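(* Let $s,m$ be positive integers. (1) Let $S=\{a_1<a_2<\cdots<a_m\}$ be a set of $m$ non-negative integers, and for a prime $p$ let $\alpha_s(S,p)$ be the number of chains of subgroups $A_m\subseteq A_{m-1}\subseteq\cdots\subseteq A_1\subseteq\mathbb{Z}^s$ with $[\mathbb{Z}^s:A_i]=p^{a_i}$ for $1\le i\le m$. Then $\alpha_s(S,p)$ is a polynomial in $p$ with non-negative integer coefficients (i.e. there is a polynomial $f\in\mathbb{Z}_{\ge 0}[x]$, depending only on $s$ and $S$, with $\alpha_s(S,p)=f(p)$ for every prime $p$). (2) Let $\underline{\lambda}^{(1)}\subseteq\underline{\lambda}^{(2)}\subseteq\cdots\subseteq\underline{\lambda}^{(m)}$ be partitions, each having at most $s$ parts, and for a prime $p$ let $\alpha_s(\underline{\lambda}^{(1)},\ldots,\underline{\lambda}^{(m)},p)$ be the number of chains of finite index subgroups $A_m\subseteq A_{m-1}\subseteq\cdots\subseteq A_1\subseteq\mathbb{Z}^s$ such that $\mathbb{Z}^s/A_i$ is a finite abelian $p$-group of type $\underline{\lambda}^{(i)}$ for $1\le i\le m$. Then $\alpha_s(\underline{\lambda}^{(1)},\ldots,\underline{\lambda}^{(m)},p)$ is a polynomial in $p$ with non-negative integer coefficients (depending only on $s$ and the partitions), and its sequence of coefficients is unimodal.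
   Context: A partition is a finite non-increasing sequence of positive integers (the empty partition allowed). For partitions $\underline{\lambda}=(\lambda_1\geq\cdots\geq\lambda_k)$ and $\underline{\mu}=(\mu_1\geq\cdots\geq\mu_l)$, $\underline{\mu}\subseteq\underline{\lambda}$ means $l\le k$ and $\mu_i\le\lambda_i$ for $1\le i\le l$. A finite abelian $p$-group is of type $\underline{\lambda}$ if it is isomorphic to $\bigoplus_{i=1}^k\mathbb{Z}/p^{\lambda_i}\mathbb{Z}$. A sequence $c_0,\ldots,c_M$ of reals is unimodal if there is an index $0\le j\le M$ with $c_0\le c_1\le\cdots\le c_j\ge c_{j+1}\ge\cdots\ge c_M$. *)

theory Defs
  imports
    "HOL-Algebra.Product_Groups"
    "HOL-Computational_Algebra.Polynomial"
    "HOL-Computational_Algebra.Primes"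
begin

text \<open>The elements of \<open>int_lattice s\<close> are the functions on \<open>{..<s}\<close> (undefined elsewhere)
  with integer values.\<close>

definition int_lattice :: "nat \<Rightarrow> (nat \<Rightarrow> int) monoid" where
  "int_lattice s = product_group {..<s} (\<lambda>_. integer_group)"

definition is_partition :: "nat list \<Rightarrow> bool" where
  "is_partition ls \<longleftrightarrow> sorted_wrt (\<ge>) ls \<and> (\<forall>x\<in>set ls. 0 < x)"

definition partition_le :: "nat list \<Rightarrow> nat list \<Rightarrow> bool" where
  "partition_le ks ls \<longleftrightarrow>
     length ks \<le> length ls \<and> (\<forall>i<length ks. ks ! i \<le> ls ! i)"

text \<open>The direct sum has finitely many summands, so it is the direct product. The condition makes
  \<open>G\<close> a finite abelian \<open>p\<close>-group when \<open>p\<close> is prime.\<close>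

definition has_type :: "nat \<Rightarrow> nat list \<Rightarrow> ('a, 'b) monoid_scheme \<Rightarrow> bool" where
  "has_type p ls G \<longleftrightarrow>
     G \<cong> product_group {..<length ls} (\<lambda>i. integer_mod_group (p ^ (ls ! i)))"

text \<open>A chain \<open>A\<^sub>m \<subseteq> \<dots> \<subseteq> A\<^sub>1\<close> is the list \<open>[A\<^sub>1, \<dots>, A\<^sub>m]\<close>, so the
  subgroup \<open>A\<^sub>i\<close> has list index \<open>i - 1\<close>.\<close>

definition subgroup_chains :: "nat \<Rightarrow> nat \<Rightarrow> (nat \<Rightarrow> int) set list set" where
  "subgroup_chains s m =
     {As. length As = m \<and> (\<forall>i<m. subgroup (As ! i) (int_lattice s)) \<and>
          (\<forall>i. Suc i < m \<longrightarrow> As ! Suc i \<subseteq> As ! i)}"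

text \<open>An infinite set has cardinality 0, so a cardinality \<open>p ^ a\<close> with \<open>p > 0\<close> also says that
  the index is finite.\<close>

definition alpha_index :: "nat \<Rightarrow> nat set \<Rightarrow> nat \<Rightarrow> nat" where
  "alpha_index s S p =
     card {As \<in> subgroup_chains s (card S).
             \<forall>i<card S. card (rcosets\<^bsub>int_lattice s\<^esub> (As ! i)) = p ^ (sorted_list_of_set S ! i)}"

definition alpha_type :: "nat \<Rightarrow> nat list list \<Rightarrow> nat \<Rightarrow> nat" where
  "alpha_type s \<Lambda> p =
     card {As \<in> subgroup_chains s (length \<Lambda>).
             \<forall>i<length \<Lambda>. finite (rcosets\<^bsub>int_lattice s\<^esub> (As ! i)) \<and>
               has_type p (\<Lambda> ! i) (int_lattice s Mod (As ! i))}"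

definition unimodal :: "(nat \<Rightarrow> real) \<Rightarrow> nat \<Rightarrow> bool" where
  "unimodal c M \<longleftrightarrow>
     (\<exists>j\<le>M. (\<forall>i<j. c i \<le> c (Suc i)) \<and> (\<forall>i. j \<le> i \<and> i < M \<longrightarrow> c (Suc i) \<le> c i))"

end

theory Submission
  imports Defs Complex_Main "HOL-Library.Multiset" "HOL-Algebra.FiniteProduct"
begin

text \<open>Let \<open>q = p ^ N\<close> with \<open>N\<close> at least as large as all parts. Orthogonality with respect to the dot product
  modulo \<open>q\<close> matches the sublattices of \<open>\<int>\<^sup>s\<close> of cotype \<open>\<lambda>\<close> with the subgroups of \<open>(\<int>/q)\<^sup>s\<close> of
  type \<open>\<lambda>\<close> and reverses inclusions; that double orthogonals are trivial follows from counting with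
  characters. A chain thus becomes a flag of subgroups in a finite abelian group, and the number of
  flags is a product of numbers of subgroups of type \<open>\<mu>\<close> in a group of type \<open>\<lambda>\<close>. The latter is
  the number of ordered bases of type \<open>\<mu>\<close> in the big group divided by that number in a group
  of type \<open>\<mu>\<close>, which is a power of \<open>p\<close> times a product of Gaussian binomial coefficients. These are
  symmetric and unimodal by an \<open>sl\<^sub>2\<close> argument on multisets, and products of symmetric unimodal
  polynomials are symmetric unimodal. For chains with prescribed indices, sum over all types.\<close>

section \<open>Gaussian binomial coefficients\<close>

text \<open>The types are prescribed for the quotients Z^s/A_i, which are related by surjections
  rather than inclusions. Duality turns them into subgroups: the orthogonal of A_i has the type of
  Z^s/A_i, and a larger i gives a larger subgroup. When a flag is chosen from the top down, the
  number of choices for the next subgroup depends only on its type and on the type of the subgroup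
  it lies in, so the counts multiply and the types of the quotients A_i/A_(i+1) never have to be
  controlled. Division is avoided throughout. Gaussian polynomials are generating functions, hence
  of type \<open>nat poly\<close> from the start, and the quotient formulas are product identities
  in \<open>int\<close>; a positive factor is cancelled only at the end, at an actual prime.
  Symmetry about a known centre is carried along because a product of merely unimodal polynomials
  need not be unimodal. A sum over several types mixes different centres, which is why this argument
  yields only non-negative coefficients for chains with prescribed indices.\<close>

definition boxed_msets :: "nat \<Rightarrow> nat \<Rightarrow> nat multiset set" where
  "boxed_msets m n = {M. size M = m \<and> set_mset M \<subseteq> {..n}}"

lemma boxed_msets_0_left: "boxed_msets 0 n = {{#}}"
  by (auto simp: boxed_msets_def)

lemma boxed_msets_0_right: "boxed_msets m 0 = {replicate_mset m 0}"
proof -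
  have "M = replicate_mset (size M) 0" if "set_mset M \<subseteq> {0::nat}" for M
    using that by (metis set_mset_subset_singletonD)
  then show ?thesis
    by (auto simp: boxed_msets_def atMost_0 split: if_splits)
qed

lemma boxed_msets_Suc:
  "boxed_msets (Suc m) (Suc n) =
     boxed_msets (Suc m) n \<union> add_mset (Suc n) ` boxed_msets m (Suc n)" (is "?L = ?R")
proof
  show "?L \<subseteq> ?R"
  proof
    fix M assume M: "M \<in> ?L"
    show "M \<in> ?R"
    proof (cases "Suc n \<in># M")
      case True
      then obtain M' where "M = add_mset (Suc n) M'" by (metis mset_add)
      with M show ?thesis by (auto simp: boxed_msets_def)
    next
      case False
      then have "x \<noteq> Suc n" if "x \<in># M" for x using that by blast
      with M show ?thesis by (force simp: boxed_msets_def le_Suc_eq)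
    qed
  qed
  show "?R \<subseteq> ?L" by (auto simp: boxed_msets_def)
qed

lemma boxed_msets_Suc_disjoint:
  "boxed_msets (Suc m) n \<inter> add_mset (Suc n) ` boxed_msets m (Suc n) = {}"
  by (auto simp: boxed_msets_def)

lemma finite_boxed_msets [simp]: "finite (boxed_msets m n)"
proof (induction "m + n" arbitrary: m n rule: less_induct)
  case less
  then show ?case
    by (cases m; cases n)
       (auto simp: boxed_msets_0_left boxed_msets_0_right boxed_msets_Suc)
qed

text \<open>This is the Gaussian binomial coefficient of \<open>m + n\<close> over \<open>m\<close>: multisets in the box
  encode partitions with at most \<open>m\<close> parts, each at most \<open>n\<close>.\<close>

definition gauss_poly :: "nat \<Rightarrow> nat \<Rightarrow> nat poly" where
  "gauss_poly m n = (\<Sum>M\<in>boxed_msets m n. monom 1 (sum_mset M))"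

lemma gauss_poly_0_left [simp]: "gauss_poly 0 n = 1"
  by (simp add: gauss_poly_def boxed_msets_0_left monom_eq_1 del: One_nat_def)

lemma gauss_poly_0_right [simp]: "gauss_poly m 0 = 1"
  by (simp add: gauss_poly_def boxed_msets_0_right monom_eq_1 del: One_nat_def)

text \<open>The q-Pascal rule: a multiset either avoids the value \<open>Suc n\<close> or loses one
  copy of it, which lowers its sum by \<open>Suc n\<close>.\<close>

lemma gauss_poly_Suc:
  "gauss_poly (Suc m) (Suc n) = gauss_poly (Suc m) n + monom 1 (Suc n) * gauss_poly m (Suc n)"
proof -
  have "(\<Sum>M\<in>add_mset (Suc n) ` boxed_msets m (Suc n). monom (1::nat) (sum_mset M)) =
        (\<Sum>M\<in>boxed_msets m (Suc n). monom 1 (Suc n) * monom 1 (sum_mset M))"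
    by (subst sum.reindex) (auto simp: inj_on_def mult_monom)
  then show ?thesis
    unfolding gauss_poly_def boxed_msets_Suc
    by (subst sum.union_disjoint) (auto simp: boxed_msets_Suc_disjoint sum_distrib_left)
qed

text \<open>At a prime power x the right-hand product counts the independent \<open>m\<close>-tuples
  in a space of dimension \<open>m + n\<close> over the field with x elements, and the product on
  the left counts the bases of an \<open>m\<close>-dimensional space. Multiplied out, the identity
  holds for every natural x, including 0 and 1, by induction along the q-Pascal rule.\<close>

lemma gauss_poly_quotient:
  fixes x :: nat
  shows "int (poly (gauss_poly m n) x) * (\<Prod>i<m. int x ^ m - int x ^ i) =
           (\<Prod>i<m. int x ^ (m + n) - int x ^ i)"
proof (induction "m + n" arbitrary: m n rule: less_induct)
  case less
  show ?case
  proof (cases m)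
    case 0
    then show ?thesis by simp
  next
    case (Suc m')
    show ?thesis
    proof (cases n)
      case 0
      then show ?thesis by simp
    next
      case (Suc n')
      define q where "q = int x"
      define D where "D = (\<Prod>i<m'. q ^ m' - q ^ i)"
      define N where "N = (\<Prod>i<m'. q ^ (m' + n) - q ^ i)"
      have m: "m = Suc m'" by fact
      \<comment> \<open>The factor i = 0 is split off and one q is taken out of each remaining
        factor, which lowers both parameters by one.\<close>
      have shift: "(\<Prod>i<Suc k. q ^ Suc l - q ^ i) = (q ^ Suc l - 1) * q ^ k * (\<Prod>i<k. q ^ l - q ^ i)" for k l
      proof -
        have "(\<Prod>i<k. q ^ Suc l - q ^ Suc i) = (\<Prod>i<k. q * (q ^ l - q ^ i))"
          by (simp add: algebra_simps)
        also have "\<dots> = q ^ k * (\<Prod>i<k. q ^ l - q ^ i)"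
          by (simp add: prod.distrib)
        finally show ?thesis
          by (simp only: prod.lessThan_Suc_shift power_0 mult.assoc)
      qed
      have Dm: "(\<Prod>i<m. q ^ m - q ^ i) = (q ^ m - 1) * q ^ m' * D"
        using shift[where k = m' and l = m'] by (simp only: m D_def)
      have Nm: "(\<Prod>i<m. q ^ (m + n) - q ^ i) = (q ^ (m + n) - 1) * q ^ m' * N"
        using shift[where k = m' and l = "m' + n"] by (simp only: m N_def add_Suc)
      \<comment> \<open>Since \<open>m + n' = m' + n\<close>, here it is the last factor that is
        split off, and the rest is again \<open>N\<close>.\<close>
      have Nm1: "(\<Prod>i<m. q ^ (m + n') - q ^ i) = N * (q ^ (m' + n) - q ^ m')"
        by (simp add: m N_def \<open>n = Suc n'\<close>)
      have IH1: "int (poly (gauss_poly m n') x) * (\<Prod>i<m. q ^ m - q ^ i) = (\<Prod>i<m. q ^ (m + n') - q ^ i)"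
        using less[of m n'] \<open>n = Suc n'\<close> by (simp add: q_def)
      have IH2: "int (poly (gauss_poly m' n) x) * D = N"
        using less[of m' n] by (simp add: m D_def N_def q_def)
      have "int (poly (gauss_poly m n) x) =
              int (poly (gauss_poly m n') x) + q ^ n * int (poly (gauss_poly m' n) x)"
        by (simp add: m \<open>n = Suc n'\<close> gauss_poly_Suc poly_monom q_def)
      then have "int (poly (gauss_poly m n) x) * (\<Prod>i<m. q ^ m - q ^ i) =
          int (poly (gauss_poly m n') x) * (\<Prod>i<m. q ^ m - q ^ i) +
          q ^ n * ((q ^ m - 1) * q ^ m') * (int (poly (gauss_poly m' n) x) * D)"
        by (simp add: Dm algebra_simps)
      also have "\<dots> = N * (q ^ (m' + n) - q ^ m') + q ^ n * ((q ^ m - 1) * q ^ m') * N"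
        by (simp only: IH1 IH2 Nm1)
      also have "\<dots> = (q ^ (m + n) - 1) * q ^ m' * N"
        by (simp add: power_add algebra_simps)
      finally show ?thesis
        by (simp only: Nm flip: q_def)
    qed
  qed
qed

lemma coeff_gauss_poly:
  "coeff (gauss_poly m n) i = card {M \<in> boxed_msets m n. sum_mset M = i}"
proof -
  have "coeff (gauss_poly m n) i = (\<Sum>M\<in>boxed_msets m n. if sum_mset M = i then 1 else 0)"
    by (simp add: gauss_poly_def coeff_sum del: One_nat_def)
  also have "\<dots> = card {M \<in> boxed_msets m n. sum_mset M = i}"
    by (simp add: sum.If_cases Int_def)
  finally show ?thesis .
qed

section \<open>Unimodality of the Gaussian coefficients through an sl2 action\<close>

lemma linear_functionals_common_zero:
  fixes l :: "'b \<Rightarrow> ('a \<Rightarrow> real) \<Rightarrow> real"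
  assumes "finite B" "finite A" "card B < card A"
    and "\<And>b f g c d. b \<in> B \<Longrightarrow> l b (\<lambda>a. c * f a + d * g a) = c * l b f + d * l b g"
  shows "\<exists>f. (\<exists>a\<in>A. f a \<noteq> 0) \<and> (\<forall>a. a \<notin> A \<longrightarrow> f a = 0) \<and> (\<forall>b\<in>B. l b f = 0)"
  using assms
proof (induction B arbitrary: A rule: finite_induct)
  case empty
  then obtain a where "a \<in> A" by fastforce
  then show ?case
    by (intro exI[of _ "\<lambda>x. if x = a then 1 else 0"]) auto
next
  case (insert b B)
  have lin: "l b' (\<lambda>a. c * f a + d * g a) = c * l b' f + d * l b' g" if "b' \<in> insert b B" for b' c d f g
    using insert.prems(3) that by blast
  have IH: "\<exists>f. (\<exists>a\<in>A'. f a \<noteq> 0) \<and> (\<forall>a. a \<notin> A' \<longrightarrow> f a = 0) \<and> (\<forall>b\<in>B. l b f = 0)"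
    if "finite A'" "card B < card A'" for A'
    using insert.IH[OF that] lin by blast
  obtain f a1 where f: "a1 \<in> A" "f a1 \<noteq> 0" "\<forall>a. a \<notin> A \<longrightarrow> f a = 0" "\<forall>b\<in>B. l b f = 0"
    using IH[of A] insert.prems insert.hyps by auto
  have "card B < card (A - {a1})"
    using insert.prems insert.hyps f(1) by simp
  then obtain g a2 where g: "a2 \<in> A - {a1}" "g a2 \<noteq> 0" "\<forall>a. a \<notin> A - {a1} \<longrightarrow> g a = 0" "\<forall>b\<in>B. l b g = 0"
    using IH[of "A - {a1}"] insert.prems by auto
  show ?case
  proof (cases "l b f = 0")
    case True
    then show ?thesis using f by (intro exI[of _ f]) auto
  next
    case False
    \<comment> \<open>The combination is built to kill \<open>l b\<close>. It is not zero because g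
      vanishes at a1: look at a1 if \<open>l b g\<close> is non-zero and at a2 otherwise.\<close>
    let ?h = "\<lambda>a. l b g * f a + (- l b f) * g a"
    have "\<forall>b'\<in>insert b B. l b' ?h = 0"
    proof
      fix b' assume "b' \<in> insert b B"
      then have "l b' ?h = l b g * l b' f + (- l b f) * l b' g" by (rule lin)
      moreover have "l b' f = 0 \<and> l b' g = 0 \<or> b' = b"
        using f(4) g(4) \<open>b' \<in> insert b B\<close> by blast
      ultimately show "l b' ?h = 0" by fastforce
    qed
    moreover have "\<exists>a\<in>A. ?h a \<noteq> 0"
    proof (cases "l b g = 0")
      case True
      then show ?thesis using False g by (intro bexI[of _ a2]) auto
    next
      case False
      then show ?thesis using f g(3) by (intro bexI[of _ a1]) auto
    qed
    moreover have "\<forall>a. a \<notin> A \<longrightarrow> ?h a = 0"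
      using f(3) g(3) by simp
    ultimately show ?thesis by (intro exI[of _ ?h] conjI)
  qed
qed

text \<open>The lowering and raising operators of \<open>sl\<^sub>2\<close> on the \<open>m\<close>-th symmetric power of its irreducible
  representation with weights \<open>n - 2 * v\<close> for \<open>v \<le> n\<close>.\<close>

definition lower_op :: "(nat multiset \<Rightarrow> real) \<Rightarrow> nat multiset \<Rightarrow> real" where
  "lower_op f M = (\<Sum>v\<in>#M. real v * f (add_mset (v - 1) (M - {#v#})))"

definition raise_op :: "nat \<Rightarrow> (nat multiset \<Rightarrow> real) \<Rightarrow> nat multiset \<Rightarrow> real" where
  "raise_op n f M = (\<Sum>v\<in>#M. (real n - real v) * f (add_mset (Suc v) (M - {#v#})))"

lemma lower_op_linear:
  "lower_op (\<lambda>M. c * f M + d * g M) M = c * lower_op f M + d * lower_op g M"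
  unfolding lower_op_def
  by (simp add: algebra_simps sum_mset.distrib sum_mset_distrib_left)

lemma raise_op_scale: "raise_op n (\<lambda>M. c * f M) M = c * raise_op n f M"
  unfolding raise_op_def by (simp add: algebra_simps sum_mset_distrib_left)

text \<open>Removing one occurrence of v leaves a sum over ordered pairs of distinct positions. Both
  sides are a full double sum minus the same diagonal.\<close>

lemma sum_mset_pairs_swap:
  fixes F :: "'a \<Rightarrow> 'a \<Rightarrow> real"
  shows "(\<Sum>v\<in>#M. \<Sum>u\<in>#M - {#v#}. F v u) = (\<Sum>v\<in>#M. \<Sum>u\<in>#M - {#v#}. F u v)"
proof -
  have diff: "(\<Sum>u\<in>#M - {#v#}. H u) = (\<Sum>u\<in>#M. H u) - H v" if "v \<in># M" for v and H :: "'a \<Rightarrow> real"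
    using that by (metis (no_types, lifting) add_diff_cancel_left' insert_DiffM image_mset_add_mset sum_mset.add_mset)
  have "(\<Sum>v\<in>#M. \<Sum>u\<in>#M - {#v#}. F v u) = (\<Sum>v\<in>#M. (\<Sum>u\<in>#M. F v u) - F v v)"
    by (rule arg_cong[of _ _ sum_mset], rule image_mset_cong) (simp add: diff)
  also have "\<dots> = (\<Sum>v\<in>#M. \<Sum>u\<in>#M. F v u) + (\<Sum>v\<in>#M. - F v v)"
    by (simp flip: sum_mset.distrib)
  also have "(\<Sum>v\<in>#M. \<Sum>u\<in>#M. F v u) = (\<Sum>v\<in>#M. \<Sum>u\<in>#M. F u v)"
    by (rule sum_mset.swap)
  also have "\<dots> + (\<Sum>v\<in>#M. - F v v) = (\<Sum>v\<in>#M. (\<Sum>u\<in>#M. F u v) - F v v)"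
    by (simp flip: sum_mset.distrib)
  also have "\<dots> = (\<Sum>v\<in>#M. \<Sum>u\<in>#M - {#v#}. F u v)"
    by (rule arg_cong[of _ _ sum_mset], rule image_mset_cong) (simp add: diff)
  finally show ?thesis .
qed

text \<open>The sl2 commutator relation. Terms that raise one entry and lower another occur in both
  orders and cancel; moving the same entry back and forth leaves (n - v)(v + 1) - v(n - v + 1) = n -
  2v, and these weights add up over M.\<close>

lemma raise_lower_commutator:
  "raise_op n (lower_op f) M =
     lower_op (raise_op n f) M + (real n * real (size M) - 2 * real (sum_mset M)) * f M"
proof -
  \<comment> \<open>The cross term: the entry v is raised and an entry u at another position is
    lowered.\<close>
  define F where "F v u = (real n - real v) * (real u *
      f (add_mset (u - 1) (add_mset (Suc v) (M - {#v#} - {#u#}))))" for v u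
  have 1: "(real n - real v) * lower_op f (add_mset (Suc v) (M - {#v#})) =
      (real n - real v) * (real v + 1) * f M + (\<Sum>u\<in>#M - {#v#}. F v u)" if v: "v \<in># M" for v
  proof -
    have "lower_op f (add_mset (Suc v) (M - {#v#})) =
       (real v + 1) * f M +
       (\<Sum>u\<in>#M - {#v#}. real u * f (add_mset (u - 1) (add_mset (Suc v) (M - {#v#}) - {#u#})))"
      using v by (simp add: lower_op_def add.commute)
    also have "(\<Sum>u\<in>#M - {#v#}. real u * f (add_mset (u - 1) (add_mset (Suc v) (M - {#v#}) - {#u#})))
      = (\<Sum>u\<in>#M - {#v#}. real u * f (add_mset (u - 1) (add_mset (Suc v) (M - {#v#} - {#u#}))))"
      by (rule arg_cong[of _ _ sum_mset], rule image_mset_cong)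
         (metis diff_union_swap2 add_mset_remove_trivial_If multi_drop_mem_not_eq insert_DiffM add_mset_commute add_mset_remove_trivial)
    finally show ?thesis
      by (simp add: F_def sum_mset_distrib_left algebra_simps)
  qed
  have 2: "real u * raise_op n f (add_mset (u - 1) (M - {#u#})) =
      real u * (real n - real u + 1) * f M + (\<Sum>v\<in>#M - {#u#}. F v u)" if u: "u \<in># M" for u
  proof (cases u)
    case 0
    \<comment> \<open>The factor \<open>real u\<close> is zero here, so the truncated
      \<open>u - 1\<close> does no harm.\<close>
    then show ?thesis by (simp add: F_def)
  next
    case (Suc w)
    have "raise_op n f (add_mset w (M - {#u#})) =
       (real n - real w) * f M +
       (\<Sum>v\<in>#M - {#u#}. (real n - real v) * f (add_mset (Suc v) (add_mset w (M - {#u#}) - {#v#})))"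
      using u Suc by (simp add: raise_op_def)
    also have "(\<Sum>v\<in>#M - {#u#}. (real n - real v) * f (add_mset (Suc v) (add_mset w (M - {#u#}) - {#v#})))
      = (\<Sum>v\<in>#M - {#u#}. (real n - real v) * f (add_mset w (add_mset (Suc v) (M - {#v#} - {#u#}))))"
    proof (rule arg_cong[of _ _ sum_mset], rule image_mset_cong)
      fix v assume v: "v \<in># M - {#u#}"
      then obtain K where K: "M - {#u#} = add_mset v K" by (metis mset_add)
      have "M - {#v#} - {#u#} = K"
        using K by (metis add_mset_remove_trivial diff_right_commute)
      then show "(real n - real v) * f (add_mset (Suc v) (add_mset w (M - {#u#}) - {#v#})) =
        (real n - real v) * f (add_mset w (add_mset (Suc v) (M - {#v#} - {#u#})))"
        using K by (simp add: add_mset_commute)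
    qed
    finally have eq: "raise_op n f (add_mset (u - 1) (M - {#u#})) = (real n - real w) * f M +
       (\<Sum>v\<in>#M - {#u#}. (real n - real v) * f (add_mset w (add_mset (Suc v) (M - {#v#} - {#u#}))))"
      using Suc by simp
    have "real n - real u + 1 = real n - real w"
      using Suc by simp
    moreover have "(\<Sum>v\<in>#M - {#u#}. F v u) =
       real u * (\<Sum>v\<in>#M - {#u#}. (real n - real v) * f (add_mset w (add_mset (Suc v) (M - {#v#} - {#u#}))))"
      using Suc by (simp add: F_def sum_mset_distrib_left mult.left_commute)
    ultimately show ?thesis by (simp only: eq distrib_left mult.assoc)
  qed
  have "raise_op n (lower_op f) M =
     (\<Sum>v\<in>#M. (real n - real v) * (real v + 1) * f M + (\<Sum>u\<in>#M - {#v#}. F v u))"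
    unfolding raise_op_def
    by (rule arg_cong[of _ _ sum_mset], rule image_mset_cong) (simp add: 1)
  also have "\<dots> = (\<Sum>v\<in>#M. (real n - real v) * (real v + 1) * f M) + (\<Sum>v\<in>#M. \<Sum>u\<in>#M - {#v#}. F v u)"
    by (simp add: sum_mset.distrib)
  also have "(\<Sum>v\<in>#M. (real n - real v) * (real v + 1) * f M) =
     (\<Sum>u\<in>#M. real u * (real n - real u + 1) * f M) + (\<Sum>u\<in>#M. (real n - 2 * real u) * f M)"
    by (simp add: algebra_simps flip: sum_mset.distrib)
  also have "(\<Sum>u\<in>#M. (real n - 2 * real u) * f M) =
      (real n * real (size M) - 2 * real (sum_mset M)) * f M"
  proof -
    have "(\<Sum>u\<in>#M. (real n - 2 * real u) * c) =
        (real n * real (size M) - 2 * real (sum_mset M)) * c" for c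
      by (induction M) (simp_all add: algebra_simps)
    then show ?thesis .
  qed
  also have "(\<Sum>v\<in>#M. \<Sum>u\<in>#M - {#v#}. F v u) = (\<Sum>u\<in>#M. \<Sum>v\<in>#M - {#u#}. F v u)"
    by (rule sum_mset_pairs_swap)
  finally have "raise_op n (lower_op f) M =
     (\<Sum>u\<in>#M. real u * (real n - real u + 1) * f M + (\<Sum>v\<in>#M - {#u#}. F v u)) +
     (real n * real (size M) - 2 * real (sum_mset M)) * f M"
    by (simp add: sum_mset.distrib)
  also have "(\<Sum>u\<in>#M. real u * (real n - real u + 1) * f M + (\<Sum>v\<in>#M - {#u#}. F v u)) =
     lower_op (raise_op n f) M"
    unfolding lower_op_def
    by (rule arg_cong[of _ _ sum_mset], rule image_mset_cong) (simp add: 2 del: One_nat_def)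
  finally show ?thesis .
qed

text \<open>Raising an entry v = n would leave the box, but its coefficient n - v is zero; hence
  only values inside the box matter.\<close>

lemma raise_op_cong:
  assumes "\<And>M. M \<in> boxed_msets m n \<Longrightarrow> f M = g M" "M \<in> boxed_msets m n"
  shows "raise_op n f M = raise_op n g M"
  unfolding raise_op_def
proof (rule arg_cong[of _ _ sum_mset], rule image_mset_cong)
  fix v assume v: "v \<in># M"
  show "(real n - real v) * f (add_mset (Suc v) (M - {#v#})) =
        (real n - real v) * g (add_mset (Suc v) (M - {#v#}))"
  proof (cases "v = n")
    case False
    with v assms(2) have "v < n" by (auto simp: boxed_msets_def)
    moreover have "size M = Suc (size (M - {#v#}))"
      using v by (metis insert_DiffM size_add_mset)
    ultimately have "add_mset (Suc v) (M - {#v#}) \<in> boxed_msets m n"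
      using v assms(2) by (auto simp: boxed_msets_def dest: in_diffD)
    then show ?thesis by (simp add: assms(1))
  qed simp
qed

text \<open>As \<open>lower_op f M\<close> reads f at multisets of sum one less, it carries
  functions supported on sum i to functions supported on sum i + 1. A function in the kernel is an
  extremal vector of weight mn - 2i > 0, so applying \<open>raise_op\<close> k > 0 times and then
  \<open>lower_op\<close> gives a non-zero multiple of its image under k - 1 applications of
  \<open>raise_op\<close>. These images must end, because sums cannot become negative, and therefore
  all of them vanish, down to f itself.\<close>

lemma lower_op_injective:
  assumes i: "2 * i < m * n"
    and f0: "\<And>M. \<not> (M \<in> boxed_msets m n \<and> sum_mset M = i) \<Longrightarrow> f M = 0"
    and l0: "\<And>M. M \<in> boxed_msets m n \<Longrightarrow> sum_mset M = Suc i \<Longrightarrow> lower_op f M = 0"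
  shows "f M = 0"
proof -
  define F where "F k = (raise_op n ^^ k) f" for k
  have F_Suc: "F (Suc k) = raise_op n (F k)" for k
    by (simp add: F_def)
  \<comment> \<open>\<open>r\<close> solves r(k + 1) = r(k) + (mn - 2i + 2k); the increment is the
    weight at sum i - k, contributed by the commutator.\<close>
  define r where "r k = real k * (real m * real n - 2 * real i + real k - 1)" for k
  have rpos: "r (Suc k) > 0" for k
  proof -
    have "real (2 * i) < real (m * n)" using i by linarith
    then show ?thesis by (simp add: r_def)
  qed
  have sum_remove: "sum_mset M = v + sum_mset (M - {#v#})" if "v \<in># M" for v and M :: "nat multiset"
    using that by (metis insert_DiffM sum_mset.add_mset)
  have supp: "F k M = 0" if "M \<in> boxed_msets m n" "sum_mset M + k \<noteq> i" for k M
    using that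
  proof (induction k arbitrary: M)
    case 0
    then show ?case by (simp add: F_def f0)
  next
    case (Suc k)
    \<comment> \<open>By the induction hypothesis \<open>F k\<close> agrees with \<open>?g\<close>
      on the box, and \<open>raise_op\<close> at M reads only multisets of sum one larger, where
      \<open>?g\<close> is zero by definition.\<close>
    let ?g = "\<lambda>M'. if sum_mset M' = Suc (sum_mset M) then 0 else F k M'"
    have "F (Suc k) M = raise_op n ?g M"
      unfolding F_Suc by (rule raise_op_cong[of m]) (use Suc in auto)
    also have "\<dots> = (\<Sum>v\<in>#M. 0)"
      unfolding raise_op_def
      by (rule arg_cong[of _ _ sum_mset], rule image_mset_cong) (simp add: sum_remove[of _ M])
    finally show ?case by simp
  qed
  have "lower_op (F 0) M = 0" if M: "M \<in> boxed_msets m n" for M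
  proof (cases "sum_mset M = Suc i")
    case True
    then show ?thesis using M l0 by (simp add: F_def)
  next
    case False
    have "lower_op (F 0) M = (\<Sum>v\<in>#M. 0)"
      unfolding lower_op_def
    proof (rule arg_cong[of _ _ sum_mset], rule image_mset_cong)
      fix v assume v: "v \<in># M"
      show "real v * F 0 (add_mset (v - 1) (M - {#v#})) = 0"
      proof (cases v)
        case (Suc w)
        then have "sum_mset (add_mset (v - 1) (M - {#v#})) \<noteq> i"
          using False sum_remove[OF v] by auto
        then show ?thesis using f0 by (simp add: F_def)
      qed simp
    qed
    then show ?thesis by simp
  qed
  then have lower: "lower_op (F k) M = - r k * F (k - 1) M" if "M \<in> boxed_msets m n" for k M
    using that
  proof (induction k arbitrary: M)
    case 0
    \<comment> \<open>\<open>r 0 = 0\<close> makes the truncated index \<open>k - 1\<close> harmless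
      at k = 0.\<close>
    then show ?case by (simp add: r_def)
  next
    case (Suc k)
    have "raise_op n (lower_op (F k)) M = raise_op n (\<lambda>M. - r k * F (k - 1) M) M"
      by (rule raise_op_cong[of m]) (use Suc in auto)
    also have "\<dots> = - r k * raise_op n (F (k - 1)) M"
      by (rule raise_op_scale)
    also have "\<dots> = - r k * F k M"
      by (cases k) (simp_all add: r_def F_Suc)
    finally have "lower_op (F (Suc k)) M =
        - r k * F k M - (real n * real (size M) - 2 * real (sum_mset M)) * F k M"
      using raise_lower_commutator[of n "F k" M] by (simp add: F_Suc)
    moreover have "size M = m"
      using Suc.prems(2) by (simp add: boxed_msets_def)
    moreover have "(real n * real m - 2 * real (sum_mset M)) * F k M =
        (real n * real m - 2 * (real i - real k)) * F k M"
      using supp[of M k] Suc.prems by (cases "sum_mset M + k = i") auto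
    ultimately show ?case
      by (simp add: r_def algebra_simps)
  qed
  \<comment> \<open>Downward induction: \<open>F (Suc i)\<close> vanishes on the box since its
    support would need a negative sum, and if \<open>F (Suc k)\<close> vanishes, so does its image
    under \<open>lower_op\<close>, a multiple of \<open>F k\<close> by the non-zero
    \<open>r (Suc k)\<close>.\<close>
  have "\<forall>M\<in>boxed_msets m n. F (Suc i - j) M = 0" if "j \<le> Suc i" for j
    using that
  proof (induction j)
    case 0
    then show ?case using supp[of _ "Suc i"] by auto
  next
    case (Suc j)
    define k where "k = i - j"
    have k: "Suc i - j = Suc k" "Suc i - Suc j = k" using Suc.prems by (auto simp: k_def)
    show ?case unfolding k
    proof
      fix M assume M: "M \<in> boxed_msets m n"
      have "lower_op (F (Suc k)) M = (\<Sum>v\<in>#M. 0)"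
        unfolding lower_op_def
      proof (rule arg_cong[of _ _ sum_mset], rule image_mset_cong)
        fix v assume v: "v \<in># M"
        then have "size M = Suc (size (M - {#v#}))"
          by (metis insert_DiffM size_add_mset)
        then have "add_mset (v - 1) (M - {#v#}) \<in> boxed_msets m n"
          using v M by (auto simp: boxed_msets_def dest: in_diffD)
        then show "real v * F (Suc k) (add_mset (v - 1) (M - {#v#})) = 0"
          using Suc.IH Suc.prems k by simp
      qed
      then show "F k M = 0"
        using lower[OF M, of "Suc k"] rpos[of k] by simp
    qed
  qed
  from this[of "Suc i"] have "\<forall>M\<in>boxed_msets m n. f M = 0"
    by (simp add: F_def)
  then show ?thesis using f0 by blast
qed

text \<open>If the coefficient dropped, there would be more unknowns (multisets of sum i) than
  equations (multisets of sum i + 1), and \<open>lower_op\<close> would kill a non-zero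
  function.\<close>

lemma coeff_gauss_poly_mono:
  assumes "2 * i < m * n"
  shows "coeff (gauss_poly m n) i \<le> coeff (gauss_poly m n) (Suc i)"
proof (rule ccontr)
  define A where "A j = {M \<in> boxed_msets m n. sum_mset M = j}" for j
  assume "\<not> ?thesis"
  then have "card (A (Suc i)) < card (A i)"
    by (simp add: coeff_gauss_poly A_def)
  moreover have "finite (A j)" for j by (simp add: A_def)
  ultimately obtain f where f: "\<exists>M\<in>A i. f M \<noteq> 0" "\<forall>M. M \<notin> A i \<longrightarrow> f M = 0"
      "\<forall>M\<in>A (Suc i). lower_op f M = 0"
    using linear_functionals_common_zero[of "A (Suc i)" "A i" "\<lambda>M f. lower_op f M"] lower_op_linear
    by blast
  have "f M = 0" for M
    by (rule lower_op_injective[OF assms]) (use f(2,3) in \<open>auto simp: A_def\<close>)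
  with f(1) show False by blast
qed

text \<open>Complementing every entry, v to n - v, is an involution of the box that exchanges the
  sums i and mn - i.\<close>

lemma coeff_gauss_poly_symmetric:
  assumes "i \<le> m * n"
  shows "coeff (gauss_poly m n) (m * n - i) = coeff (gauss_poly m n) i"
proof -
  define r where "r = image_mset (\<lambda>v. n - v)"
  have sum_r: "sum_mset (r M) + sum_mset M = m * n" and r_boxed: "r M \<in> boxed_msets m n"
    and rr: "r (r M) = M" if M: "M \<in> boxed_msets m n" for M
  proof -
    have "sum_mset (r M) + sum_mset M = (\<Sum>v\<in>#M. n - v + v)"
      by (simp add: r_def sum_mset.distrib)
    also have "image_mset (\<lambda>v. n - v + v) M = image_mset (\<lambda>_. n) M"
      by (rule image_mset_cong) (use M in \<open>auto simp: boxed_msets_def\<close>)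
    finally show "sum_mset (r M) + sum_mset M = m * n"
      using M by (simp add: boxed_msets_def)
    show "r M \<in> boxed_msets m n"
      using M by (auto simp: boxed_msets_def r_def)
    have "image_mset (\<lambda>v. n - (n - v)) M = image_mset (\<lambda>v. v) M"
      by (rule image_mset_cong) (use M in \<open>auto simp: boxed_msets_def\<close>)
    then show "r (r M) = M"
      by (simp add: r_def image_mset.compositionality comp_def)
  qed
  have "bij_betw r {M \<in> boxed_msets m n. sum_mset M = i} {M \<in> boxed_msets m n. sum_mset M = m * n - i}"
  proof (rule bij_betw_byWitness[where f' = r])
    show "\<forall>M\<in>{M \<in> boxed_msets m n. sum_mset M = i}. r (r M) = M"
      "\<forall>M\<in>{M \<in> boxed_msets m n. sum_mset M = m * n - i}. r (r M) = M"
      by (simp_all add: rr)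
    show "r ` {M \<in> boxed_msets m n. sum_mset M = i} \<subseteq> {M \<in> boxed_msets m n. sum_mset M = m * n - i}"
      using r_boxed sum_r by force
    show "r ` {M \<in> boxed_msets m n. sum_mset M = m * n - i} \<subseteq> {M \<in> boxed_msets m n. sum_mset M = i}"
      using r_boxed sum_r assms by force
  qed
  then show ?thesis
    by (simp add: coeff_gauss_poly bij_betw_same_card)
qed

lemma coeff_gauss_poly_eq_0:
  assumes "i > m * n"
  shows "coeff (gauss_poly m n) i = 0"
proof -
  have "sum_mset M \<le> m * n" if "M \<in> boxed_msets m n" for M
  proof -
    have "sum_mset M \<le> (\<Sum>v\<in>#M. n)"
      using that sum_mset_mono[of M "\<lambda>v. v" "\<lambda>_. n"] by (auto simp: boxed_msets_def)
    then show ?thesis using that by (simp add: boxed_msets_def)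
  qed
  then show ?thesis using assms by (force simp: coeff_gauss_poly)
qed

section \<open>Symmetric unimodal polynomials\<close>

text \<open>\<open>d\<close> is twice the centre of symmetry and may exceed the degree:
  \<open>monom 1 k\<close> is used with d = 2k. With the centre recorded this way, the values of
  \<open>d\<close> add under multiplication, and zero qualifies for every \<open>d\<close>.\<close>

definition sym_unimodal :: "nat \<Rightarrow> nat poly \<Rightarrow> bool" where
  "sym_unimodal d f \<longleftrightarrow>
     (\<forall>i>d. coeff f i = 0) \<and> (\<forall>i\<le>d. coeff f (d - i) = coeff f i) \<and>
     (\<forall>i. 2 * i < d \<longrightarrow> coeff f i \<le> coeff f (Suc i))"

lemma sym_unimodal_gauss_poly: "sym_unimodal (m * n) (gauss_poly m n)"
  by (simp add: sym_unimodal_def coeff_gauss_poly_mono coeff_gauss_poly_symmetric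
      coeff_gauss_poly_eq_0)

lemma sym_unimodal_monom: "sym_unimodal (2 * k) (monom 1 k)"
  by (auto simp: sym_unimodal_def coeff_monom)

lemma sym_unimodal_0: "sym_unimodal d 0"
  by (simp add: sym_unimodal_def)

text \<open>Extending the coefficients by zero to all integers makes the reindexings in the
  convolution unconditional.\<close>

definition int_coeff :: "nat poly \<Rightarrow> int \<Rightarrow> int" where
  "int_coeff f k = (if k < 0 then 0 else int (coeff f (nat k)))"

text \<open>The conditions \<open>b \<le> a\<close> and \<open>a + b \<le> int d\<close> say that a
  is at least as close to the centre as b, and that b lies on the left. One inequality thus covers
  indices on both slopes and outside the range.\<close>

lemma sym_unimodal_int_coeff:
  assumes "sym_unimodal d f"
  shows "int_coeff f (int d - k) = int_coeff f k"
    and "b \<le> a \<Longrightarrow> a + b \<le> int d \<Longrightarrow> int_coeff f b \<le> int_coeff f a"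
proof -
  have out: "coeff f i = 0" if "i > d" for i using assms that by (simp add: sym_unimodal_def)
  have symm: "coeff f (d - i) = coeff f i" if "i \<le> d" for i using assms that by (simp add: sym_unimodal_def)
  show symi: "int_coeff f (int d - k) = int_coeff f k" for k
  proof -
    consider "k < 0" | "k > int d" | "0 \<le> k" "k \<le> int d" by linarith
    then show ?thesis
    proof cases
      case 3
      then have "nat (int d - k) = d - nat k" by linarith
      with 3 show ?thesis using symm[of "nat k"] by (simp add: int_coeff_def)
    qed (auto simp: int_coeff_def out)
  qed
  have chain: "int_coeff f b \<le> int_coeff f a" if "0 \<le> b" "b \<le> a" "2 * a \<le> int d" for a b
  proof -
    have "coeff f (nat b) \<le> coeff f (nat b + j)" if "2 * (nat b + j) \<le> d" for j
      using that
    proof (induction j)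
      case (Suc j)
      then have "coeff f (nat b + j) \<le> coeff f (Suc (nat b + j))"
        using assms by (simp add: sym_unimodal_def)
      with Suc show ?case by simp
    qed simp
    from this[of "nat (a - b)"] that show ?thesis
      by (simp add: int_coeff_def nat_diff_distrib)
  qed
  show "int_coeff f b \<le> int_coeff f a" if "b \<le> a" "a + b \<le> int d"
  proof (cases "b < 0")
    case True
    then show ?thesis by (simp add: int_coeff_def)
  next
    case False
    show ?thesis
    proof (cases "2 * a \<le> int d")
      case True
      then show ?thesis using chain that False by simp
    next
      case 2: False
      then have "int_coeff f b \<le> int_coeff f (int d - a)"
        using False that by (intro chain) auto
      then show ?thesis by (simp add: symi)
    qed
  qed
qed

lemma int_coeff_mult:
  assumes "\<And>k. k > d \<Longrightarrow> coeff g k = 0"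
  shows "int_coeff (f * g) n = (\<Sum>k\<in>{0..int d}. int_coeff g k * int_coeff f (n - k))"
proof (cases "n < 0")
  case True
  then show ?thesis by (simp add: int_coeff_def)
next
  case False
  define N where "N = nat n"
  have n: "n = int N" using False by (simp add: N_def)
  have "int_coeff (f * g) n = (\<Sum>k\<le>N. int (coeff g k) * int (coeff f (N - k)))"
    by (simp add: n int_coeff_def coeff_mult mult.commute[of f g])
  also have "\<dots> = (\<Sum>k\<le>N. int_coeff g (int k) * int_coeff f (n - int k))"
    by (rule sum.cong) (auto simp: n int_coeff_def nat_diff_distrib)
  also have "\<dots> = (\<Sum>k\<le>N + d. int_coeff g (int k) * int_coeff f (n - int k))"
    by (rule sum.mono_neutral_left) (auto simp: n int_coeff_def)
  also have "\<dots> = (\<Sum>k\<le>d. int_coeff g (int k) * int_coeff f (n - int k))"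
    by (rule sum.mono_neutral_right) (auto simp: int_coeff_def assms)
  also have "\<dots> = (\<Sum>k\<in>int ` {..d}. int_coeff g k * int_coeff f (n - k))"
    by (simp add: sum.reindex)
  also have "int ` {..d} = {0..int d}"
    by (simp add: atMost_atLeast0 image_int_atLeastAtMost)
  finally show ?thesis .
qed

text \<open>The difference of consecutive coefficients of the product is a convolution of
  \<open>F\<close> with the differences \<open>\<delta>\<close> of \<open>G\<close>. Since
  \<open>\<delta>\<close> is antisymmetric, averaging with the reflected sum makes every term a
  product of two factors of equal sign.\<close>

lemma sym_unimodal_mult:
  assumes f: "sym_unimodal d f" and g: "sym_unimodal e g"
  shows "sym_unimodal (d + e) (f * g)"
proof -
  define F G where "F = int_coeff f" and "G = int_coeff g"
  note F = sym_unimodal_int_coeff[OF f, folded F_def]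
  note G = sym_unimodal_int_coeff[OF g, folded G_def]
  have G_out: "G k = 0" if "k < 0 \<or> k > int e" for k
    using g that by (auto simp: G_def int_coeff_def sym_unimodal_def)
  have conv: "int_coeff (f * g) n = (\<Sum>k\<in>{0..int e}. G k * F (n - k))" for n
    unfolding F_def G_def by (rule int_coeff_mult) (use g in \<open>simp add: sym_unimodal_def\<close>)
  have refl: "(\<Sum>k\<in>{0..int c}. h k) = (\<Sum>k\<in>{0..int c}. h (int c - k))" for c and h :: "int \<Rightarrow> int"
    by (rule sum.reindex_bij_witness[where i = "\<lambda>k. int c - k" and j = "\<lambda>k. int c - k"]) auto
  have symm: "int_coeff (f * g) (int (d + e) - n) = int_coeff (f * g) n" for n
  proof -
    have "int_coeff (f * g) (int (d + e) - n) = (\<Sum>k\<in>{0..int e}. G (int e - k) * F (int d - (n - k)))"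
      unfolding conv by (subst refl) (simp add: algebra_simps)
    also have "\<dots> = int_coeff (f * g) n"
      unfolding conv by (simp add: F(1) G(1))
    finally show ?thesis .
  qed
  have mono: "int_coeff (f * g) n \<le> int_coeff (f * g) (n + 1)" if n: "2 * n < int (d + e)" for n
  proof -
    define \<delta> where "\<delta> k = G k - G (k - 1)" for k
    have "int_coeff (f * g) (n + 1) = (\<Sum>k\<in>{0..int (Suc e)}. G k * F (n + 1 - k))"
      unfolding conv by (rule sum.mono_neutral_left) (auto simp: G_out)
    moreover have "int_coeff (f * g) n = (\<Sum>k\<in>{1..int (Suc e)}. G (k - 1) * F (n + 1 - k))"
      unfolding conv
      by (rule sum.reindex_bij_witness[where i = "\<lambda>k. k - 1" and j = "\<lambda>k. k + 1"]) auto
    moreover have "\<dots> = (\<Sum>k\<in>{0..int (Suc e)}. G (k - 1) * F (n + 1 - k))"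
      by (rule sum.mono_neutral_left) (auto simp: G_out not_le)
    ultimately have diff: "int_coeff (f * g) (n + 1) - int_coeff (f * g) n =
        (\<Sum>k\<in>{0..int (Suc e)}. \<delta> k * F (n + 1 - k))"
      by (simp add: \<delta>_def algebra_simps flip: sum_subtractf)
    have \<delta>_anti: "\<delta> (int (Suc e) - k) = - \<delta> k" for k
      using G(1)[of k] G(1)[of "k - 1"] by (simp add: \<delta>_def algebra_simps)
    \<comment> \<open>Reflect k to e + 1 - k; adding this to the original sum produces the factor 2
      below.\<close>
    have "(\<Sum>k\<in>{0..int (Suc e)}. \<delta> k * F (n + 1 - k)) =
        (\<Sum>k\<in>{0..int (Suc e)}. - \<delta> k * F (n - int e + k))"
      by (subst refl) (simp add: \<delta>_anti[simplified] algebra_simps)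
    then have "2 * (int_coeff (f * g) (n + 1) - int_coeff (f * g) n) =
        (\<Sum>k\<in>{0..int (Suc e)}. \<delta> k * (F (n + 1 - k) - F (n - int e + k)))"
      unfolding diff by (simp add: algebra_simps sum.distrib sum_subtractf sum_negf)
    also have "\<dots> \<ge> 0"
    proof (rule sum_nonneg)
      fix k
      show "0 \<le> \<delta> k * (F (n + 1 - k) - F (n - int e + k))"
      \<comment> \<open>On the left half \<open>\<delta> k\<close> is non-negative, and
        \<open>n + 1 - k\<close> is at least as close to d/2 as \<open>n - int e + k\<close> because
        2n < d + e. On the right half both signs flip.\<close>
      proof (cases "2 * k \<le> int e + 1")
        case True
        then have "\<delta> k \<ge> 0" "F (n + 1 - k) \<ge> F (n - int e + k)"
          using n by (auto simp: \<delta>_def intro!: F(2) G(2))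
        then show ?thesis by simp
      next
        case False
        then have "G (int e - k) \<le> G (k - 1)" "F (n + 1 - k) \<le> F (n - int e + k)"
          using n by (auto intro!: F(2) G(2))
        then show ?thesis by (simp add: \<delta>_def G(1) mult_nonpos_nonpos)
      qed
    qed
    finally show ?thesis by simp
  qed
  show ?thesis
    unfolding sym_unimodal_def
  proof (intro conjI allI impI)
    fix i
    assume "i > d + e"
    with symm[of "int i"] show "coeff (f * g) i = 0"
      by (simp add: int_coeff_def)
  next
    fix i
    assume i: "i \<le> d + e"
    then have "nat (int (d + e) - int i) = d + e - i" by linarith
    with i symm[of "int i"] show "coeff (f * g) (d + e - i) = coeff (f * g) i"
      by (simp add: int_coeff_def split: if_splits)
  next
    fix i
    assume i: "2 * i < d + e"
    have "nat (int i + 1) = Suc i" by linarith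
    with i mono[of "int i"] show "coeff (f * g) i \<le> coeff (f * g) (Suc i)"
      by (simp add: int_coeff_def)
  qed
qed

text \<open>\<open>unimodal\<close> wants its peak at most the degree. The index
  \<open>d div 2\<close> qualifies because the coefficient there is the largest, hence non-zero
  unless f is zero.\<close>

lemma unimodal_if_sym_unimodal:
  assumes "sym_unimodal d f"
  shows "unimodal (\<lambda>i. real (coeff f i)) (degree f)"
proof (cases "f = 0")
  case True
  then show ?thesis by (simp add: unimodal_def)
next
  case False
  define j where "j = d div 2"
  have up: "coeff f i \<le> coeff f (Suc i)" if "i < j" for i
    using assms that by (auto simp: sym_unimodal_def j_def)
  have down: "coeff f (Suc i) \<le> coeff f i" if "j \<le> i" for i
  proof -
    have "int_coeff f (int d - int (Suc i)) \<le> int_coeff f (int i)"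
      using that by (intro sym_unimodal_int_coeff(2)[OF assms]) (auto simp: j_def)
    then have "int_coeff f (int (Suc i)) \<le> int_coeff f (int i)"
      by (simp only: sym_unimodal_int_coeff(1)[OF assms])
    moreover have "nat (1 + int i) = Suc i" by linarith
    ultimately show ?thesis by (simp add: int_coeff_def)
  qed
  have le_mid: "coeff f i \<le> coeff f j" for i
  proof (cases "i \<le> j")
    case True
    then show ?thesis
      by (induction rule: inc_induct) (use up in \<open>auto intro: order_trans\<close>)
  next
    case False
    then have "j \<le> i" by simp
    then show ?thesis
      by (induction rule: dec_induct) (use down in \<open>auto intro: order_trans\<close>)
  qed
  have "coeff f j \<noteq> 0"
  proof
    assume "coeff f j = 0"
    then have "coeff f i = 0" for i using le_mid[of i] by simp
    then show False using False by (simp add: poly_eq_iff)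
  qed
  then have "j \<le> degree f" by (rule le_degree)
  then show ?thesis
    unfolding unimodal_def using up down by (intro exI[of _ j]) auto
qed

section \<open>Torsion in finite abelian groups\<close>

lemma pow_product_group:
  assumes "x \<in> carrier (product_group I G)"
  shows "x [^]\<^bsub>product_group I G\<^esub> (n::nat) = (\<lambda>i\<in>I. x i [^]\<^bsub>G i\<^esub> n)"
  by (induction n) (auto simp: fun_eq_iff)

lemma card_torsion_integer_mod_group:
  assumes "p > 0"
  shows "card {x \<in> carrier (integer_mod_group (p ^ a)). x [^]\<^bsub>integer_mod_group (p ^ a)\<^esub> (p ^ e) = 0} =
         p ^ min a e"
proof -
  have pos: "int p ^ k > 0" for k using assms by simp
  show ?thesis
  proof (cases "a \<le> e")
    case True
    then have "int p ^ a dvd int p ^ e * x" for x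
      by (simp add: le_imp_power_dvd)
    then have "{x \<in> carrier (integer_mod_group (p ^ a)). x [^]\<^bsub>integer_mod_group (p ^ a)\<^esub> (p ^ e) = 0} =
        {0..<int (p ^ a)}"
      using assms by (auto simp: carrier_integer_mod_group)
    then show ?thesis using True by (simp add: min_def nat_power_eq)
  next
    case False
    then have split: "int p ^ a = int p ^ e * int p ^ (a - e)"
      by (simp flip: power_add)
    have "{x \<in> carrier (integer_mod_group (p ^ a)). x [^]\<^bsub>integer_mod_group (p ^ a)\<^esub> (p ^ e) = 0} =
        (\<lambda>y. int p ^ (a - e) * y) ` {0..<int p ^ e}" (is "?L = ?R")
    proof
      show "?L \<subseteq> ?R"
      proof
        fix x assume "x \<in> ?L"
        then have x: "0 \<le> x" "x < int p ^ e * int p ^ (a - e)"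
            "int p ^ e * int p ^ (a - e) dvd int p ^ e * x"
          using assms by (auto simp: carrier_integer_mod_group dvd_eq_mod_eq_0 split)
        then have "int p ^ (a - e) dvd x" using assms by simp
        then obtain y where y: "x = int p ^ (a - e) * y" by (elim dvdE)
        with x pos[of "a - e"] have "0 \<le> y" "y < int p ^ e"
          by (auto simp: zero_le_mult_iff mult.commute[of "int p ^ e"])
        with y show "x \<in> ?R" by auto
      qed
      show "?R \<subseteq> ?L"
        using assms by (auto simp: carrier_integer_mod_group split mult.commute[of "int p ^ e"] mult.assoc
            simp flip: mult.assoc)
    qed
    moreover have "inj_on (\<lambda>y. int p ^ (a - e) * y) {0..<int p ^ e}"
      using assms by (auto simp: inj_on_def)
    ultimately show ?thesis
      using False by (simp add: card_image nat_power_eq)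
  qed
qed

lemma sum_list_conv_sum_nth: "sum_list (map f xs) = (\<Sum>i<length xs. f (xs ! i))"
  by (simp add: sum_list_sum_nth atLeast0LessThan)

abbreviation type_group :: "nat \<Rightarrow> nat list \<Rightarrow> (nat \<Rightarrow> int) monoid" where
  "type_group p ls \<equiv> product_group {..<length ls} (\<lambda>i. integer_mod_group (p ^ (ls ! i)))"

lemma group_type_group: "group (type_group p ls)"
  by simp

lemma card_torsion_type_group:
  assumes "p > 0"
  shows "card {x \<in> carrier (type_group p ls). x [^]\<^bsub>type_group p ls\<^esub> (p ^ e) = \<one>\<^bsub>type_group p ls\<^esub>} =
         p ^ (\<Sum>x\<leftarrow>ls. min x e)"
proof -
  let ?T = "\<lambda>a. {x \<in> carrier (integer_mod_group (p ^ a)). x [^]\<^bsub>integer_mod_group (p ^ a)\<^esub> (p ^ e) = 0}"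
  have "{x \<in> carrier (type_group p ls). x [^]\<^bsub>type_group p ls\<^esub> (p ^ e) = \<one>\<^bsub>type_group p ls\<^esub>} =
        (\<Pi>\<^sub>E i\<in>{..<length ls}. ?T (ls ! i))"
  proof -
    have "x [^]\<^bsub>type_group p ls\<^esub> (p ^ e) = \<one>\<^bsub>type_group p ls\<^esub> \<longleftrightarrow>
        (\<forall>i<length ls. x i [^]\<^bsub>integer_mod_group (p ^ (ls ! i))\<^esub> (p ^ e) = 0)"
      if "x \<in> carrier (type_group p ls)" for x
      unfolding pow_product_group[OF that] by (auto simp: fun_eq_iff)
    then show ?thesis by (auto simp: PiE_iff extensional_def)
  qed
  then have "card {x \<in> carrier (type_group p ls). x [^]\<^bsub>type_group p ls\<^esub> (p ^ e) = \<one>\<^bsub>type_group p ls\<^esub>} =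
      (\<Prod>i<length ls. card (?T (ls ! i)))"
    by (simp only: card_PiE finite_lessThan)
  also have "\<dots> = (\<Prod>i<length ls. p ^ min (ls ! i) e)"
    by (rule prod.cong) (simp_all only: card_torsion_integer_mod_group[OF assms])
  finally show ?thesis
    by (simp add: sum_list_conv_sum_nth power_sum)
qed

lemma card_type_group:
  assumes "p > 0"
  shows "finite (carrier (type_group p ls))" "card (carrier (type_group p ls)) = p ^ sum_list ls"
proof -
  have "card (carrier (type_group p ls)) = (\<Prod>i<length ls. p ^ (ls ! i))"
    using assms by (simp add: card_PiE carrier_integer_mod_group nat_power_eq)
  then show "card (carrier (type_group p ls)) = p ^ sum_list ls"
    using sum_list_conv_sum_nth[of "\<lambda>x. x" ls] by (simp add: power_sum)
  show "finite (carrier (type_group p ls))"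
    using assms by (auto simp: carrier_integer_mod_group intro!: finite_PiE)
qed

lemma has_type_card:
  assumes "has_type p ls G" "p > 0"
  shows "finite (carrier G)" "card (carrier G) = p ^ sum_list ls"
proof -
  obtain h where "bij_betw h (carrier G) (carrier (type_group p ls))"
    using assms(1) by (auto simp: has_type_def is_iso_def iso_def)
  then show "finite (carrier G)" "card (carrier G) = p ^ sum_list ls"
    using card_type_group[OF assms(2), of ls] bij_betw_finite bij_betw_same_card by metis+
qed

lemma has_typeI:
  assumes "h \<in> iso (type_group p ls) G"
  shows "has_type p ls G"
  unfolding has_type_def using assms group.iso_sym[OF group_type_group] is_isoI by blast

lemma image_Collect_eq:
  assumes "h ` A = B" "\<And>x. x \<in> A \<Longrightarrow> P x \<longleftrightarrow> Q (h x)"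
  shows "h ` {x \<in> A. P x} = {y \<in> B. Q y}"
  using assms by blast

lemma has_type_torsion:
  assumes "has_type p ls G" "p > 0" "group G"
  shows "card {x \<in> carrier G. x [^]\<^bsub>G\<^esub> (p ^ e) = \<one>\<^bsub>G\<^esub>} = p ^ (\<Sum>x\<leftarrow>ls. min x e)"
proof -
  obtain h where h: "h \<in> iso G (type_group p ls)"
    using assms(1) by (auto simp: has_type_def is_iso_def)
  interpret group_hom G "type_group p ls" h
    using h assms(3) group_type_group by (simp only: group_hom_def group_hom_axioms_def iso_def) simp
  have bij: "bij_betw h (carrier G) (carrier (type_group p ls))"
    using h by (simp add: iso_def)
  have "bij_betw h {x \<in> carrier G. x [^]\<^bsub>G\<^esub> (p ^ e) = \<one>\<^bsub>G\<^esub>}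
     {x \<in> carrier (type_group p ls). x [^]\<^bsub>type_group p ls\<^esub> (p ^ e) = \<one>\<^bsub>type_group p ls\<^esub>}"
  proof (rule bij_betw_subset[OF bij])
    have "x [^]\<^bsub>G\<^esub> (p ^ e) = \<one>\<^bsub>G\<^esub> \<longleftrightarrow> h x [^]\<^bsub>type_group p ls\<^esub> (p ^ e) = \<one>\<^bsub>type_group p ls\<^esub>"
      if x: "x \<in> carrier G" for x
    proof -
      have "h x [^]\<^bsub>type_group p ls\<^esub> (p ^ e) = h (x [^]\<^bsub>G\<^esub> (p ^ e))"
        using x by (rule hom_nat_pow[symmetric])
      then have "h x [^]\<^bsub>type_group p ls\<^esub> (p ^ e) = \<one>\<^bsub>type_group p ls\<^esub> \<longleftrightarrow> h (x [^]\<^bsub>G\<^esub> (p ^ e)) = h \<one>\<^bsub>G\<^esub>"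
        by (simp only: hom_one)
      also have "\<dots> \<longleftrightarrow> x [^]\<^bsub>G\<^esub> (p ^ e) = \<one>\<^bsub>G\<^esub>"
        by (rule inj_on_eq_iff[OF bij_betw_imp_inj_on[OF bij]]) (use x in auto)
      finally show ?thesis by blast
    qed
    then show "h ` {x \<in> carrier G. x [^]\<^bsub>G\<^esub> (p ^ e) = \<one>\<^bsub>G\<^esub>} =
      {x \<in> carrier (type_group p ls). x [^]\<^bsub>type_group p ls\<^esub> (p ^ e) = \<one>\<^bsub>type_group p ls\<^esub>}"
      by (rule image_Collect_eq[OF bij_betw_imp_surj_on[OF bij]])
  qed auto
  then show ?thesis
    using card_torsion_type_group[OF assms(2)] by (metis (no_types, lifting) bij_betw_same_card)
qed

lemma (in group_hom) card_kernel_times_image: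
  assumes "finite (carrier G)"
  shows "card (carrier G) = card (kernel G H h) * card (h ` carrier G)"
proof -
  let ?I = "H\<lparr>carrier := h ` carrier G\<rparr>"
  have "group ?I"
    using img_is_subgroup H.subgroup_imp_group by blast
  then interpret I: group_hom G ?I h
    unfolding group_hom_def group_hom_axioms_def by (auto simp: hom_def)
  have "G Mod kernel G ?I h \<cong> ?I"
    by (rule I.FactGroup_iso) simp
  then have "card (rcosets\<^bsub>G\<^esub> kernel G H h) = card (h ` carrier G)"
    using iso_same_card by (fastforce simp: FactGroup_def kernel_def)
  then show ?thesis
    using G.lagrange[OF subgroup_kernel] by (simp add: Coset.order_def mult.commute)
qed

context comm_group
begin

definition torsion :: "'a set \<Rightarrow> nat \<Rightarrow> 'a set" where
  "torsion H k = {x \<in> H. x [^] k = \<one>}"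

lemma torsion_subset: "torsion H k \<subseteq> H"
  by (auto simp: torsion_def)

lemma torsion_subgroup:
  assumes "subgroup H G"
  shows "subgroup (torsion H k) G"
proof
  show "torsion H k \<subseteq> carrier G"
    using assms subgroup.subset by (auto simp: torsion_def)
  show "\<one> \<in> torsion H k"
    using assms by (simp add: torsion_def subgroup.one_closed)
  show "x \<otimes> y \<in> torsion H k" if "x \<in> torsion H k" "y \<in> torsion H k" for x y
    using that assms by (auto simp: torsion_def subgroup.m_closed subgroup.mem_carrier nat_pow_distrib)
  show "inv x \<in> torsion H k" if "x \<in> torsion H k" for x
  proof -
    have "x \<in> carrier G" using that assms by (simp add: torsion_def subgroup.mem_carrier)
    then show ?thesis
      using that assms by (simp add: torsion_def nat_pow_inv subgroup.m_inv_closed)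
  qed
qed

lemma card_power_map:
  assumes "subgroup B G" "finite B"
  shows "card B = card (torsion B n) * card ((\<lambda>x. x [^] n) ` B)"
proof -
  interpret group_hom "G\<lparr>carrier := B\<rparr>" G "\<lambda>x. x [^] n"
    unfolding group_hom_def group_hom_axioms_def
    using subgroup_imp_group[OF assms(1)] assms(1)
    by (auto simp: hom_def subgroup.mem_carrier nat_pow_distrib)
  show ?thesis
    using card_kernel_times_image assms(2) by (simp add: kernel_def torsion_def)
qed

lemma power_image_subgroup:
  assumes "subgroup B G"
  shows "(\<lambda>x. x [^] (n::nat)) ` B \<subseteq> B"
proof -
  have "x [^] n \<in> B" if "x \<in> B" for x
    by (induction n) (use that assms in \<open>auto simp: subgroup.one_closed subgroup.m_closed\<close>)
  then show ?thesis by blast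
qed

text \<open>The hypothesis says that up to exponent \<open>p ^ e\<close> the group K looks like a
  product of n cyclic groups of order at least \<open>p ^ e\<close>. The power map on the
  \<open>p ^ e\<close>-torsion has the \<open>p ^ (e - 1)\<close>-torsion as kernel, so its image
  has \<open>p ^ n\<close> elements and fills the \<open>p\<close>-torsion.\<close>

lemma power_image_torsion:
  assumes K: "subgroup K G" "finite K" and "e > 0" "p > 0"
    and card: "\<And>e'. e' \<le> e \<Longrightarrow> card (torsion K (p ^ e')) = p ^ (n * e')"
  shows "(\<lambda>x. x [^] (p ^ (e - 1))) ` torsion K (p ^ e) = torsion K p"
proof (rule card_subset_eq)
  show "finite (torsion K p)"
    using K(2) torsion_subset finite_subset by blast
  have pe: "p ^ (e - Suc 0) * p = p ^ e"
    using \<open>e > 0\<close> by (metis One_nat_def power_minus_mult)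
  show "(\<lambda>x. x [^] (p ^ (e - 1))) ` torsion K (p ^ e) \<subseteq> torsion K p"
  proof
    fix z assume "z \<in> (\<lambda>x. x [^] (p ^ (e - 1))) ` torsion K (p ^ e)"
    then obtain x where x: "x \<in> K" "x [^] (p ^ e) = \<one>" "z = x [^] (p ^ (e - 1))"
      by (auto simp: torsion_def)
    have "z \<in> K" using x power_image_subgroup[OF K(1)] by blast
    moreover have "z [^] p = \<one>"
      using x K(1) by (simp add: nat_pow_pow pe subgroup.mem_carrier)
    ultimately show "z \<in> torsion K p" by (simp add: torsion_def)
  qed
  have tt: "torsion (torsion K (p ^ e)) (p ^ (e - 1)) = torsion K (p ^ (e - 1))"
  proof -
    have "x [^] (p ^ e) = \<one>" if "x \<in> K" "x [^] (p ^ (e - 1)) = \<one>" for x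
      using that K(1) by (metis One_nat_def nat_pow_one nat_pow_pow pe subgroup.mem_carrier)
    then show ?thesis by (auto simp: torsion_def)
  qed
  have "card (torsion K (p ^ e)) =
      card (torsion K (p ^ (e - 1))) * card ((\<lambda>x. x [^] (p ^ (e - 1))) ` torsion K (p ^ e))"
    using card_power_map[OF torsion_subgroup[OF K(1)], of "p ^ e" "p ^ (e - 1)"]
      finite_subset[OF torsion_subset K(2)] by (simp only: tt)
  then have "p ^ (n * e) = p ^ (n * (e - 1)) * card ((\<lambda>x. x [^] (p ^ (e - 1))) ` torsion K (p ^ e))"
    by (simp add: card)
  moreover have "p ^ (n * e) = p ^ (n * (e - 1)) * p ^ n"
    using \<open>e > 0\<close> by (simp flip: power_add add: right_diff_distrib')
  ultimately show "card ((\<lambda>x. x [^] (p ^ (e - 1))) ` torsion K (p ^ e)) = card (torsion K p)"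
    using card[of 1] \<open>e > 0\<close> \<open>p > 0\<close> by simp
qed

text \<open>These are the elements of exponent \<open>p ^ e\<close> that cannot serve as the next
  basis element over K. They form a subgroup, which the power map sends onto the
  \<open>p\<close>-torsion of K, of order \<open>p ^ n\<close>, with the whole
  \<open>p ^ (e - 1)\<close>-torsion of H as kernel.\<close>

lemma card_dependent_extensions:
  assumes K: "subgroup K G" "K \<subseteq> H" and H: "subgroup H G" "finite H" and "e > 0" "p > 0"
    and card: "\<And>e'. e' \<le> e \<Longrightarrow> card (torsion K (p ^ e')) = p ^ (n * e')"
  shows "card {y \<in> torsion H (p ^ e). y [^] (p ^ (e - 1)) \<in> K} = p ^ n * card (torsion H (p ^ (e - 1)))"
    (is "card ?B = _")
proof -
  have finK: "finite K" using K(2) H(2) finite_subset by blast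
  have pe: "p ^ (e - Suc 0) * p = p ^ e"
    using \<open>e > 0\<close> by (metis One_nat_def power_minus_mult)
  have "subgroup ?B G"
  proof
    show "?B \<subseteq> carrier G"
      using H(1) subgroup.subset by (auto simp: torsion_def)
    show "\<one> \<in> ?B"
      using H(1) K(1) by (simp add: torsion_def subgroup.one_closed)
    show "x \<otimes> y \<in> ?B" if "x \<in> ?B" "y \<in> ?B" for x y
      using that H(1) K(1) by (auto simp: torsion_def subgroup.m_closed subgroup.mem_carrier nat_pow_distrib)
    show "inv x \<in> ?B" if "x \<in> ?B" for x
    proof -
      have "x \<in> carrier G" using that H(1) by (simp add: torsion_def subgroup.mem_carrier)
      then show ?thesis
        using that H(1) K(1) by (simp add: torsion_def nat_pow_inv subgroup.m_inv_closed)
    qed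
  qed
  moreover have "finite ?B" using H(2) by (simp add: torsion_def)
  ultimately have "card ?B = card (torsion ?B (p ^ (e - 1))) * card ((\<lambda>x. x [^] (p ^ (e - 1))) ` ?B)"
    by (rule card_power_map)
  moreover have "torsion ?B (p ^ (e - 1)) = torsion H (p ^ (e - 1))"
  proof -
    have "x [^] (p ^ e) = \<one>" if "x \<in> H" "x [^] (p ^ (e - 1)) = \<one>" for x
      using that H(1) by (metis One_nat_def nat_pow_one nat_pow_pow pe subgroup.mem_carrier)
    then show ?thesis using K(1) by (auto simp: torsion_def subgroup.one_closed)
  qed
  moreover have "(\<lambda>x. x [^] (p ^ (e - 1))) ` ?B = torsion K p"
  proof
    show "(\<lambda>x. x [^] (p ^ (e - 1))) ` ?B \<subseteq> torsion K p"
      using H(1) by (auto simp: torsion_def nat_pow_pow pe subgroup.mem_carrier)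
    \<comment> \<open>Surjectivity is already achieved by elements of K.\<close>
    have "torsion K (p ^ e) \<subseteq> ?B"
      using K power_image_subgroup[OF K(1)] by (auto simp: torsion_def)
    then show "torsion K p \<subseteq> (\<lambda>x. x [^] (p ^ (e - 1))) ` ?B"
      using power_image_torsion[OF K(1) finK \<open>e > 0\<close> \<open>p > 0\<close> card] by blast
  qed
  ultimately show ?thesis
    using card[of 1] \<open>e > 0\<close> by simp
qed

end

section \<open>Bases of finite abelian \<open>p\<close>-groups\<close>

context comm_group
begin

lemma int_pow_mod:
  assumes "y \<in> carrier G" "y [^] (m::nat) = \<one>"
  shows "y [^] (c mod int m) = y [^] (c::int)"
proof -
  have "y [^] c = y [^] (int m * (c div int m) + c mod int m)" by simp
  also have "\<dots> = (y [^] int m) [^] (c div int m) \<otimes> y [^] (c mod int m)"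
    using assms(1) by (simp only: int_pow_mult int_pow_pow)
  finally show ?thesis
    using assms by (simp add: int_pow_int)
qed

text \<open>With g the gcd of c and \<open>p ^ e\<close>, Bezout puts \<open>y [^] g\<close> into K.
  As g is a power of p, a proper divisor g of \<open>p ^ e\<close> would divide
  \<open>p ^ (e - 1)\<close> and force the excluded power into K.\<close>

lemma prime_power_dvd_if_pow_in_subgroup:
  assumes "prime p" and K: "subgroup K G" and y: "y \<in> carrier G" "y [^] (p ^ e) = \<one>"
    and nK: "y [^] (p ^ (e - 1)) \<notin> K" and c: "y [^] (c::int) \<in> K"
  shows "int (p ^ e) dvd c"
proof -
  define g where "g = gcd c (int (p ^ e))"
  obtain u v where uv: "u * c + v * int (p ^ e) = g"
    using bezout_int[of c "int (p ^ e)"] by (auto simp: g_def)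
  have "y [^] g = y [^] (c * u + int (p ^ e) * v)"
    by (simp only: uv[symmetric] mult.commute)
  also have "\<dots> = (y [^] c) [^] u \<otimes> (y [^] int (p ^ e)) [^] v"
    using y(1) by (simp only: int_pow_mult int_pow_pow)
  also have "\<dots> = (y [^] c) [^] u"
    using y c by (simp add: int_pow_int del: of_nat_power)
  also have "\<dots> \<in> K"
    using c K by (rule subgroup_int_pow_closed[rotated])
  finally have gK: "y [^] g \<in> K" .
  have "g \<ge> 0" by (simp add: g_def)
  have "nat g dvd p ^ e"
    using \<open>g \<ge> 0\<close> by (simp add: g_def nat_dvd_iff del: of_nat_power)
  then obtain j where j: "j \<le> e" "nat g = p ^ j"
    using divides_primepow_nat[OF assms(1)] by blast
  have g: "g = int (p ^ j)" using \<open>g \<ge> 0\<close> j(2) by linarith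
  have "j = e"
  proof (rule ccontr)
    assume "j \<noteq> e"
    then have "p ^ (e - 1) = p ^ j * p ^ (e - 1 - j)"
      using j(1) by (simp flip: power_add)
    then have "y [^] (p ^ (e - 1)) = (y [^] (p ^ j)) [^] (p ^ (e - 1 - j))"
      using y(1) by (simp only: nat_pow_pow)
    moreover have "y [^] (p ^ j) \<in> K"
      using gK by (simp only: g int_pow_int)
    ultimately show False
      using nK power_image_subgroup[OF K] by auto
  qed
  then have "int (p ^ e) = g" using g by simp
  then show ?thesis unfolding g_def by (metis gcd_dvd1)
qed

text \<open>Every non-trivial subgroup of the cyclic group of y contains
  \<open>y [^] (p ^ (e - 1))\<close>, so this cyclic group meets the span of S trivially and their
  product is direct.\<close>

lemma has_type_snoc:
  assumes "prime p" "e > 0" and S: "S \<subseteq> carrier G"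
    and y: "y \<in> carrier G" "y [^] (p ^ e) = \<one>" "y [^] (p ^ (e - 1)) \<notin> generate G S"
    and type: "has_type p ls (G\<lparr>carrier := generate G S\<rparr>)"
  shows "has_type p (ls @ [e]) (G\<lparr>carrier := generate G (insert y S)\<rparr>)"
proof -
  define K where "K = generate G S"
  define n where "n = length ls"
  define P where "P = type_group p ls"
  define P' where "P' = type_group p (ls @ [e])"
  have "p > 1" using assms(1) by (rule prime_gt_1_nat)
  have K: "subgroup K G" unfolding K_def by (rule generate_is_subgroup[OF S])
  have grpP: "group P" and grpP': "group P'" by (simp_all only: P_def P'_def group_type_group)
  have "P \<cong> G\<lparr>carrier := K\<rparr>"
    using type group.iso_sym[OF subgroup_imp_group[OF K]] by (simp add: has_type_def P_def K_def)
  then obtain h where h: "h \<in> iso P (G\<lparr>carrier := K\<rparr>)" by (auto simp: is_iso_def)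
  interpret h: group_hom P "G\<lparr>carrier := K\<rparr>" h
    unfolding group_hom_def group_hom_axioms_def using h grpP subgroup_imp_group[OF K] by (simp add: iso_def)
  have h_bij: "bij_betw h (carrier P) K" using h by (simp add: iso_def)
  have h_in: "h x \<in> K" if "x \<in> carrier P" for x using h_bij that bij_betwE by blast
  \<comment> \<open>The old coordinates go through h; the new coordinate, with index n, is the
    exponent of y.\<close>
  define h' where "h' x = h (restrict x {..<n}) \<otimes> y [^] (x n)" for x
  have carrier_P': "x \<in> carrier P' \<longleftrightarrow>
      restrict x {..<n} \<in> carrier P \<and> x n \<in> {0..<int (p ^ e)} \<and> x \<in> extensional {..<Suc n}" for x
  proof -
    have "x \<in> carrier P' \<longleftrightarrow>
        (\<forall>i<Suc n. x i \<in> {0..<int (p ^ ((ls @ [e]) ! i))}) \<and> x \<in> extensional {..<Suc n}"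
      using \<open>p > 1\<close> by (simp add: P'_def n_def PiE_iff carrier_integer_mod_group Ball_def)
    moreover have "restrict x {..<n} \<in> carrier P \<longleftrightarrow> (\<forall>i<n. x i \<in> {0..<int (p ^ ((ls @ [e]) ! i))})"
      using \<open>p > 1\<close> by (simp add: P_def n_def PiE_iff carrier_integer_mod_group Ball_def nth_append)
    ultimately show ?thesis by (auto simp: All_less_Suc n_def)
  qed
  have one_P: "\<one>\<^bsub>P\<^esub> = (\<lambda>i\<in>{..<n}. 0)" and one_P': "\<one>\<^bsub>P'\<^esub> = (\<lambda>i\<in>{..<Suc n}. 0)"
    by (simp_all add: P_def P'_def n_def)
  have mult_P: "x \<otimes>\<^bsub>P\<^esub> z = (\<lambda>i\<in>{..<n}. (x i + z i) mod int (p ^ (ls ! i)))"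
    and mult_P': "x \<otimes>\<^bsub>P'\<^esub> z = (\<lambda>i\<in>{..<Suc n}. (x i + z i) mod int (p ^ ((ls @ [e]) ! i)))" for x z
    by (simp_all add: P_def P'_def n_def)
  have h'_hom: "h' \<in> hom P' G"
  proof (rule homI)
    show "h' x \<in> carrier G" if "x \<in> carrier P'" for x
      using that y(1) h_in K carrier_P' by (simp add: h'_def subgroup.mem_carrier)
    show "h' (x \<otimes>\<^bsub>P'\<^esub> z) = h' x \<otimes> h' z" if x: "x \<in> carrier P'" and z: "z \<in> carrier P'" for x z
    proof -
      let ?r = "\<lambda>x. restrict x {..<n}"
      have "?r (x \<otimes>\<^bsub>P'\<^esub> z) = ?r x \<otimes>\<^bsub>P\<^esub> ?r z"
        by (auto simp: mult_P mult_P' nth_append n_def fun_eq_iff)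
      moreover have "(x \<otimes>\<^bsub>P'\<^esub> z) n = (x n + z n) mod int (p ^ e)"
        by (simp add: mult_P' n_def)
      moreover have "h (?r x \<otimes>\<^bsub>P\<^esub> ?r z) = h (?r x) \<otimes> h (?r z)"
        using x z carrier_P' h.hom_mult by simp
      moreover have "y [^] ((x n + z n) mod int (p ^ e)) = y [^] x n \<otimes> y [^] z n"
        using y(1,2) int_pow_mod int_pow_mult by metis
      moreover have "h (?r x) \<in> carrier G" "h (?r z) \<in> carrier G"
        using x z carrier_P' h_in K by (auto intro: subgroup.mem_carrier)
      ultimately show ?thesis
        using y(1) by (simp add: h'_def m_ac)
    qed
  qed
  interpret h': group_hom P' G h'
    unfolding group_hom_def group_hom_axioms_def using h'_hom grpP' is_group by simp
  have "kernel P' G h' \<subseteq> {\<one>\<^bsub>P'\<^esub>}"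
  proof
    fix x assume "x \<in> kernel P' G h'"
    then have x: "x \<in> carrier P'" "h (restrict x {..<n}) \<otimes> y [^] x n = \<one>"
      by (auto simp: kernel_def h'_def)
    have xr: "restrict x {..<n} \<in> carrier P" "x n \<in> {0..<int (p ^ e)}" "x \<in> extensional {..<Suc n}"
      using x(1) carrier_P' by auto
    have hK: "h (restrict x {..<n}) \<in> K" using h_in xr by blast
    have hG: "h (restrict x {..<n}) \<in> carrier G" using hK K by (rule subgroup.mem_carrier[rotated])
    then have "y [^] x n = inv (h (restrict x {..<n}))"
      using x(2) y(1) by (metis inv_equality inv_inv int_pow_closed m_comm)
    then have "y [^] x n \<in> K"
      using hK K by (simp add: subgroup.m_inv_closed)
    then have "int (p ^ e) dvd x n"
      using prime_power_dvd_if_pow_in_subgroup[OF assms(1) K y(1,2)] y(3) by (simp add: K_def)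
    then have xn: "x n = 0" using xr(2) by (auto dest: zdvd_imp_le)
    then have "h (restrict x {..<n}) = \<one>" using x(2) hG by simp
    then have "h (restrict x {..<n}) = h \<one>\<^bsub>P\<^esub>" using h.hom_one by simp
    then have eq: "restrict x {..<n} = \<one>\<^bsub>P\<^esub>"
      using inj_on_eq_iff[OF bij_betw_imp_inj_on[OF h_bij]] xr(1) h.G.one_closed by blast
    have "x i = 0" if "i < n" for i
      using fun_cong[OF eq, of i] that by (simp add: one_P)
    then have "x = \<one>\<^bsub>P'\<^esub>"
      using xn xr(3) by (auto simp: one_P' fun_eq_iff extensional_def less_Suc_eq)
    then show "x \<in> {\<one>\<^bsub>P'\<^esub>}" by simp
  qed
  then have "kernel P' G h' = {\<one>\<^bsub>P'\<^esub>}"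
    using h'.subgroup_kernel subgroup.one_closed by fastforce
  then have inj: "inj_on h' (carrier P')" by (rule h'.trivial_ker_imp_inj)
  have "h' ` carrier P' = generate G (insert y S)"
  proof
    show "h' ` carrier P' \<subseteq> generate G (insert y S)"
    proof
      fix z assume "z \<in> h' ` carrier P'"
      then obtain x where x: "x \<in> carrier P'" "z = h (restrict x {..<n}) \<otimes> y [^] x n"
        by (auto simp: h'_def)
      have sub: "subgroup (generate G (insert y S)) G"
        using S y(1) by (intro generate_is_subgroup) auto
      have "h (restrict x {..<n}) \<in> generate G (insert y S)"
        using h_in[of "restrict x {..<n}"] x(1) carrier_P' mono_generate[of S "insert y S"] by (auto simp: K_def)
      moreover have "y [^] x n \<in> generate G (insert y S)"
        by (rule subgroup_int_pow_closed[OF sub]) (simp add: generate.incl)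
      ultimately show "z \<in> generate G (insert y S)"
        unfolding x(2) by (rule subgroup.m_closed[OF sub])
    qed
    show "generate G (insert y S) \<subseteq> h' ` carrier P'"
    proof (rule generate_subgroup_incl)
      show "subgroup (h' ` carrier P') G" by (rule h'.img_is_subgroup)
      have "y \<in> h' ` carrier P'"
      proof
        let ?x = "\<lambda>i\<in>{..<Suc n}. if i = n then 1 else (0::int)"
        have r: "restrict ?x {..<n} = \<one>\<^bsub>P\<^esub>" by (auto simp: one_P fun_eq_iff)
        have "1 < p ^ e" using \<open>p > 1\<close> \<open>e > 0\<close> by (rule one_less_power)
        then have "1 < int (p ^ e)" by linarith
        then show "?x \<in> carrier P'"
          unfolding carrier_P' r using h.G.one_closed by simp
        show "y = h' ?x" unfolding h'_def r using y(1) h.hom_one by simp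
      qed
      moreover have "s \<in> h' ` carrier P'" if "s \<in> S" for s
      proof -
        have "s \<in> K" using that by (simp add: K_def generate.incl)
        then obtain z where z: "z \<in> carrier P" "h z = s"
          using h_bij by (auto simp: bij_betw_def)
        let ?x = "\<lambda>i\<in>{..<Suc n}. if i = n then 0 else z i"
        have "z \<in> extensional {..<n}" using z(1) by (simp add: P_def n_def PiE_iff)
        then have r: "restrict ?x {..<n} = z" by (auto simp: fun_eq_iff extensional_def)
        have "?x \<in> carrier P'"
          unfolding carrier_P' r using z \<open>p > 1\<close> by simp
        moreover have "s = h' ?x"
          unfolding h'_def r using z(2) subsetD[OF S that] y(1) by simp
        ultimately show ?thesis by blast
      qed
      ultimately show "insert y S \<subseteq> h' ` carrier P'" by blast
    qed
  qed
  with inj h'_hom have "h' \<in> iso P' (G\<lparr>carrier := generate G (insert y S)\<rparr>)"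
    by (auto simp: iso_def bij_betw_def hom_def)
  then show ?thesis
    unfolding P'_def by (rule has_typeI)
qed

lemma has_type_Nil: "has_type p [] (G\<lparr>carrier := generate G {}\<rparr>)"
proof -
  have "generate G {} = {\<one>}" by (rule generate_empty)
  then have "(\<lambda>_. \<one>) \<in> iso (type_group p []) (G\<lparr>carrier := generate G {}\<rparr>)"
    by (auto simp: iso_def hom_def bij_betw_def)
  then show ?thesis by (rule has_typeI)
qed

text \<open>Reading \<open>y\<close> as the next basis element, the last condition says that the cyclic group it
  generates has order exactly \<open>p ^ \<mu> n\<close> and meets the span of the previous ones trivially.\<close>

primrec basis_tuples :: "nat \<Rightarrow> 'a set \<Rightarrow> (nat \<Rightarrow> nat) \<Rightarrow> nat \<Rightarrow> 'a list set" where
  "basis_tuples p H \<mu> 0 = {[]}"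
| "basis_tuples p H \<mu> (Suc n) =
     {ys @ [y] | ys y. ys \<in> basis_tuples p H \<mu> n \<and> y \<in> torsion H (p ^ \<mu> n) \<and>
        y [^] (p ^ (\<mu> n - 1)) \<notin> generate G (set ys)}"

lemma basis_tuples_subset: "ys \<in> basis_tuples p H \<mu> n \<Longrightarrow> set ys \<subseteq> H"
  by (induction n arbitrary: ys) (fastforce simp: torsion_def)+

text \<open>The ambient set enters only through membership of the entries. This allows a tuple found
  in a large group to be regarded as a basis of its own span.\<close>

lemma basis_tuples_mono:
  "ys \<in> basis_tuples p H \<mu> n \<Longrightarrow> set ys \<subseteq> K \<Longrightarrow> ys \<in> basis_tuples p K \<mu> n"
  by (induction n arbitrary: ys) (auto simp: torsion_def)

lemma has_type_generate_basis_tuple: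
  assumes "prime p" "H \<subseteq> carrier G" "ys \<in> basis_tuples p H \<mu> n" "\<And>i. i < n \<Longrightarrow> \<mu> i > 0"
  shows "has_type p (map \<mu> [0..<n]) (G\<lparr>carrier := generate G (set ys)\<rparr>)"
  using assms(3,4)
proof (induction n arbitrary: ys)
  case 0
  then show ?case using has_type_Nil by simp
next
  case (Suc n)
  then obtain zs y where zs: "ys = zs @ [y]" "zs \<in> basis_tuples p H \<mu> n" "y \<in> torsion H (p ^ \<mu> n)"
      "y [^] (p ^ (\<mu> n - 1)) \<notin> generate G (set zs)"
    by auto
  have "has_type p (map \<mu> [0..<n] @ [\<mu> n]) (G\<lparr>carrier := generate G (insert y (set zs))\<rparr>)"
  proof (rule has_type_snoc)
    show "set zs \<subseteq> carrier G" using basis_tuples_subset[OF zs(2)] assms(2) by blast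
    show "y \<in> carrier G" using zs(3) assms(2) by (auto simp: torsion_def)
    show "has_type p (map \<mu> [0..<n]) (G\<lparr>carrier := generate G (set zs)\<rparr>)"
      using Suc zs(2) by simp
  qed (use zs Suc.prems(2) assms(1) in \<open>auto simp: torsion_def\<close>)
  then show ?case by (simp add: zs(1))
qed

lemma torsion_restrict:
  "torsion H k = {x \<in> carrier (G\<lparr>carrier := H\<rparr>). x [^]\<^bsub>G\<lparr>carrier := H\<rparr>\<^esub> k = \<one>\<^bsub>G\<lparr>carrier := H\<rparr>\<^esub>}"
  by (simp add: torsion_def flip: nat_pow_consistent)

lemma card_torsion_has_type:
  assumes "has_type p ls (G\<lparr>carrier := H\<rparr>)" "p > 0" "subgroup H G"
  shows "card (torsion H (p ^ e)) = p ^ (\<Sum>x\<leftarrow>ls. min x e)"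
  unfolding torsion_restrict
  by (rule has_type_torsion[OF assms(1,2)]) (rule subgroup_imp_group[OF assms(3)])

text \<open>Since all parts so far are at least e, each contributes exactly e' to the torsion. This
  supplies the hypothesis of \<open>card_dependent_extensions\<close> and is the reason for choosing
  basis elements with decreasing orders.\<close>

lemma card_torsion_generate_basis_tuple:
  assumes "prime p" "H \<subseteq> carrier G" "ys \<in> basis_tuples p H \<mu> n"
    and "e > 0" "\<And>i. i < n \<Longrightarrow> \<mu> i \<ge> e" "e' \<le> e"
  shows "card (torsion (generate G (set ys)) (p ^ e')) = p ^ (n * e')"
proof -
  have "\<mu> i > 0" if "i < n" for i
    using assms(4) assms(5)[OF that] by simp
  with assms(1-3) have "has_type p (map \<mu> [0..<n]) (G\<lparr>carrier := generate G (set ys)\<rparr>)"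
    by (rule has_type_generate_basis_tuple)
  moreover have "subgroup (generate G (set ys)) G"
    using basis_tuples_subset assms(2,3) by (intro generate_is_subgroup) blast
  ultimately have "card (torsion (generate G (set ys)) (p ^ e')) = p ^ (\<Sum>x\<leftarrow>map \<mu> [0..<n]. min x e')"
    using card_torsion_has_type prime_gt_0_nat[OF assms(1)] by blast
  also have "(\<Sum>x\<leftarrow>map \<mu> [0..<n]. min x e') = (\<Sum>x\<leftarrow>map \<mu> [0..<n]. e')"
    by (rule arg_cong[of _ _ sum_list], rule map_cong) (auto intro!: min_absorb2 order_trans[OF assms(6) assms(5)])
  also have "\<dots> = n * e'" by (induction n) simp_all
  finally show ?thesis .
qed

text \<open>The sets of admissible extensions differ from tuple to tuple, but their size depends
  only on the length, so the counts multiply.\<close>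

lemma card_basis_tuples:
  assumes p: "prime p" and H: "subgroup H G" "finite H"
    and \<mu>: "\<And>i. i < n \<Longrightarrow> \<mu> i > 0" "\<And>i j. i \<le> j \<Longrightarrow> j < n \<Longrightarrow> \<mu> j \<le> \<mu> i"
  shows "finite (basis_tuples p H \<mu> n) \<and>
    int (card (basis_tuples p H \<mu> n)) =
       (\<Prod>i<n. int (card (torsion H (p ^ \<mu> i))) - int p ^ i * int (card (torsion H (p ^ (\<mu> i - 1)))))"
  using \<mu>
proof (induction n)
  case 0
  show ?case by simp
next
  case (Suc n)
  let ?B = "basis_tuples p H \<mu> n"
  let ?N = "\<lambda>ys. {y \<in> torsion H (p ^ \<mu> n). y [^] (p ^ (\<mu> n - 1)) \<notin> generate G (set ys)}"
  have HG: "H \<subseteq> carrier G" using H(1) by (rule subgroup.subset)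
  have eq: "basis_tuples p H \<mu> (Suc n) = (\<lambda>(ys, y). ys @ [y]) ` (SIGMA ys : ?B. ?N ys)"
    by auto
  have fin_tor: "finite (torsion H k)" for k using H(2) by (simp add: torsion_def)
  have finB: "finite ?B"
    using Suc.IH Suc.prems by simp
  then have fin: "finite (basis_tuples p H \<mu> (Suc n))"
    unfolding eq using fin_tor by (intro finite_imageI finite_SigmaI) auto
  have N: "int (card (?N ys)) =
      int (card (torsion H (p ^ \<mu> n))) - int p ^ n * int (card (torsion H (p ^ (\<mu> n - 1))))"
    if ys: "ys \<in> ?B" for ys
  proof -
    let ?D = "{y \<in> torsion H (p ^ \<mu> n). y [^] (p ^ (\<mu> n - 1)) \<in> generate G (set ys)}"
    have sub: "generate G (set ys) \<subseteq> H"
      using basis_tuples_subset[OF ys] H(1) by (rule generate_subgroup_incl)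
    have "card ?D = p ^ n * card (torsion H (p ^ (\<mu> n - 1)))"
    proof (rule card_dependent_extensions)
      show "subgroup (generate G (set ys)) G"
        using basis_tuples_subset[OF ys] HG by (intro generate_is_subgroup) blast
      show "card (torsion (generate G (set ys)) (p ^ e')) = p ^ (n * e')" if "e' \<le> \<mu> n" for e'
        using p HG ys Suc.prems that by (intro card_torsion_generate_basis_tuple) auto
    qed (use sub H Suc.prems prime_gt_0_nat[OF p] in auto)
    moreover have "?N ys = torsion H (p ^ \<mu> n) - ?D" by auto
    moreover have "card ?D \<le> card (torsion H (p ^ \<mu> n))"
      by (rule card_mono) (auto simp: fin_tor)
    ultimately show ?thesis
      by (simp add: card_Diff_subset fin_tor of_nat_diff)
  qed
  have "card (basis_tuples p H \<mu> (Suc n)) = card (SIGMA ys : ?B. ?N ys)"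
    unfolding eq by (rule card_image) (auto simp: inj_on_def)
  also have "\<dots> = (\<Sum>ys\<in>?B. card (?N ys))"
    using finB fin_tor by (subst card_SigmaI) auto
  finally have "int (card (basis_tuples p H \<mu> (Suc n))) = (\<Sum>ys\<in>?B. int (card (?N ys)))"
    by simp
  also have "\<dots> = (\<Sum>ys\<in>?B. int (card (torsion H (p ^ \<mu> n))) -
      int p ^ n * int (card (torsion H (p ^ (\<mu> n - 1)))))"
    using N by (rule sum.cong[OF refl])
  finally show ?case
    using fin Suc.IH Suc.prems by simp
qed

end

section \<open>Counting subgroups by type\<close>

text \<open>For a group of type \<open>ls\<close> this is the exponent of p in the number of
  \<open>p ^ e\<close>-torsion elements; it is the sum of the first e parts of the conjugate
  partition.\<close>

definition torsion_exp :: "nat list \<Rightarrow> nat \<Rightarrow> nat" where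
  "torsion_exp ls e = (\<Sum>x\<leftarrow>ls. min x e)"

definition conjugate_part :: "nat list \<Rightarrow> nat \<Rightarrow> nat" where
  "conjugate_part ls e = length (filter (\<lambda>x. e \<le> x) ls)"

lemma torsion_exp_step:
  "e > 0 \<Longrightarrow> torsion_exp ls e = torsion_exp ls (e - 1) + conjugate_part ls e"
  by (induction ls) (auto simp: torsion_exp_def conjugate_part_def)

text \<open>Both sides say that the Ferrers diagram has a row i, counted from 0, of length at least
  e.\<close>

lemma less_conjugate_part_iff:
  assumes "sorted_wrt (\<ge>) ls"
  shows "i < conjugate_part ls e \<longleftrightarrow> i < length ls \<and> e \<le> ls ! i"
  using assms
proof (induction ls arbitrary: i)
  case Nil
  then show ?case by (simp add: conjugate_part_def)
next
  case (Cons x ls)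
  show ?case
  proof (cases "e \<le> x")
    case True
    then have "conjugate_part (x # ls) e = Suc (conjugate_part ls e)"
      by (simp add: conjugate_part_def)
    then show ?thesis using Cons True by (cases i) auto
  next
    case False
    then have "\<forall>y\<in>set (x # ls). \<not> e \<le> y" using Cons.prems by auto
    then show ?thesis by (metis conjugate_part_def filter_False list.size(3) nth_mem not_less_zero)
  qed
qed

text \<open>The number of bases of type \<open>ms\<close> in a group of type \<open>ls\<close>: the \<open>i\<close>-th factor counts the
  elements of exponent \<open>p ^ (ms ! i)\<close> that extend a given tuple of length \<open>i\<close>.\<close>

definition tuple_count :: "nat \<Rightarrow> nat list \<Rightarrow> nat list \<Rightarrow> int" where
  "tuple_count p ls ms = (\<Prod>i<length ms.
     int p ^ torsion_exp ls (ms ! i) - int p ^ i * int p ^ torsion_exp ls (ms ! i - 1))"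

lemma tuple_count_eq:
  assumes "is_partition ms"
  shows "tuple_count p ls ms = (\<Prod>i<length ms. int p ^ torsion_exp ls (ms ! i - 1) *
     (int p ^ conjugate_part ls (ms ! i) - int p ^ i))"
  unfolding tuple_count_def
proof (rule prod.cong)
  fix i assume "i \<in> {..<length ms}"
  then have "ms ! i > 0" using assms by (simp add: is_partition_def)
  then show "int p ^ torsion_exp ls (ms ! i) - int p ^ i * int p ^ torsion_exp ls (ms ! i - 1) =
      int p ^ torsion_exp ls (ms ! i - 1) * (int p ^ conjugate_part ls (ms ! i) - int p ^ i)"
    by (simp add: torsion_exp_step[of "ms ! i"] power_add algebra_simps)
qed simp

lemma tuple_count_self_pos:
  assumes "p > 1" "is_partition ms"
  shows "tuple_count p ms ms > 0"
  unfolding tuple_count_eq[OF assms(2)]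
proof (rule prod_pos)
  fix i assume "i \<in> {..<length ms}"
  then have "i < conjugate_part ms (ms ! i)"
    using assms(2) by (simp add: less_conjugate_part_iff is_partition_def)
  then have "int p ^ i < int p ^ conjugate_part ms (ms ! i)"
    using assms(1) by (intro power_strict_increasing) auto
  then show "0 < int p ^ torsion_exp ms (ms ! i - 1) * (int p ^ conjugate_part ms (ms ! i) - int p ^ i)"
    using assms(1) by simp
qed

context comm_group
begin

definition subgroups_of_type :: "nat \<Rightarrow> 'a set \<Rightarrow> nat list \<Rightarrow> 'a set set" where
  "subgroups_of_type p H ms = {K. subgroup K G \<and> K \<subseteq> H \<and> has_type p ms (G\<lparr>carrier := K\<rparr>)}"

lemma card_basis_tuples_has_type:
  assumes "prime p" "is_partition ms" and H: "subgroup H G" "has_type p ls (G\<lparr>carrier := H\<rparr>)"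
    and "n \<le> length ms"
  shows "finite (basis_tuples p H (nth ms) n)"
    "int (card (basis_tuples p H (nth ms) n)) = tuple_count p ls (take n ms)"
proof -
  have "finite H" using has_type_card[OF H(2)] prime_gt_0_nat[OF assms(1)] by simp
  moreover have "ms ! i > 0" if "i < n" for i
    using assms(2,5) that by (simp add: is_partition_def)
  moreover have "ms ! j \<le> ms ! i" if "i \<le> j" "j < n" for i j
    using assms(2,5) that by (cases "i = j") (auto simp: is_partition_def sorted_wrt_iff_nth_less)
  ultimately have *: "finite (basis_tuples p H (nth ms) n) \<and> int (card (basis_tuples p H (nth ms) n)) =
     (\<Prod>i<n. int (card (torsion H (p ^ (ms ! i)))) - int p ^ i * int (card (torsion H (p ^ (ms ! i - 1)))))"
    by (intro card_basis_tuples assms H)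
  then show "finite (basis_tuples p H (nth ms) n)" ..
  have tor: "card (torsion H (p ^ e)) = p ^ torsion_exp ls e" for e
    unfolding torsion_exp_def by (rule card_torsion_has_type[OF H(2) prime_gt_0_nat[OF assms(1)] H(1)])
  show "int (card (basis_tuples p H (nth ms) n)) = tuple_count p ls (take n ms)"
    using * assms(5) by (simp add: tor tuple_count_def min_absorb2)
qed

text \<open>Sort the bases of type \<open>ms\<close> in H by the subgroup they span: every subgroup
  of that type has the same number \<open>tuple_count p ms ms\<close> of bases.\<close>

lemma card_subgroups_of_type:
  assumes p: "prime p" and ms: "is_partition ms" and H: "subgroup H G" "has_type p ls (G\<lparr>carrier := H\<rparr>)"
  shows "int (card (subgroups_of_type p H ms)) * tuple_count p ms ms = tuple_count p ls ms"
proof -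
  define n where "n = length ms"
  define S where "S = subgroups_of_type p H ms"
  let ?B = "\<lambda>K. basis_tuples p K (nth ms) n"
  have "p > 0" using p by (rule prime_gt_0_nat)
  have HG: "H \<subseteq> carrier G" using H(1) by (rule subgroup.subset)
  have finH: "finite H" using has_type_card[OF H(2) \<open>p > 0\<close>] by simp
  have "finite S"
    by (rule finite_subset[of _ "Pow H"]) (auto simp: S_def subgroups_of_type_def finH)
  have gen_type: "has_type p ms (G\<lparr>carrier := generate G (set ys)\<rparr>)" if "ys \<in> ?B H" for ys
  proof -
    have "ms ! i > 0" if "i < n" for i
      using ms that by (simp add: is_partition_def n_def)
    with p HG that have "has_type p (map (nth ms) [0..<n]) (G\<lparr>carrier := generate G (set ys)\<rparr>)"
      by (rule has_type_generate_basis_tuple)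
    then show ?thesis by (simp add: n_def map_nth)
  qed
  \<comment> \<open>A basis tuple inside K spans a subgroup with as many elements as K; hence
    different K have disjoint sets of bases.\<close>
  have gen_eq: "generate G (set ys) = K" if K: "K \<in> S" and ys: "ys \<in> ?B K" for K ys
  proof (rule card_subset_eq)
    have K': "subgroup K G" "K \<subseteq> H" "has_type p ms (G\<lparr>carrier := K\<rparr>)"
      using K by (auto simp: S_def subgroups_of_type_def)
    show "finite K" using finH K'(2) finite_subset by blast
    show "generate G (set ys) \<subseteq> K"
      by (rule generate_subgroup_incl[OF basis_tuples_subset[OF ys] K'(1)])
    have "ys \<in> ?B H"
      by (rule basis_tuples_mono[OF ys]) (use basis_tuples_subset[OF ys] K'(2) in blast)
    then show "card (generate G (set ys)) = card K"
      using has_type_card(2)[OF gen_type \<open>p > 0\<close>] has_type_card(2)[OF K'(3) \<open>p > 0\<close>] by simp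
  qed
  have "?B H = (\<Union>K\<in>S. ?B K)"
  proof
    show "?B H \<subseteq> (\<Union>K\<in>S. ?B K)"
    proof
      fix ys assume ys: "ys \<in> ?B H"
      have sub: "set ys \<subseteq> H" by (rule basis_tuples_subset[OF ys])
      have "generate G (set ys) \<in> S"
        unfolding S_def subgroups_of_type_def
        using generate_is_subgroup[of "set ys"] generate_subgroup_incl[OF sub H(1)] gen_type[OF ys] sub HG by auto
      moreover have "ys \<in> ?B (generate G (set ys))"
        by (rule basis_tuples_mono[OF ys]) (auto intro: generate.incl)
      ultimately show "ys \<in> (\<Union>K\<in>S. ?B K)" by blast
    qed
    show "(\<Union>K\<in>S. ?B K) \<subseteq> ?B H"
      using basis_tuples_mono basis_tuples_subset by (fastforce simp: S_def subgroups_of_type_def)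
  qed
  moreover have "\<forall>K\<in>S. finite (?B K)"
    using card_basis_tuples_has_type(1)[OF p ms, of _ ms n] by (auto simp: S_def subgroups_of_type_def n_def)
  moreover have "\<forall>K\<in>S. \<forall>L\<in>S. K \<noteq> L \<longrightarrow> ?B K \<inter> ?B L = {}"
    using gen_eq by blast
  ultimately have "card (?B H) = (\<Sum>K\<in>S. card (?B K))"
    using \<open>finite S\<close> by (simp only: card_UN_disjoint)
  then have "int (card (?B H)) = (\<Sum>K\<in>S. int (card (?B K)))" by simp
  also have "\<dots> = (\<Sum>K\<in>S. tuple_count p ms ms)"
    using card_basis_tuples_has_type(2)[OF p ms, of _ ms n]
    by (intro sum.cong) (auto simp: S_def subgroups_of_type_def n_def)
  finally show ?thesis
    using card_basis_tuples_has_type(2)[OF p ms H, of n] by (simp add: n_def S_def)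
qed

section \<open>The type of a subgroup is contained in the type of the group\<close>

lemma basis_tuples_length: "ys \<in> basis_tuples p H \<mu> n \<Longrightarrow> length ys = n"
  by (induction n arbitrary: ys) auto

lemma basis_tuples_take:
  "ys \<in> basis_tuples p H \<mu> n \<Longrightarrow> m \<le> n \<Longrightarrow> take m ys \<in> basis_tuples p H \<mu> m"
proof (induction n arbitrary: ys)
  case (Suc n)
  obtain zs y where zs: "ys = zs @ [y]" "zs \<in> basis_tuples p H \<mu> n"
    using Suc.prems(1) by auto
  show ?case
  proof (cases "m = Suc n")
    case True
    then show ?thesis using Suc.prems(1) basis_tuples_length[OF Suc.prems(1)] by simp
  next
    case False
    then show ?thesis using Suc.IH[OF zs(2)] Suc.prems(2) basis_tuples_length[OF zs(2)] zs(1) by simp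
  qed
qed simp

text \<open>A basis of K and all its initial segments are tuples in H, so every partial product of
  the tuple count is positive, and with it every factor. Positivity of factor i means that i is less
  than the conjugate part of \<open>ls\<close> at \<open>ms ! i\<close>, which is the containment in
  row i.\<close>

lemma partition_le_if_subgroup:
  assumes p: "prime p" and ms: "is_partition ms" and ls: "is_partition ls"
    and H: "subgroup H G" "has_type p ls (G\<lparr>carrier := H\<rparr>)"
    and K: "K \<in> subgroups_of_type p H ms"
  shows "partition_le ms ls"
proof -
  have "p > 1" using p by (rule prime_gt_1_nat)
  have K': "subgroup K G" "K \<subseteq> H" "has_type p ms (G\<lparr>carrier := K\<rparr>)"
    using K by (auto simp: subgroups_of_type_def)
  have "int (card (basis_tuples p K (nth ms) (length ms))) > 0"
    using card_basis_tuples_has_type(2)[OF p ms K'(1,3), of "length ms"] tuple_count_self_pos[OF \<open>p > 1\<close> ms]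
    by simp
  then have "basis_tuples p K (nth ms) (length ms) \<noteq> {}"
    by (metis card.empty less_irrefl of_nat_0)
  then obtain ys where ysK: "ys \<in> basis_tuples p K (nth ms) (length ms)"
    by blast
  then have ys: "ys \<in> basis_tuples p H (nth ms) (length ms)"
    by (rule basis_tuples_mono) (rule subset_trans[OF basis_tuples_subset[OF ysK] K'(2)])
  have pos: "tuple_count p ls (take n ms) > 0" if "n \<le> length ms" for n
  proof -
    have "take n ys \<in> basis_tuples p H (nth ms) n"
      using ys that by (rule basis_tuples_take)
    then have "card (basis_tuples p H (nth ms) n) > 0"
      using card_basis_tuples_has_type(1)[OF p ms H that] by (auto simp: card_gt_0_iff)
    then show ?thesis
      using card_basis_tuples_has_type(2)[OF p ms H that] by simp
  qed
  have "i < length ls \<and> ms ! i \<le> ls ! i" if i: "i < length ms" for i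
  proof -
    have "tuple_count p ls (take (Suc i) ms) = tuple_count p ls (take i ms) *
        (int p ^ torsion_exp ls (ms ! i) - int p ^ i * int p ^ torsion_exp ls (ms ! i - 1))"
      using i by (simp add: tuple_count_def min_absorb2)
    moreover have "tuple_count p ls (take (Suc i) ms) > 0" "tuple_count p ls (take i ms) > 0"
      using pos[of i] pos[of "Suc i"] i by simp_all
    ultimately have "int p ^ torsion_exp ls (ms ! i) - int p ^ i * int p ^ torsion_exp ls (ms ! i - 1) > 0"
      by (simp add: zero_less_mult_iff)
    moreover have "ms ! i > 0" using ms i by (simp add: is_partition_def)
    ultimately have "int p ^ (i + torsion_exp ls (ms ! i - 1)) <
        int p ^ (conjugate_part ls (ms ! i) + torsion_exp ls (ms ! i - 1))"
      by (simp add: torsion_exp_step[of "ms ! i"] power_add mult.commute)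
    then have "i < conjugate_part ls (ms ! i)"
      using \<open>p > 1\<close> by (subst (asm) power_strict_increasing_iff) auto
    then show ?thesis
      using ls by (simp add: less_conjugate_part_iff is_partition_def)
  qed
  then show ?thesis
    unfolding partition_le_def by (metis leI less_irrefl)
qed

section \<open>Existence of a type by a greedy choice of basis\<close>

lemma basis_tuples_cong:
  "(\<And>i. i < n \<Longrightarrow> \<mu> i = \<nu> i) \<Longrightarrow> basis_tuples p H \<mu> n = basis_tuples p H \<nu> n"
  by (induction n) auto

text \<open>The greedy construction: basis elements of the largest order are chosen first. After
  stage \<open>e\<close> the span has the same \<open>p ^ (e' - 1)\<close>-th powers of elements of exponent \<open>p ^ e'\<close> as
  the whole group, for every \<open>e' \<ge> e\<close>.\<close>

definition greedy_stage :: "nat \<Rightarrow> 'a set \<Rightarrow> nat \<Rightarrow> (nat \<Rightarrow> nat) \<Rightarrow> nat \<Rightarrow> 'a list \<Rightarrow> bool" where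
  "greedy_stage p H e \<mu> n ys \<longleftrightarrow>
     ys \<in> basis_tuples p H \<mu> n \<and>
     (\<forall>i j. i \<le> j \<and> j < n \<longrightarrow> \<mu> j \<le> \<mu> i) \<and> (\<forall>i<n. e \<le> \<mu> i) \<and>
     (\<forall>e'\<ge>e. \<forall>x\<in>torsion H (p ^ e').
        x [^] (p ^ (e' - 1)) \<in> (\<lambda>k. k [^] (p ^ (e' - 1))) ` torsion (generate G (set ys)) (p ^ e'))"

text \<open>Keep adding elements of exponent \<open>p ^ e\<close> whose
  \<open>p ^ (e - 1)\<close>-th power lies outside the span. The span grows each time, so this ends;
  then every such power lies in the \<open>p\<close>-torsion of the span and is therefore a
  \<open>p ^ (e - 1)\<close>-th power from the span.\<close>

lemma greedy_stage_step:
  assumes p: "prime p" and H: "subgroup H G" "finite H" and "e > 0"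
    and "greedy_stage p H (Suc e) \<mu> n ys"
  shows "\<exists>\<mu> n ys. greedy_stage p H e \<mu> n ys"
proof -
  have HG: "H \<subseteq> carrier G" using H(1) by (rule subgroup.subset)
  \<comment> \<open>The state between two stages: parts may already equal e, while the condition on
    powers is known only from \<open>Suc e\<close> on.\<close>
  define weak where "weak \<mu> n ys \<longleftrightarrow>
     ys \<in> basis_tuples p H \<mu> n \<and>
     (\<forall>i j. i \<le> j \<and> j < n \<longrightarrow> \<mu> j \<le> \<mu> i) \<and> (\<forall>i<n. e \<le> \<mu> i) \<and>
     (\<forall>e'\<ge>Suc e. \<forall>x\<in>torsion H (p ^ e').
        x [^] (p ^ (e' - 1)) \<in> (\<lambda>k. k [^] (p ^ (e' - 1))) ` torsion (generate G (set ys)) (p ^ e'))"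
    for \<mu> n ys
  have "weak \<mu> n ys"
    using assms(5) by (auto simp: weak_def greedy_stage_def dest: Suc_leD)
  then show ?thesis
  proof (induction "card H - card (generate G (set ys))" arbitrary: \<mu> n ys rule: less_induct)
    case less
    define K where "K = generate G (set ys)"
    have ysH: "set ys \<subseteq> H" using less.prems unfolding weak_def by (blast dest: basis_tuples_subset)
    have K: "subgroup K G" "K \<subseteq> H"
      unfolding K_def using ysH HG generate_is_subgroup generate_subgroup_incl[OF ysH H(1)] by auto
    show ?case
    proof (cases "\<forall>x\<in>torsion H (p ^ e). x [^] (p ^ (e - 1)) \<in> K")
      case True
      have ys: "ys \<in> basis_tuples p H \<mu> n" and \<mu>e: "\<And>i. i < n \<Longrightarrow> e \<le> \<mu> i"
        using less.prems by (auto simp: weak_def)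
      have "card (torsion K (p ^ e')) = p ^ (n * e')" if "e' \<le> e" for e'
        unfolding K_def using p HG ys \<open>e > 0\<close> \<mu>e that by (rule card_torsion_generate_basis_tuple)
      then have im: "(\<lambda>x. x [^] (p ^ (e - 1))) ` torsion K (p ^ e) = torsion K p"
        by (intro power_image_torsion K(1) finite_subset[OF K(2) H(2)] \<open>e > 0\<close> prime_gt_0_nat[OF p])
      have pe: "p ^ (e - 1) * p = p ^ e"
        using \<open>e > 0\<close> by (rule power_minus_mult)
      have at_e: "x [^] (p ^ (e - 1)) \<in> (\<lambda>k. k [^] (p ^ (e - 1))) ` torsion K (p ^ e)"
        if x: "x \<in> torsion H (p ^ e)" for x
      proof -
        have "x \<in> carrier G" using x HG by (auto simp: torsion_def)
        then have "(x [^] (p ^ (e - 1))) [^] p = \<one>"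
          using x by (simp only: nat_pow_pow pe) (simp add: torsion_def)
        then have "x [^] (p ^ (e - 1)) \<in> torsion K p"
          using True x by (simp add: torsion_def)
        then show ?thesis by (simp only: im)
      qed
      have "greedy_stage p H e \<mu> n ys"
        unfolding greedy_stage_def
      proof (intro conjI allI impI ballI)
        fix e' x assume "e \<le> e'" "x \<in> torsion H (p ^ e')"
        then show "x [^] (p ^ (e' - 1)) \<in> (\<lambda>k. k [^] (p ^ (e' - 1))) ` torsion (generate G (set ys)) (p ^ e')"
          using at_e less.prems by (cases "e = e'") (auto simp: weak_def K_def)
      qed (use less.prems in \<open>auto simp: weak_def\<close>)
      then show ?thesis by blast
    next
      case False
      then obtain x where x: "x \<in> torsion H (p ^ e)" "x [^] (p ^ (e - 1)) \<notin> K" by blast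
      define \<nu> where "\<nu> = \<mu>(n := e)"
      define K' where "K' = generate G (set (ys @ [x]))"
      have xH: "x \<in> H" using x(1) by (simp add: torsion_def)
      have "ys \<in> basis_tuples p H \<nu> n"
        using less.prems basis_tuples_cong[of n \<mu> \<nu>] by (auto simp: weak_def \<nu>_def)
      then have new: "ys @ [x] \<in> basis_tuples p H \<nu> (Suc n)"
        using x by (auto simp: \<nu>_def K_def)
      have KK': "K \<subseteq> K'" unfolding K_def K'_def by (rule mono_generate) auto
      have "x \<in> K'" unfolding K'_def by (rule generate.incl) simp
      moreover have "x \<notin> K" using x(2) power_image_subgroup[OF K(1)] by blast
      moreover have "K' \<subseteq> H"
        unfolding K'_def using ysH xH H(1) by (intro generate_subgroup_incl) auto
      ultimately have "card K < card K'" "card K' \<le> card H"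
        using KK' H(2) finite_subset by (auto intro!: psubset_card_mono card_mono)
      then have dec: "card H - card K' < card H - card K" by linarith
      have mono_tor: "torsion K k \<subseteq> torsion K' k" for k
        using KK' by (auto simp: torsion_def)
      have "weak \<nu> (Suc n) (ys @ [x])"
        unfolding weak_def
      proof (intro conjI allI impI ballI)
        show "\<nu> j \<le> \<nu> i" if "i \<le> j \<and> j < Suc n" for i j
          using that less.prems by (auto simp: weak_def \<nu>_def)
        show "e \<le> \<nu> i" if "i < Suc n" for i
          using that less.prems by (auto simp: weak_def \<nu>_def)
        fix e' z assume "Suc e \<le> e'" "z \<in> torsion H (p ^ e')"
        then have "z [^] (p ^ (e' - 1)) \<in> (\<lambda>k. k [^] (p ^ (e' - 1))) ` torsion K (p ^ e')"
          using less.prems by (auto simp: weak_def K_def)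
        then show "z [^] (p ^ (e' - 1)) \<in> (\<lambda>k. k [^] (p ^ (e' - 1))) ` torsion (generate G (set (ys @ [x]))) (p ^ e')"
          using mono_tor by (auto simp: K'_def)
      qed (rule new)
      then show ?thesis
        using less.hyps dec unfolding K_def K'_def by blast
    qed
  qed
qed

text \<open>Start above the exponent of the group, where all the powers in question are trivial, and
  go down to stage 1. The condition on powers then shows, by induction on the exponent of an
  element, that the span is everything.\<close>

lemma p_group_has_type:
  assumes p: "prime p" and H: "subgroup H G" "card H = p ^ k"
  shows "\<exists>ls. is_partition ls \<and> has_type p ls (G\<lparr>carrier := H\<rparr>)"
proof -
  have HG: "H \<subseteq> carrier G" using H(1) by (rule subgroup.subset)
  have "p > 0" using p by (rule prime_gt_0_nat)
  then have finH: "finite H" using H(2) by (metis card.infinite power_not_zero not_gr0)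
  have tor_all: "torsion H (p ^ e) = H" if "e \<ge> k" for e
  proof -
    have "x [^] (p ^ e) = \<one>" if "x \<in> H" for x
    proof -
      interpret H: comm_group "G\<lparr>carrier := H\<rparr>"
        by (rule group.group_comm_groupI[OF subgroup_imp_group[OF H(1)]]) (use HG in \<open>auto intro: m_comm\<close>)
      have "x [^] card H = \<one>"
        using H.power_order_eq_one[of x] \<open>x \<in> H\<close> finH by (simp flip: nat_pow_consistent)
      then have "x [^] (p ^ k * p ^ (e - k)) = \<one>"
        using \<open>x \<in> H\<close> HG H(2) by (metis nat_pow_one nat_pow_pow subsetD)
      then show ?thesis using \<open>e \<ge> k\<close> by (simp flip: power_add)
    qed
    then show ?thesis by (auto simp: torsion_def)
  qed
  have start: "greedy_stage p H (Suc k) \<mu> 0 []" for \<mu>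
  proof -
    have "\<one> \<in> torsion (generate G {}) m" for m by (simp add: torsion_def generate.one)
    moreover have "x [^] (p ^ (e' - 1)) = \<one> [^] (p ^ (e' - 1))" if "Suc k \<le> e'" "x \<in> torsion H (p ^ e')" for e' x
    proof -
      have "x \<in> torsion H (p ^ (e' - 1))" using that tor_all[of "e' - 1"] torsion_subset by fastforce
      then show ?thesis by (simp add: torsion_def)
    qed
    ultimately show ?thesis unfolding greedy_stage_def by (auto intro!: image_eqI[where x = "\<one>"])
  qed
  have "\<exists>\<mu> n ys. greedy_stage p H (Suc k - d) \<mu> n ys" if "d \<le> k" for d
    using that
  proof (induction d)
    case 0
    then show ?case using start by auto
  next
    case (Suc d)
    then have "Suc k - d = Suc (Suc k - Suc d)" by simp
    moreover obtain \<mu> n ys where "greedy_stage p H (Suc k - d) \<mu> n ys" using Suc by auto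
    ultimately have "greedy_stage p H (Suc (Suc k - Suc d)) \<mu> n ys" by simp
    then show ?case
      using Suc.prems by (intro greedy_stage_step[OF p H(1) finH]) auto
  qed
  from this[of k] obtain \<mu> n ys where "greedy_stage p H 1 \<mu> n ys" by auto
  then have ys: "ys \<in> basis_tuples p H \<mu> n"
    and \<mu>: "\<And>i j. i \<le> j \<Longrightarrow> j < n \<Longrightarrow> \<mu> j \<le> \<mu> i" "\<And>i. i < n \<Longrightarrow> \<mu> i > 0"
    and pow: "\<And>e x. e \<ge> 1 \<Longrightarrow> x \<in> torsion H (p ^ e) \<Longrightarrow>
        x [^] (p ^ (e - 1)) \<in> (\<lambda>k. k [^] (p ^ (e - 1))) ` torsion (generate G (set ys)) (p ^ e)"
    by (auto simp: greedy_stage_def)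
  define K where "K = generate G (set ys)"
  have ysH: "set ys \<subseteq> H" using ys by (rule basis_tuples_subset)
  have K: "subgroup K G" "K \<subseteq> H"
    unfolding K_def using ysH HG generate_is_subgroup generate_subgroup_incl[OF ysH H(1)] by auto
  have "torsion H (p ^ e) \<subseteq> K" for e
  proof (induction e)
    case 0
    then show ?case using HG K(1) by (auto simp: torsion_def subgroup.one_closed)
  next
    case (Suc e)
    show ?case
    proof
      fix x assume x: "x \<in> torsion H (p ^ Suc e)"
      then obtain c where c: "c \<in> K" "x [^] (p ^ e) = c [^] (p ^ e)"
        using pow[of "Suc e" x] by (auto simp: K_def torsion_def)
      have xG: "x \<in> carrier G" "x \<in> H" and cG: "c \<in> carrier G" "c \<in> H"
        using x c(1) K(2) HG by (auto simp: torsion_def)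
      \<comment> \<open>Dividing x by an element of the span with the same \<open>p ^ e\<close>-th
        power lowers its exponent.\<close>
      have "(x \<otimes> inv c) [^] (p ^ e) = \<one>"
        using c(2) xG cG by (simp add: nat_pow_distrib nat_pow_inv)
      moreover have "x \<otimes> inv c \<in> H"
        using xG cG H(1) by (simp add: subgroup.m_closed subgroup.m_inv_closed)
      ultimately have "x \<otimes> inv c \<in> K"
        using Suc by (auto simp: torsion_def)
      then have "x \<otimes> inv c \<otimes> c \<in> K"
        using c(1) K(1) by (simp add: subgroup.m_closed)
      then show "x \<in> K" using xG cG by (simp add: m_assoc)
    qed
  qed
  then have "K = H" using tor_all[of k] K(2) by blast
  moreover have "has_type p (map \<mu> [0..<n]) (G\<lparr>carrier := K\<rparr>)"
    unfolding K_def using p HG ys \<mu>(2) by (rule has_type_generate_basis_tuple)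
  moreover have "is_partition (map \<mu> [0..<n])"
    using \<mu> by (auto simp: is_partition_def sorted_wrt_iff_nth_less)
  ultimately show ?thesis by blast
qed

end

section \<open>Duality modulo a prime power\<close>

lemma (in group) sum_character:
  fixes \<phi> :: "'a \<Rightarrow> complex"
  assumes fin: "finite (carrier G)"
    and mult: "\<And>x y. x \<in> carrier G \<Longrightarrow> y \<in> carrier G \<Longrightarrow> \<phi> (x \<otimes> y) = \<phi> x * \<phi> y"
    and one: "\<phi> \<one> = 1"
  shows "(\<Sum>x\<in>carrier G. \<phi> x) = (if \<forall>x\<in>carrier G. \<phi> x = 1 then of_nat (card (carrier G)) else 0)"
proof (cases "\<forall>x\<in>carrier G. \<phi> x = 1")
  case True
  then show ?thesis by simp
next
  case False
  then obtain z where z: "z \<in> carrier G" "\<phi> z \<noteq> 1" by blast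
  have "(\<Sum>x\<in>carrier G. \<phi> x) = (\<Sum>x\<in>carrier G. \<phi> (z \<otimes> x))"
    by (rule sum.reindex_bij_witness[where i = "\<lambda>x. z \<otimes> x" and j = "\<lambda>x. inv z \<otimes> x"])
       (use z(1) in \<open>auto simp flip: m_assoc\<close>)
  also have "\<dots> = \<phi> z * (\<Sum>x\<in>carrier G. \<phi> x)"
    using z(1) by (simp add: mult sum_distrib_left)
  finally show ?thesis using z(2) False by auto
qed

lemma (in comm_group) comm_group_FactGroup:
  assumes "subgroup A G"
  shows "comm_group (G Mod A)"
proof -
  interpret normal A G using assms by (rule subgroup_imp_normal)
  show ?thesis
    by (rule group.group_comm_groupI[OF factorgroup_is_group])
       (auto simp: FactGroup_def RCOSETS_def rcos_sum m_comm)
qed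

lemma product_group_cong:
  assumes "\<And>i. i \<in> I \<Longrightarrow> G i = H i"
  shows "product_group I G = product_group I H"
proof -
  have "(\<Pi>\<^sub>E i\<in>I. carrier (G i)) = (\<Pi>\<^sub>E i\<in>I. carrier (H i))"
    using assms by (intro PiE_cong) simp
  moreover have "(\<lambda>x y. \<lambda>i\<in>I. x i \<otimes>\<^bsub>G i\<^esub> y i) = (\<lambda>x y. \<lambda>i\<in>I. x i \<otimes>\<^bsub>H i\<^esub> y i)"
    using assms by (auto simp: fun_eq_iff)
  moreover have "(\<lambda>i\<in>I. \<one>\<^bsub>G i\<^esub>) = (\<lambda>i\<in>I. \<one>\<^bsub>H i\<^esub>)"
    using assms by (auto simp: fun_eq_iff)
  ultimately show ?thesis by (simp add: product_group_def)
qed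

lemma comm_group_product_group:
  assumes "\<And>i. i \<in> I \<Longrightarrow> comm_group (G i)"
  shows "comm_group (product_group I G)"
proof (rule group.group_comm_groupI)
  show "group (product_group I G)"
    using assms by (simp add: comm_group_def)
  show "x \<otimes>\<^bsub>product_group I G\<^esub> y = y \<otimes>\<^bsub>product_group I G\<^esub> x"
    if "x \<in> carrier (product_group I G)" "y \<in> carrier (product_group I G)" for x y
    using that assms by (auto simp: PiE_iff comm_monoid.m_comm comm_group_def intro!: restrict_ext)
qed

text \<open>Used to extend orthogonality from a basis of a subgroup to the whole subgroup. The
  descent lowers one positive coordinate by 1.\<close>

lemma type_group_generated_by_units:
  assumes "p > 0" "subgroup S (type_group p ls)"
    and units: "\<And>i. i < length ls \<Longrightarrow> (\<lambda>j\<in>{..<length ls}. if j = i then 1 else 0) \<in> S"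
    and "x \<in> carrier (type_group p ls)"
  shows "x \<in> S"
  using assms(4)
proof (induction "\<Sum>i<length ls. nat (x i)" arbitrary: x rule: less_induct)
  case less
  have x: "0 \<le> x i" "x i < int (p ^ (ls ! i))" if "i < length ls" for i
    using less.prems assms(1) that by (auto simp: PiE_iff carrier_integer_mod_group)
  have ext: "x \<in> extensional {..<length ls}" using less.prems by (simp add: PiE_iff)
  show ?case
  proof (cases "\<forall>i<length ls. x i = 0")
    case True
    then have "x = \<one>\<^bsub>type_group p ls\<^esub>"
      using ext by (auto simp: fun_eq_iff extensional_def)
    then show ?thesis using subgroup.one_closed[OF assms(2)] by simp
  next
    case False
    then obtain i where i: "i < length ls" "x i > 0" using x by force
    define y where "y = x(i := x i - 1)"
    have "y \<in> carrier (type_group p ls)"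
      using x ext i assms(1)
      by (auto simp: PiE_iff carrier_integer_mod_group y_def extensional_def intro: less_trans)
         (smt (verit))
    moreover have "(\<Sum>j<length ls. nat (y j)) < (\<Sum>j<length ls. nat (x j))"
      by (rule sum_strict_mono_ex1) (use i in \<open>auto simp: y_def\<close>)
    ultimately have "y \<in> S" using less.hyps by blast
    moreover have "x = y \<otimes>\<^bsub>type_group p ls\<^esub> (\<lambda>j\<in>{..<length ls}. if j = i then 1 else 0)"
      using x ext i by (auto simp: fun_eq_iff y_def extensional_def)
    ultimately show ?thesis
      using subgroup.m_closed[OF assms(2)] units[OF i(1)] by metis
  qed
qed

text \<open>Positivity of \<open>N\<close> makes \<open>replicate s N\<close>, the type of the
  finite quotient, a partition, since parts have to be positive.\<close>

locale prime_power_lattice =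
  fixes s p N :: nat
  assumes prime_p: "prime p" and N_pos: "N > 0"
begin

abbreviation "L \<equiv> int_lattice s"

definition q :: nat where "q = p ^ N"

text \<open>Residues are represented by the integers from 0 to q - 1, so the carrier of
  \<open>Q\<close> is a subset of the carrier of the lattice and one \<open>dot\<close> serves
  both.\<close>

definition Q :: "(nat \<Rightarrow> int) monoid" where
  "Q = product_group {..<s} (\<lambda>_. integer_mod_group q)"

definition dot :: "(nat \<Rightarrow> int) \<Rightarrow> (nat \<Rightarrow> int) \<Rightarrow> int" where
  "dot x y = (\<Sum>i<s. x i * y i)"

definition perp :: "(nat \<Rightarrow> int) set \<Rightarrow> (nat \<Rightarrow> int) set" where
  "perp B = {x \<in> carrier Q. \<forall>b\<in>B. int q dvd dot b x}"

text \<open>\<open>annih\<close> takes orthogonals in the lattice; \<open>perp\<close> takes them in the finite quotient, but is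
  applied to subgroups of the quotient and to sublattices alike.\<close>

definition annih :: "(nat \<Rightarrow> int) set \<Rightarrow> (nat \<Rightarrow> int) set" where
  "annih B = {x \<in> carrier L. \<forall>b\<in>B. int q dvd dot b x}"

definition red :: "(nat \<Rightarrow> int) \<Rightarrow> nat \<Rightarrow> int" where
  "red x = (\<lambda>i\<in>{..<s}. x i mod int q)"

lemma p_pos: "p > 0" using prime_p by (rule prime_gt_0_nat)

lemma q_pos: "q > 0" using p_pos by (simp add: q_def)

lemma comm_group_L: "comm_group L"
  unfolding int_lattice_def by (rule comm_group_product_group) (rule abelian_integer_group)

lemma comm_group_Q: "comm_group Q"
  unfolding Q_def by (rule comm_group_product_group) simp

sublocale L: comm_group L by (rule comm_group_L)
sublocale Q: comm_group Q by (rule comm_group_Q)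

lemma carrier_L: "carrier L = extensional {..<s}"
  by (simp add: int_lattice_def PiE_def)

lemma mult_L: "x \<otimes>\<^bsub>L\<^esub> y = (\<lambda>i\<in>{..<s}. x i + y i)"
  by (simp add: int_lattice_def)

lemma one_L: "\<one>\<^bsub>L\<^esub> = (\<lambda>i\<in>{..<s}. 0)"
  by (simp add: int_lattice_def)

lemma inv_L: "x \<in> carrier L \<Longrightarrow> inv\<^bsub>L\<^esub> x = (\<lambda>i\<in>{..<s}. - x i)"
  by (simp add: int_lattice_def)

lemma pow_L: "x \<in> carrier L \<Longrightarrow> x [^]\<^bsub>L\<^esub> (n::nat) = (\<lambda>i\<in>{..<s}. int n * x i)"
  unfolding int_lattice_def by (subst pow_product_group) auto

lemma carrier_Q: "carrier Q = (\<Pi>\<^sub>E i\<in>{..<s}. {0..<int q})"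
  using q_pos by (simp add: Q_def carrier_integer_mod_group)

lemma mult_Q: "x \<otimes>\<^bsub>Q\<^esub> y = (\<lambda>i\<in>{..<s}. (x i + y i) mod int q)"
  by (simp add: Q_def)

lemma one_Q: "\<one>\<^bsub>Q\<^esub> = (\<lambda>i\<in>{..<s}. 0)"
  by (simp add: Q_def)

lemma inv_Q: "x \<in> carrier Q \<Longrightarrow> inv\<^bsub>Q\<^esub> x = (\<lambda>i\<in>{..<s}. (- x i) mod int q)"
  by (auto simp: Q_def PiE_iff intro!: restrict_ext)

lemma pow_Q: "x \<in> carrier Q \<Longrightarrow> x [^]\<^bsub>Q\<^esub> (n::nat) = (\<lambda>i\<in>{..<s}. (int n * x i) mod int q)"
  unfolding Q_def by (subst pow_product_group) auto

lemma Q_subset_L: "carrier Q \<subseteq> carrier L"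
  by (simp add: carrier_L carrier_Q PiE_def)

lemma Q_type_group: "Q = type_group p (replicate s N)"
  unfolding Q_def q_def length_replicate by (rule product_group_cong) simp

lemma has_type_Q: "has_type p (replicate s N) Q"
  unfolding has_type_def Q_type_group by (rule iso_refl)

lemma card_Q: "finite (carrier Q)" "card (carrier Q) = p ^ (s * N)"
  using has_type_card[OF has_type_Q p_pos] by (simp_all add: sum_list_replicate)

lemma red_in_Q: "red x \<in> carrier Q"
  using q_pos by (auto simp: red_def carrier_Q)

lemma dot_commute: "dot x y = dot y x"
  by (simp add: dot_def mult.commute)

lemma dot_cong:
  assumes "\<And>i. i < s \<Longrightarrow> int q dvd x i - y i"
  shows "int q dvd dot b x - dot b y"
proof -
  have "dot b x - dot b y = (\<Sum>i<s. b i * (x i - y i))"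
    by (simp add: dot_def algebra_simps sum_subtractf)
  also have "int q dvd \<dots>"
    by (rule dvd_sum) (use assms in auto)
  finally show ?thesis .
qed

lemma dot_red: "int q dvd dot b (red x) - dot b x"
  by (rule dot_cong) (simp add: red_def mod_eq_dvd_iff[symmetric])

lemma dot_mult_L: "dot b (x \<otimes>\<^bsub>L\<^esub> y) = dot b x + dot b y"
  by (simp add: dot_def mult_L algebra_simps sum.distrib)

lemma mult_Q_eq_red: "x \<otimes>\<^bsub>Q\<^esub> y = red (x \<otimes>\<^bsub>L\<^esub> y)"
  by (auto simp: mult_Q mult_L red_def fun_eq_iff)

lemma dot_mult_Q: "int q dvd dot b (x \<otimes>\<^bsub>Q\<^esub> y) - (dot b x + dot b y)"
  unfolding mult_Q_eq_red using dot_red[of b "x \<otimes>\<^bsub>L\<^esub> y"] by (simp only: dot_mult_L)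

lemma dvd_dot_mult_Q:
  "int q dvd dot b x \<Longrightarrow> int q dvd dot b y \<Longrightarrow> int q dvd dot b (x \<otimes>\<^bsub>Q\<^esub> y)"
  using dot_mult_Q[of b x y] by (metis diff_add_cancel dvd_add)

lemma dvd_dot_red_iff: "int q dvd dot b (red x) \<longleftrightarrow> int q dvd dot b x"
  using dot_red[of b x] by (metis diff_add_cancel dvd_add_right_iff)

lemma dot_one: "dot b (\<lambda>i\<in>{..<s}. 0) = 0"
  by (simp add: dot_def)

lemma dot_inv_L: "x \<in> carrier L \<Longrightarrow> dot b (inv\<^bsub>L\<^esub> x) = - dot b x"
  by (simp add: dot_def inv_L sum_negf)

lemma perp_subgroup: "subgroup (perp B) Q"
proof
  show "perp B \<subseteq> carrier Q" by (auto simp: perp_def)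
  show "\<one>\<^bsub>Q\<^esub> \<in> perp B"
    using Q.one_closed by (simp add: perp_def one_Q dot_one)
  show "x \<otimes>\<^bsub>Q\<^esub> y \<in> perp B" if "x \<in> perp B" "y \<in> perp B" for x y
    using that by (simp add: perp_def dvd_dot_mult_Q)
  show "inv\<^bsub>Q\<^esub> x \<in> perp B" if "x \<in> perp B" for x
  proof -
    have x: "x \<in> carrier Q" using that by (simp add: perp_def)
    have "inv\<^bsub>Q\<^esub> x = red (inv\<^bsub>L\<^esub> x)"
      using x Q_subset_L by (auto simp: inv_Q inv_L red_def fun_eq_iff)
    then have "int q dvd dot b (inv\<^bsub>Q\<^esub> x) \<longleftrightarrow> int q dvd dot b x" for b
      using x Q_subset_L by (simp add: dvd_dot_red_iff dot_inv_L subset_iff)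
    then show ?thesis using that by (simp add: perp_def)
  qed
qed

lemma annih_subgroup: "subgroup (annih B) L"
proof
  show "annih B \<subseteq> carrier L" by (auto simp: annih_def)
  show "\<one>\<^bsub>L\<^esub> \<in> annih B"
    using L.one_closed by (simp add: annih_def one_L dot_one)
  show "x \<otimes>\<^bsub>L\<^esub> y \<in> annih B" if "x \<in> annih B" "y \<in> annih B" for x y
    using that by (simp add: annih_def dot_mult_L)
  show "inv\<^bsub>L\<^esub> x \<in> annih B" if "x \<in> annih B" for x
    using that by (simp add: annih_def dot_inv_L)
qed

definition chi :: "int \<Rightarrow> complex" where
  "chi k = cis (2 * pi * (of_int k / of_nat q))"

lemma chi_add: "chi (a + b) = chi a * chi b"
  by (simp add: chi_def cis_mult ring_distribs add_divide_distrib)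

lemma chi_eq_1_iff: "chi k = 1 \<longleftrightarrow> int q dvd k"
proof
  assume "int q dvd k"
  then obtain c where "k = int q * c" by (elim dvdE)
  then have "of_int k / of_nat q = (of_int c :: real)"
    using q_pos by simp
  then show "chi k = 1" by (simp add: chi_def)
next
  assume "chi k = 1"
  then have "cos (2 * pi * (of_int k / of_nat q)) = 1"
    by (simp add: chi_def complex_eq_iff)
  then obtain n :: int where "2 * pi * (of_int k / of_nat q) = of_int n * 2 * pi"
    by (auto simp: cos_one_2pi_int)
  then have "2 * pi * (real_of_int k / of_nat q) = 2 * pi * of_int n" by (simp only: mult.commute mult.left_commute)
  then have "real_of_int k / of_nat q = of_int n" by (subst (asm) mult_cancel_left) simp
  then have "real_of_int k = of_int (n * int q)"
    using q_pos by (simp add: field_simps)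
  then have "k = n * int q" by linarith
  then show "int q dvd k" by simp
qed

lemma chi_cong: "int q dvd a - b \<Longrightarrow> chi a = chi b"
  using chi_add[of "a - b" b] chi_eq_1_iff[of "a - b"] by simp

lemma chi_dot_mult_Q: "chi (dot b (x \<otimes>\<^bsub>Q\<^esub> y)) = chi (dot b x) * chi (dot b y)"
  using chi_cong[OF dot_mult_Q] by (simp add: chi_add)

lemma zero_if_dot_zero:
  assumes b: "b \<in> carrier Q" and "\<And>x. x \<in> carrier Q \<Longrightarrow> int q dvd dot b x"
  shows "b = \<one>\<^bsub>Q\<^esub>"
proof -
  have "b i = 0" if i: "i < s" for i
  proof -
    have "int q dvd dot b (red (\<lambda>j. if j = i then 1 else 0))"
      using assms(2) red_in_Q by blast
    then have "int q dvd dot b (\<lambda>j. if j = i then 1 else 0)"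
      by (simp only: dvd_dot_red_iff)
    also have "dot b (\<lambda>j. if j = i then 1 else 0) = b i"
      using i by (simp add: dot_def if_distrib[of "(*) _"] sum.delta cong: if_cong)
    finally show ?thesis
      using b i zdvd_not_zless[of "b i" "int q"] by (force simp: carrier_Q PiE_iff)
  qed
  then show ?thesis
    using b by (auto simp: one_Q carrier_Q fun_eq_iff PiE_iff extensional_def)
qed

text \<open>Evaluate the double sum of \<open>chi (dot b x)\<close> over B and \<open>Q\<close> in
  both orders: summing over B first singles out \<open>perp B\<close>, summing over \<open>Q\<close>
  first singles out b = 0, because the pairing is nondegenerate.\<close>

lemma card_perp:
  assumes B: "subgroup B Q"
  shows "card B * card (perp B) = card (carrier Q)"
proof -
  have BQ: "B \<subseteq> carrier Q" using B by (rule subgroup.subset)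
  have finB: "finite B" using BQ card_Q(1) finite_subset by blast
  interpret B: group "Q\<lparr>carrier := B\<rparr>" using B by (rule Q.subgroup_imp_group)
  have "(\<Sum>b\<in>B. chi (dot x b)) = (if \<forall>b\<in>B. chi (dot x b) = 1 then of_nat (card B) else 0)" for x
    using B.sum_character[of "\<lambda>b. chi (dot x b)"] finB
    by (simp add: chi_dot_mult_Q chi_eq_1_iff dot_one one_Q)
  then have inner_B: "(\<Sum>b\<in>B. chi (dot b x)) = (if x \<in> perp B then of_nat (card B) else 0)"
    if "x \<in> carrier Q" for x
    using that by (simp add: perp_def chi_eq_1_iff dot_commute[of _ x])
  have inner_Q: "(\<Sum>x\<in>carrier Q. chi (dot b x)) = (if b = \<one>\<^bsub>Q\<^esub> then of_nat (card (carrier Q)) else 0)"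
    if "b \<in> B" for b
  proof -
    have "(\<forall>x\<in>carrier Q. chi (dot b x) = 1) \<longleftrightarrow> b = \<one>\<^bsub>Q\<^esub>"
      using zero_if_dot_zero[of b] that BQ by (auto simp: chi_eq_1_iff one_Q dot_def)
    then show ?thesis
      using Q.sum_character[of "\<lambda>x. chi (dot b x)"] card_Q(1)
      by (simp add: chi_dot_mult_Q chi_eq_1_iff dot_one one_Q)
  qed
  have "(of_nat (card B * card (perp B)) :: complex) = (\<Sum>x\<in>carrier Q. if x \<in> perp B then of_nat (card B) else 0)"
    using card_Q(1) subgroup.subset[OF perp_subgroup, of B]
    by (simp add: sum.If_cases Int_absorb1)
  also have "\<dots> = (\<Sum>x\<in>carrier Q. \<Sum>b\<in>B. chi (dot b x))"
    by (simp add: inner_B)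
  also have "\<dots> = (\<Sum>b\<in>B. \<Sum>x\<in>carrier Q. chi (dot b x))"
    by (rule sum.swap)
  also have "\<dots> = of_nat (card (carrier Q))"
    using finB subgroup.one_closed[OF B] by (simp add: inner_Q)
  finally show ?thesis by (simp only: of_nat_eq_iff)
qed

lemma perp_perp:
  assumes B: "subgroup B Q"
  shows "perp (perp B) = B"
proof (rule card_subset_eq[symmetric])
  show "finite (perp (perp B))"
    using card_Q(1) subgroup.subset[OF perp_subgroup] finite_subset by blast
  show "B \<subseteq> perp (perp B)"
    using subgroup.subset[OF B] by (auto simp: perp_def dot_commute)
  have "card B * card (perp B) = card (perp B) * card (perp (perp B))"
    using card_perp[OF B] card_perp[OF perp_subgroup, of B] by simp
  moreover have "card (perp B) > 0"
    using card_Q(1) subgroup.subset[OF perp_subgroup, of B] subgroup.one_closed[OF perp_subgroup, of B]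
    by (metis card_gt_0_iff empty_iff finite_subset)
  ultimately show "card B = card (perp (perp B))" by simp
qed

lemma annih_iff_red: "x \<in> carrier L \<Longrightarrow> x \<in> annih B \<longleftrightarrow> red x \<in> perp B"
  by (simp add: annih_def perp_def dvd_dot_red_iff red_in_Q)

lemma perp_annih:
  assumes "subgroup B Q"
  shows "perp (annih B) = B"
proof -
  have "perp (annih B) = perp (perp B)"
  proof
    show "perp (annih B) \<subseteq> perp (perp B)"
      using Q_subset_L by (auto simp: perp_def annih_def)
    show "perp (perp B) \<subseteq> perp (annih B)"
    proof
      fix x assume x: "x \<in> perp (perp B)"
      have "int q dvd dot b x" if "b \<in> annih B" for b
      proof -
        have "red b \<in> perp B" using that annih_iff_red by (auto simp: annih_def)
        then have "int q dvd dot (red b) x" using x by (simp add: perp_def[of "perp B"])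
        then show ?thesis by (simp add: dvd_dot_red_iff dot_commute[of _ x])
      qed
      then show "x \<in> perp (annih B)" using x by (simp add: perp_def)
    qed
  qed
  then show ?thesis using perp_perp[OF assms] by simp
qed

text \<open>A sublattice that contains q times the lattice is determined by its residues, and these
  are represented by its intersection with the carrier of \<open>Q\<close>. On that level the claim
  is \<open>perp_perp\<close>.\<close>

lemma annih_perp:
  assumes A: "subgroup A L" and qA: "\<And>x. x \<in> carrier L \<Longrightarrow> x [^]\<^bsub>L\<^esub> q \<in> A"
  shows "annih (perp A) = A"
proof -
  have red_iff: "red x \<in> A \<longleftrightarrow> x \<in> A" if x: "x \<in> carrier L" for x
  proof -
    define z where "z = (\<lambda>i\<in>{..<s}. x i div int q)"
    have z: "z \<in> carrier L" by (simp add: z_def carrier_L)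
    have r: "red x \<in> carrier L" using red_in_Q Q_subset_L by blast
    have eq: "x = red x \<otimes>\<^bsub>L\<^esub> z [^]\<^bsub>L\<^esub> q"
    proof -
      have "x i = (red x \<otimes>\<^bsub>L\<^esub> z [^]\<^bsub>L\<^esub> q) i" for i
        using x unfolding pow_L[OF z] by (simp add: mult_L red_def z_def carrier_L extensional_def)
      then show ?thesis by (rule ext)
    qed
    have zA: "z [^]\<^bsub>L\<^esub> q \<in> A" by (rule qA[OF z])
    show ?thesis
    proof
      assume "red x \<in> A"
      then show "x \<in> A" using eq zA subgroup.m_closed[OF A] by metis
    next
      assume "x \<in> A"
      then have "x \<otimes>\<^bsub>L\<^esub> inv\<^bsub>L\<^esub> (z [^]\<^bsub>L\<^esub> q) \<in> A"
        using zA A by (simp add: subgroup.m_closed subgroup.m_inv_closed)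
      moreover have "x \<otimes>\<^bsub>L\<^esub> inv\<^bsub>L\<^esub> (z [^]\<^bsub>L\<^esub> q) = red x"
        using eq r z by (metis L.inv_solve_right' L.nat_pow_closed x)
      ultimately show "red x \<in> A" by simp
    qed
  qed
  define A' where "A' = A \<inter> carrier Q"
  have A': "subgroup A' Q"
  proof
    show "A' \<subseteq> carrier Q" by (simp add: A'_def)
    show "\<one>\<^bsub>Q\<^esub> \<in> A'"
      using Q.one_closed subgroup.one_closed[OF A] by (simp add: A'_def one_Q one_L)
    show "x \<otimes>\<^bsub>Q\<^esub> y \<in> A'" if "x \<in> A'" "y \<in> A'" for x y
    proof -
      have "x \<otimes>\<^bsub>L\<^esub> y \<in> A" using that A by (simp add: A'_def subgroup.m_closed)
      then have "red (x \<otimes>\<^bsub>L\<^esub> y) \<in> A"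
        using red_iff subgroup.mem_carrier[OF A] by blast
      then show ?thesis by (simp add: A'_def mult_Q_eq_red red_in_Q)
    qed
    show "inv\<^bsub>Q\<^esub> x \<in> A'" if "x \<in> A'" for x
    proof -
      have x: "x \<in> carrier Q" "x \<in> A" using that by (auto simp: A'_def)
      then have "inv\<^bsub>Q\<^esub> x = red (inv\<^bsub>L\<^esub> x)"
        using Q_subset_L by (auto simp: inv_Q inv_L red_def fun_eq_iff)
      moreover have "inv\<^bsub>L\<^esub> x \<in> A" using x A by (simp add: subgroup.m_inv_closed)
      ultimately have "inv\<^bsub>Q\<^esub> x \<in> A"
        using red_iff subgroup.mem_carrier[OF A] by simp
      then show ?thesis using x by (simp add: A'_def)
    qed
  qed
  have "perp A = perp A'"
  proof
    show "perp A \<subseteq> perp A'" by (auto simp: perp_def A'_def)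
    show "perp A' \<subseteq> perp A"
    proof
      fix x assume x: "x \<in> perp A'"
      have "int q dvd dot a x" if "a \<in> A" for a
      proof -
        have "red a \<in> A'" using that red_iff subgroup.mem_carrier[OF A] red_in_Q by (simp add: A'_def)
        then have "int q dvd dot (red a) x" using x by (simp add: perp_def)
        then show ?thesis by (simp add: dvd_dot_red_iff dot_commute[of _ x])
      qed
      then show "x \<in> perp A" using x by (simp add: perp_def)
    qed
  qed
  then have "x \<in> annih (perp A) \<longleftrightarrow> x \<in> A" if "x \<in> carrier L" for x
    using annih_iff_red[OF that] perp_perp[OF A'] red_iff[OF that] red_in_Q by (simp add: A'_def)
  moreover have "annih (perp A) \<subseteq> carrier L" "A \<subseteq> carrier L"
    using A subgroup.subset by (auto simp: annih_def)
  ultimately show ?thesis by blast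
qed

end

section \<open>Equality of types under the duality\<close>

lemma partition_le_antisym:
  assumes "partition_le ls ms" "partition_le ms ls"
  shows "ls = ms"
  using assms unfolding partition_le_def by (intro nth_equalityI) (auto intro: antisym)

text \<open>Viewing the group as a subgroup of itself gives containment of types in both
  directions.\<close>

lemma (in comm_group) has_type_unique:
  assumes "prime p" "is_partition ls" "is_partition ms" "has_type p ls G" "has_type p ms G"
  shows "ls = ms"
proof (rule partition_le_antisym)
  show "partition_le ls ms" "partition_le ms ls"
    using assms partition_le_if_subgroup[OF assms(1), of _ _ "carrier G" "carrier G"] subgroup_self
    by (auto simp: subgroups_of_type_def)
qed

context prime_power_lattice
begin

text \<open>The quotient by \<open>annih B\<close> is the dual of B, and a finite abelian group is
  isomorphic to its dual. Explicitly, a lattice element is sent to its pairings with a basis of B;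
  the kernel is \<open>annih B\<close>, and surjectivity follows by counting on
  \<open>Q\<close>.\<close>

lemma has_type_annih:
  assumes B: "subgroup B Q" and ls: "is_partition ls" "\<And>x. x \<in> set ls \<Longrightarrow> x \<le> N"
    and type: "has_type p ls (Q\<lparr>carrier := B\<rparr>)"
  shows "has_type p ls (L Mod annih B)"
proof -
  define k where "k = length ls"
  define P where "P = type_group p ls"
  define u where "u i = (\<lambda>j\<in>{..<k}. if j = i then 1 else (0::int))" for i
  have p1: "p > 1" using prime_p by (rule prime_gt_1_nat)
  have BQ: "B \<subseteq> carrier Q" using B by (rule subgroup.subset)
  have grpP: "group P" unfolding P_def by (rule group_type_group)
  interpret B: group "Q\<lparr>carrier := B\<rparr>" using B by (rule Q.subgroup_imp_group)
  have "P \<cong> Q\<lparr>carrier := B\<rparr>"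
    using type B.iso_sym by (simp add: has_type_def P_def)
  then obtain h where h: "h \<in> iso P (Q\<lparr>carrier := B\<rparr>)" by (auto simp: is_iso_def)
  interpret h: group_hom P "Q\<lparr>carrier := B\<rparr>" h
    unfolding group_hom_def group_hom_axioms_def using h grpP B.is_group by (simp add: iso_def)
  have h_bij: "bij_betw h (carrier P) B" using h by (simp add: iso_def)
  have ls_pos: "ls ! i > 0" and ls_le: "ls ! i \<le> N" if "i < k" for i
    using ls that by (auto simp: is_partition_def k_def)
  have u_P: "u i \<in> carrier P" if "i < k" for i
  proof -
    have "1 < int (p ^ (ls ! i))"
      using one_less_power[OF p1 ls_pos[OF that]] by linarith
    then show ?thesis
      using p1 by (auto simp: P_def u_def k_def PiE_iff carrier_integer_mod_group)
  qed
  have h_B: "h x \<in> B" if "x \<in> carrier P" for x using h_bij that bij_betwE by blast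
  define x where "x i = h (u i)" for i
  have x_B: "x i \<in> B" and x_Q: "x i \<in> carrier Q" if "i < k" for i
    using h_B[OF u_P[OF that]] BQ by (auto simp: x_def)
  have split_q: "q = p ^ (ls ! i) * p ^ (N - ls ! i)" if "i < k" for i
    using ls_le[OF that] by (simp add: q_def flip: power_add)
  \<comment> \<open>A basis element killed by \<open>p ^ (ls ! i)\<close> modulo q has all its
    coordinates divisible by \<open>p ^ (N - ls ! i)\<close>.\<close>
  have x_tor: "int (p ^ (N - ls ! i)) dvd dot (x i) y" if i: "i < k" for i y
  proof -
    have "u i [^]\<^bsub>P\<^esub> (p ^ (ls ! i)) = \<one>\<^bsub>P\<^esub>"
      unfolding P_def by (subst pow_product_group) (use u_P[OF i] in \<open>auto simp: P_def u_def k_def fun_eq_iff\<close>)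
    then have "h (u i [^]\<^bsub>P\<^esub> (p ^ (ls ! i))) = \<one>\<^bsub>Q\<^esub>" using h.hom_one by simp
    then have "x i [^]\<^bsub>Q\<^esub> (p ^ (ls ! i)) = \<one>\<^bsub>Q\<^esub>"
      using h.hom_nat_pow[OF u_P[OF i]] by (simp add: x_def flip: Q.nat_pow_consistent)
    then have "(\<lambda>j\<in>{..<s}. (int (p ^ (ls ! i)) * x i j) mod int q) = (\<lambda>j\<in>{..<s}. 0)"
      by (simp only: pow_Q[OF x_Q[OF i]] one_Q)
    then have "int q dvd int (p ^ (ls ! i)) * x i j" if "j < s" for j
      unfolding dvd_eq_mod_eq_0 using that by (drule_tac fun_cong[of _ _ j]) simp
    then have "int (p ^ (N - ls ! i)) dvd x i j" if "j < s" for j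
      using that p_pos by (simp add: split_q[OF i])
    then show ?thesis unfolding dot_def by (intro dvd_sum) auto
  qed
  \<comment> \<open>By \<open>x_tor\<close> the division is exact; it identifies the possible
    pairings modulo q with residues modulo \<open>p ^ (ls ! i)\<close>.\<close>
  define f where "f y = (\<lambda>i\<in>{..<k}. (dot (x i) y div int (p ^ (N - ls ! i))) mod int (p ^ (ls ! i)))" for y
  have f_P: "f y \<in> carrier P" for y
    using p_pos by (auto simp: f_def P_def k_def carrier_integer_mod_group)
  have f_add: "f z = f y \<otimes>\<^bsub>P\<^esub> f y'"
    if z: "\<And>i. i < k \<Longrightarrow> int q dvd dot (x i) z - (dot (x i) y + dot (x i) y')" for y y' z
  proof -
    have "f z i = (f y i + f y' i) mod int (p ^ (ls ! i))" if i: "i < k" for i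
    proof -
      let ?c = "int (p ^ (N - ls ! i))" and ?d = "int (p ^ (ls ! i))"
      have c0: "?c \<noteq> 0" using p_pos by simp
      obtain a b e where ab: "dot (x i) y = ?c * a" "dot (x i) y' = ?c * b" "dot (x i) z = ?c * e"
        using x_tor[OF i] by (meson dvdE)
      have "int q = ?c * ?d" using split_q[OF i] by (metis mult.commute of_nat_mult)
      then have "?c * ?d dvd ?c * (e - (a + b))"
        using z[OF i] by (simp add: ab right_diff_distrib distrib_left)
      then have "?d dvd e - (a + b)"
        using c0 dvd_times_left_cancel_iff[of ?c] by blast
      then have "e mod ?d = (a + b) mod ?d"
        by (simp only: mod_eq_dvd_iff)
      then show ?thesis
        using i c0 by (simp only: f_def ab nonzero_mult_div_cancel_left not_False_eq_True mod_add_eq restrict_apply lessThan_iff if_True)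
    qed
    then show ?thesis
      by (auto simp: P_def k_def fun_eq_iff f_def)
  qed
  have f_eq_one_iff: "f y = \<one>\<^bsub>P\<^esub> \<longleftrightarrow> (\<forall>i<k. int q dvd dot (x i) y)" for y
  proof -
    have "f y i = 0 \<longleftrightarrow> int q dvd dot (x i) y" if i: "i < k" for i
    proof -
      let ?c = "int (p ^ (N - ls ! i))" and ?d = "int (p ^ (ls ! i))"
      have c0: "?c \<noteq> 0" using p_pos by simp
      obtain a where a: "dot (x i) y = ?c * a" using x_tor[OF i] by (meson dvdE)
      have "int q = ?c * ?d" using split_q[OF i] by (metis mult.commute of_nat_mult)
      then have "int q dvd dot (x i) y \<longleftrightarrow> ?d dvd a"
        using dvd_times_left_cancel_iff[OF c0, of ?d a] by (simp only: a)
      also have "\<dots> \<longleftrightarrow> f y i = 0"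
        using i c0 by (simp only: f_def a nonzero_mult_div_cancel_left not_False_eq_True dvd_eq_mod_eq_0 restrict_apply lessThan_iff if_True)
      finally show ?thesis by blast
    qed
    moreover have "f y = \<one>\<^bsub>P\<^esub> \<longleftrightarrow> (\<forall>i<k. f y i = 0)"
      by (auto simp: P_def k_def fun_eq_iff f_def)
    ultimately show ?thesis by auto
  qed
  \<comment> \<open>Orthogonality to the basis extends to B, since the coordinate vectors whose
    image is orthogonal to y form a subgroup containing all unit vectors.\<close>
  have dvd_all: "int q dvd dot b y" if y: "\<And>i. i < k \<Longrightarrow> int q dvd dot (x i) y" and b: "b \<in> B" for b y
  proof -
    define S where "S = {c \<in> carrier P. int q dvd dot (h c) y}"
    have dvd_Q: "int q dvd dot (a \<otimes>\<^bsub>Q\<^esub> c) y" if "int q dvd dot a y" "int q dvd dot c y" for a c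
      using dvd_dot_mult_Q[of y a c] that by (simp add: dot_commute[of _ y])
    have "subgroup S P"
    proof (rule group.subgroupI[OF grpP])
      show "S \<subseteq> carrier P" by (auto simp: S_def)
      have "\<one>\<^bsub>P\<^esub> \<in> S" using h.hom_one h.G.one_closed by (simp add: S_def one_Q dot_def)
      then show "S \<noteq> {}" by blast
      show mult: "a \<otimes>\<^bsub>P\<^esub> c \<in> S" if "a \<in> S" "c \<in> S" for a c
        using that h.hom_mult[of a c] h.G.m_closed[of a c] dvd_Q by (auto simp: S_def)
      show "inv\<^bsub>P\<^esub> a \<in> S" if "a \<in> S" for a
      proof -
        have a: "a \<in> carrier P" "h a \<in> carrier Q" "int q dvd dot (h a) y"
          using that h_B BQ by (auto simp: S_def)
        have "h (inv\<^bsub>P\<^esub> a) = inv\<^bsub>Q\<^esub> (h a)"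
          using h.hom_inv[OF a(1)] Q.m_inv_consistent[OF B h_B[OF a(1)]] by simp
        moreover have "int q dvd dot y (inv\<^bsub>Q\<^esub> (h a))"
          using subgroup.m_inv_closed[OF perp_subgroup[of "{y}"], of "h a"] a
          by (simp add: perp_def dot_commute[of _ y])
        ultimately show ?thesis
          using a(1) by (simp add: S_def dot_commute[of _ y])
      qed
    qed
    moreover have "(\<lambda>j\<in>{..<length ls}. if j = i then 1 else 0) \<in> S" if "i < length ls" for i
      using y[of i] u_P[of i] that by (simp add: S_def x_def u_def k_def)
    ultimately have "c \<in> S" if "c \<in> carrier P" for c
      using type_group_generated_by_units[OF p_pos] that unfolding P_def by blast
    moreover obtain c where "c \<in> carrier P" "b = h c"
      using h_bij b by (auto simp: bij_betw_def)
    ultimately show ?thesis by (auto simp: S_def)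
  qed
  have f_hom_L: "f \<in> hom L P"
    by (rule homI) (simp_all only: f_P, rule f_add, simp add: dot_mult_L)
  have f_hom_Q: "f \<in> hom Q P"
    by (rule homI) (simp_all only: f_P, rule f_add, rule dot_mult_Q)
  interpret fL: group_hom L P f
    unfolding group_hom_def group_hom_axioms_def using f_hom_L grpP L.is_group by simp
  interpret fQ: group_hom Q P f
    unfolding group_hom_def group_hom_axioms_def using f_hom_Q grpP Q.is_group by simp
  have ker_L: "kernel L P f = annih B"
    using dvd_all x_B by (auto simp: kernel_def annih_def f_eq_one_iff)
  have ker_Q: "kernel Q P f = perp B"
    using dvd_all x_B by (auto simp: kernel_def perp_def f_eq_one_iff)
  \<comment> \<open>The image of \<open>Q\<close> has card(Q) / card(\<open>perp B\<close>) =
    card(B) elements, as many as \<open>P\<close>.\<close>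
  have "card (carrier Q) = card (perp B) * card (f ` carrier Q)"
    using fQ.card_kernel_times_image[OF card_Q(1)] by (simp only: ker_Q)
  then have "card (perp B) * card (f ` carrier Q) = card (perp B) * card B"
    using card_perp[OF B] by (simp only: mult.commute)
  moreover have "card (perp B) \<noteq> 0"
    using card_perp[OF B] card_Q p_pos by (metis mult_0_right power_not_zero not_gr0)
  ultimately have "card (f ` carrier Q) = card (carrier P)"
    using bij_betw_same_card[OF h_bij] by simp
  moreover have "f ` carrier Q \<subseteq> carrier P" using f_P by blast
  moreover have "finite (carrier P)" unfolding P_def by (rule card_type_group[OF p_pos])
  ultimately have "f ` carrier Q = carrier P" by (metis card_subset_eq)
  then have "f ` carrier L = carrier P"
    using Q_subset_L f_P by blast
  then have "L Mod kernel L P f \<cong> P" by (rule fL.FactGroup_iso)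
  then show ?thesis by (simp only: ker_L has_type_def P_def[symmetric])
qed

lemma pow_q_in_if_has_type:
  assumes A: "subgroup A L" and ls: "\<And>x. x \<in> set ls \<Longrightarrow> x \<le> N"
    and type: "has_type p ls (L Mod A)" and x: "x \<in> carrier L"
  shows "x [^]\<^bsub>L\<^esub> q \<in> A"
proof -
  interpret A: normal A L using A by (rule L.subgroup_imp_normal)
  interpret M: group "L Mod A" by (rule A.factorgroup_is_group)
  define P where "P = type_group p ls"
  obtain h where h: "h \<in> iso (L Mod A) P"
    using type by (auto simp: has_type_def is_iso_def P_def)
  have grpP: "group P" unfolding P_def by (rule group_type_group)
  interpret h: group_hom "L Mod A" P h
    unfolding group_hom_def group_hom_axioms_def using h grpP M.is_group by (simp add: iso_def)
  interpret r: group_hom L "L Mod A" "\<lambda>a. A #>\<^bsub>L\<^esub> a"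
    unfolding group_hom_def group_hom_axioms_def using A.r_coset_hom_Mod L.is_group M.is_group by simp
  have P_q: "z [^]\<^bsub>P\<^esub> q = \<one>\<^bsub>P\<^esub>" if z: "z \<in> carrier P" for z
  proof -
    have "int (p ^ (ls ! i)) dvd int q * z i" if "i < length ls" for i
      using ls[OF nth_mem[OF that]] by (simp add: q_def le_imp_power_dvd)
    then show ?thesis
      using z unfolding P_def by (subst pow_product_group) (auto simp: fun_eq_iff)
  qed
  let ?c = "A #>\<^bsub>L\<^esub> x"
  have c: "?c \<in> carrier (L Mod A)" using r.hom_closed[OF x] .
  have "h (?c [^]\<^bsub>L Mod A\<^esub> q) = h \<one>\<^bsub>L Mod A\<^esub>"
    by (simp only: h.hom_nat_pow[OF c] P_q[OF h.hom_closed[OF c]] h.hom_one)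
  moreover have "inj_on h (carrier (L Mod A))" using h by (simp add: iso_def bij_betw_def)
  ultimately have "?c [^]\<^bsub>L Mod A\<^esub> q = \<one>\<^bsub>L Mod A\<^esub>"
    using c by (meson M.nat_pow_closed M.one_closed inj_onD)
  then have "A #>\<^bsub>L\<^esub> (x [^]\<^bsub>L\<^esub> q) = A"
    using r.hom_nat_pow[OF x] by (simp add: FactGroup_def)
  then show ?thesis
    using L.coset_join1[OF _ _ A] x by simp
qed

text \<open>Obtained indirectly: \<open>perp A\<close> has some type by the existence result, its
  parts are at most \<open>N\<close> because it lies in \<open>Q\<close>, so
  \<open>has_type_annih\<close> gives the quotient that same type, and types are unique.\<close>

lemma has_type_perp:
  assumes A: "subgroup A L" and ls: "is_partition ls" "\<And>x. x \<in> set ls \<Longrightarrow> x \<le> N"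
    and type: "has_type p ls (L Mod A)"
  shows "has_type p ls (Q\<lparr>carrier := perp A\<rparr>)" "annih (perp A) = A"
proof -
  interpret A: normal A L using A by (rule L.subgroup_imp_normal)
  show eq: "annih (perp A) = A"
    using annih_perp[OF A] pow_q_in_if_has_type[OF A ls(2) type] by blast
  have B: "subgroup (perp A) Q" by (rule perp_subgroup)
  have "card (perp A) dvd p ^ (s * N)"
    using card_perp[OF B] card_Q(2) by (metis dvd_triv_left)
  then obtain j where "card (perp A) = p ^ j"
    using divides_primepow_nat[OF prime_p] by blast
  then obtain ns where ns: "is_partition ns" "has_type p ns (Q\<lparr>carrier := perp A\<rparr>)"
    using Q.p_group_has_type[OF prime_p B] by blast
  have "partition_le ns (replicate s N)"
    by (rule Q.partition_le_if_subgroup[OF prime_p ns(1), of _ "carrier Q" "perp A"])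
      (use N_pos has_type_Q Q.subgroup_self B ns(2) subgroup.subset[OF B] in
        \<open>auto simp: is_partition_def Q.subgroups_of_type_def sorted_wrt_iff_nth_less\<close>)
  then have "x \<le> N" if "x \<in> set ns" for x
    using that by (auto simp: partition_le_def in_set_conv_nth)
  then have "has_type p ns (L Mod A)"
    using has_type_annih[OF B ns(1) _ ns(2)] by (simp add: eq)
  then have "ns = ls"
    using comm_group.has_type_unique[OF L.comm_group_FactGroup[OF A] prime_p ns(1) ls(1)] type by blast
  with ns(2) show "has_type p ls (Q\<lparr>carrier := perp A\<rparr>)" by simp
qed

end

section \<open>Counting chains\<close>

text \<open>With \<lambda>' and \<mu>' for the conjugates of \<open>ls\<close> and
  \<open>ms\<close>, this is the classical product over e > 0 of the variable to the power
  \<mu>'_(e+1) (\<lambda>'_e - \<mu>'_e) and the Gaussian binomial of \<lambda>'_e - \<mu>'_(e+1)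
  over \<mu>'_e - \<mu>'_(e+1). The Gaussian factor is 1 if e is not a part of
  \<open>ms\<close>.\<close>

definition subgroup_poly :: "nat list \<Rightarrow> nat list \<Rightarrow> nat poly" where
  "subgroup_poly ls ms =
     (if partition_le ms ls then
        monom 1 (\<Sum>i<length ms. torsion_exp ls (ms ! i - 1) - torsion_exp ms (ms ! i - 1)) *
        (\<Prod>e\<in>set ms. gauss_poly (conjugate_part ms e - conjugate_part ms (Suc e))
           (conjugate_part ls e - conjugate_part ms e))
      else 0)"

lemma conjugate_part_mono:
  assumes "is_partition ls" "is_partition ms" "partition_le ms ls"
  shows "conjugate_part ms e \<le> conjugate_part ls e"
proof (rule ccontr)
  let ?c = "conjugate_part ls e"
  assume "\<not> ?thesis"
  then have "?c < conjugate_part ms e" by simp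
  moreover have sorted: "sorted_wrt (\<ge>) ls" "sorted_wrt (\<ge>) ms"
    using assms by (simp_all add: is_partition_def)
  ultimately have c: "?c < length ms" "e \<le> ms ! ?c"
    by (simp_all add: less_conjugate_part_iff)
  then have "?c < length ls" "ms ! ?c \<le> ls ! ?c"
    using assms(3) by (simp_all add: partition_le_def)
  with c(2) have "?c < length ls \<and> e \<le> ls ! ?c" by simp
  then have "?c < ?c" by (rule less_conjugate_part_iff[OF sorted(1), THEN iffD2])
  then show False by simp
qed

lemma torsion_exp_mono:
  assumes "is_partition ls" "is_partition ms" "partition_le ms ls"
  shows "torsion_exp ms e \<le> torsion_exp ls e"
proof (induction e)
  case 0
  then show ?case by (simp add: torsion_exp_def)
next
  case (Suc e)
  then show ?case
    using torsion_exp_step[of "Suc e"] conjugate_part_mono[OF assms, of "Suc e"] by (simp add: add_mono)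
qed

text \<open>Equal parts of a partition occupy a window of indices that may start anywhere. On such a
  window both products carry the same power of \<open>int p ^ a\<close>, which reduces the claim to
  \<open>gauss_poly_quotient\<close>.\<close>

lemma gauss_poly_quotient_shift:
  assumes "a \<le> b" "b \<le> c"
  shows "int (poly (gauss_poly (b - a) (c - b)) p) * (\<Prod>i\<in>{a..<b}. int p ^ b - int p ^ i) =
     (\<Prod>i\<in>{a..<b}. int p ^ c - int p ^ i)"
proof -
  have shift: "(\<Prod>i\<in>{a..<b}. int p ^ d - int p ^ i) = (int p ^ a) ^ (b - a) * (\<Prod>i<b - a. int p ^ (d - a) - int p ^ i)"
    if "b \<le> d" for d
  proof -
    have "(\<Prod>i\<in>{a..<b}. int p ^ d - int p ^ i) = (\<Prod>i<b - a. int p ^ d - int p ^ (i + a))"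
      by (rule prod.reindex_bij_witness[where i = "\<lambda>i. i + a" and j = "\<lambda>i. i - a"]) auto
    also have "\<dots> = (\<Prod>i<b - a. int p ^ a * (int p ^ (d - a) - int p ^ i))"
    proof (rule prod.cong)
      fix i
      have "int p ^ d = int p ^ a * int p ^ (d - a)"
        using that assms(1) by (simp flip: power_add)
      then show "int p ^ d - int p ^ (i + a) = int p ^ a * (int p ^ (d - a) - int p ^ i)"
        by (simp add: power_add algebra_simps)
    qed simp
    also have "\<dots> = (int p ^ a) ^ (b - a) * (\<Prod>i<b - a. int p ^ (d - a) - int p ^ i)"
      by (simp add: prod.distrib)
    finally show ?thesis .
  qed
  have "b - a + (c - b) = c - a" using assms by simp
  then show ?thesis
    using gauss_poly_quotient[of "b - a" "c - b" p] assms
    by (simp add: shift[of b] shift[of c] mult.left_commute)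
qed

text \<open>In a partition the positions of the parts equal to e form the interval between two
  consecutive conjugate parts.\<close>

lemma prod_by_parts:
  fixes g :: "nat \<Rightarrow> nat \<Rightarrow> int"
  assumes "is_partition ms"
  shows "(\<Prod>i<length ms. g (ms ! i) i) =
    (\<Prod>e\<in>set ms. \<Prod>i\<in>{conjugate_part ms (Suc e)..<conjugate_part ms e}. g e i)"
proof -
  have sorted: "sorted_wrt (\<ge>) ms" using assms by (simp add: is_partition_def)
  have "(\<Prod>i<length ms. g (ms ! i) i) =
     (\<Prod>e\<in>set ms. \<Prod>i | i \<in> {..<length ms} \<and> ms ! i = e. g (ms ! i) i)"
    by (rule prod.group[symmetric]) auto
  also have "\<dots> = (\<Prod>e\<in>set ms. \<Prod>i\<in>{conjugate_part ms (Suc e)..<conjugate_part ms e}. g e i)"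
  proof (rule prod.cong[OF refl])
    fix e
    have "i < length ms \<and> ms ! i = e \<longleftrightarrow>
        \<not> i < conjugate_part ms (Suc e) \<and> i < conjugate_part ms e" for i
      unfolding less_conjugate_part_iff[OF sorted] by (auto simp: Suc_le_eq)
    then have eq: "{i. i \<in> {..<length ms} \<and> ms ! i = e} = {conjugate_part ms (Suc e)..<conjugate_part ms e}"
      by (simp add: set_eq_iff not_less)
    show "(\<Prod>i | i \<in> {..<length ms} \<and> ms ! i = e. g (ms ! i) i) =
        (\<Prod>i\<in>{conjugate_part ms (Suc e)..<conjugate_part ms e}. g e i)"
    proof (rule prod.cong[OF eq])
      fix i assume "i \<in> {conjugate_part ms (Suc e)..<conjugate_part ms e}"
      then have "ms ! i = e" using eq by blast
      then show "g (ms ! i) i = g e i" by simp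
    qed
  qed
  finally show ?thesis .
qed

lemma mult_mult_swap: "(a * b) * (c * d) = (a * c) * (b * (d :: int))"
  by simp

text \<open>The same equation that \<open>card_subgroups_of_type\<close> gives for the number of
  subgroups, so the two agree once \<open>tuple_count p ms ms\<close> is positive. Powers of p are
  matched index by index, the remaining factors by the value of the part.\<close>

lemma poly_subgroup_poly:
  assumes ls: "is_partition ls" and ms: "is_partition ms" and le: "partition_le ms ls"
  shows "int (poly (subgroup_poly ls ms) p) * tuple_count p ms ms = tuple_count p ls ms"
proof -
  let ?E = "\<lambda>i. torsion_exp ls (ms ! i - 1) - torsion_exp ms (ms ! i - 1)"
  let ?g = "\<lambda>e. gauss_poly (conjugate_part ms e - conjugate_part ms (Suc e))
           (conjugate_part ls e - conjugate_part ms e)"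
  have sorted: "sorted_wrt (\<ge>) ms" using ms by (simp add: is_partition_def)
  have anti: "conjugate_part ms (Suc e) \<le> conjugate_part ms e" for e
  proof -
    have "i < conjugate_part ms e" if "i < conjugate_part ms (Suc e)" for i
      using that by (simp add: less_conjugate_part_iff[OF sorted])
    then show ?thesis using not_less by blast
  qed
  have "int (poly (subgroup_poly ls ms) p) =
     (\<Prod>i<length ms. int p ^ ?E i) * (\<Prod>e\<in>set ms. int (poly (?g e) p))"
    using le by (simp add: subgroup_poly_def poly_monom poly_prod power_sum)
  moreover have "(\<Prod>e\<in>set ms. int (poly (?g e) p)) * (\<Prod>i<length ms. int p ^ conjugate_part ms (ms ! i) - int p ^ i) =
      (\<Prod>i<length ms. int p ^ conjugate_part ls (ms ! i) - int p ^ i)"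
    unfolding prod_by_parts[OF ms, where g = "\<lambda>e i. int p ^ conjugate_part ms e - int p ^ i"]
      prod_by_parts[OF ms, where g = "\<lambda>e i. int p ^ conjugate_part ls e - int p ^ i"]
      prod.distrib[symmetric]
    by (rule prod.cong[OF refl], rule gauss_poly_quotient_shift)
      (auto intro: anti conjugate_part_mono[OF ls ms le])
  moreover have "(\<Prod>i<length ms. int p ^ ?E i) * (\<Prod>i<length ms. int p ^ torsion_exp ms (ms ! i - 1)) =
      (\<Prod>i<length ms. int p ^ torsion_exp ls (ms ! i - 1))"
    using torsion_exp_mono[OF ls ms le] by (simp flip: prod.distrib power_add)
  ultimately show ?thesis
    unfolding tuple_count_eq[OF ms] prod.distrib by (simp only: mult_mult_swap)
qed

lemma sym_unimodal_subgroup_poly: "\<exists>d. sym_unimodal d (subgroup_poly ls ms)"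
proof (cases "partition_le ms ls")
  case True
  have gauss_prod: "\<exists>d. sym_unimodal d (\<Prod>e\<in>A. gauss_poly (a e) (b e))" for A :: "nat set" and a b
  proof (induction A rule: infinite_finite_induct)
    case (insert e A)
    then obtain d where "sym_unimodal d (\<Prod>e\<in>A. gauss_poly (a e) (b e))" by blast
    from sym_unimodal_mult[OF sym_unimodal_gauss_poly this] show ?case
      using insert.hyps by auto
  qed (use sym_unimodal_gauss_poly[of 0 0] in auto)
  then obtain d where "sym_unimodal d (\<Prod>e\<in>set ms. gauss_poly
      (conjugate_part ms e - conjugate_part ms (Suc e)) (conjugate_part ls e - conjugate_part ms e))"
    using gauss_prod[where A = "set ms"] by meson
  from sym_unimodal_mult[OF sym_unimodal_monom this] show ?thesis
    using True by (auto simp: subgroup_poly_def)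
next
  case False
  then show ?thesis using sym_unimodal_0 by (auto simp: subgroup_poly_def)
qed

section \<open>Flags of subgroups with prescribed types\<close>

primrec chain_poly :: "nat list \<Rightarrow> nat list list \<Rightarrow> nat poly" where
  "chain_poly ls [] = 1"
| "chain_poly ls (ms # Ms) = subgroup_poly ls ms * chain_poly ms Ms"

lemma sym_unimodal_chain_poly: "\<exists>d. sym_unimodal d (chain_poly ls Ms)"
proof (induction Ms arbitrary: ls)
  case Nil
  show ?case using sym_unimodal_gauss_poly[of 0 0] by auto
next
  case (Cons ms Ms)
  then show ?case
    using sym_unimodal_subgroup_poly sym_unimodal_mult by (metis chain_poly.simps(2))
qed

context comm_group
begin

primrec type_chains :: "nat \<Rightarrow> nat list list \<Rightarrow> 'a set \<Rightarrow> 'a set list set" where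
  "type_chains p [] H = {[]}"
| "type_chains p (ms # Ms) H =
     (\<Union>K\<in>subgroups_of_type p H ms. (#) K ` type_chains p Ms K)"

lemma type_chains_iff:
  assumes "H \<subseteq> carrier G"
  shows "Ks \<in> type_chains p Ms H \<longleftrightarrow>
     list_all2 (\<lambda>ms K. K \<in> subgroups_of_type p (carrier G) ms) Ms Ks \<and>
     sorted_wrt (\<lambda>A B. B \<subseteq> A) (H # Ks)"
  using assms
proof (induction Ms arbitrary: H Ks)
  case Nil
  then show ?case by auto
next
  case (Cons ms Ms)
  show ?case
  proof (cases Ks)
    case Nil
    then show ?thesis by auto
  next
    case (Cons K Ks')
    have K: "K \<in> subgroups_of_type p H ms \<longleftrightarrow> K \<in> subgroups_of_type p (carrier G) ms \<and> K \<subseteq> H"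
      using Cons.prems by (auto simp: subgroups_of_type_def)
    have "transp (\<lambda>A B :: 'a set. B \<subseteq> A)" by (auto intro: transpI)
    then have "sorted_wrt (\<lambda>A B. B \<subseteq> A) (H # Ks) \<longleftrightarrow> K \<subseteq> H \<and> sorted_wrt (\<lambda>A B. B \<subseteq> A) (K # Ks')"
      unfolding Cons by (subst sorted_wrt2) auto
    moreover have "Ks \<in> type_chains p (ms # Ms) H \<longleftrightarrow> K \<in> subgroups_of_type p H ms \<and> Ks' \<in> type_chains p Ms K"
      by (auto simp: Cons)
    moreover have "K \<in> subgroups_of_type p (carrier G) ms \<Longrightarrow> K \<subseteq> carrier G"
      by (auto simp: subgroups_of_type_def)
    ultimately show ?thesis
      using K Cons.IH[of K Ks'] Cons by auto
  qed
qed

text \<open>The number of continuations below K depends only on the type of K, so the sum over K is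
  a product.\<close>

lemma card_type_chains:
  assumes p: "prime p" and H: "subgroup H G" "has_type p ls (G\<lparr>carrier := H\<rparr>)"
    and parts: "is_partition ls" "\<forall>ms\<in>set Ms. is_partition ms"
  shows "finite (type_chains p Ms H) \<and> card (type_chains p Ms H) = poly (chain_poly ls Ms) p"
  using H parts
proof (induction Ms arbitrary: H ls)
  case Nil
  then show ?case by simp
next
  case (Cons ms Ms)
  define S where "S = subgroups_of_type p H ms"
  have ms: "is_partition ms" using Cons.prems by simp
  have "finite H" using has_type_card[OF Cons.prems(2)] prime_gt_0_nat[OF p] by simp
  then have finS: "finite S"
    by (intro finite_subset[of S "Pow H"]) (auto simp: S_def subgroups_of_type_def)
  have IH: "finite (type_chains p Ms K) \<and> card (type_chains p Ms K) = poly (chain_poly ms Ms) p" if "K \<in> S" for K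
    using that Cons.prems by (intro Cons.IH) (auto simp: S_def subgroups_of_type_def)
  have card_S: "card S = poly (subgroup_poly ls ms) p"
  proof (cases "partition_le ms ls")
    case True
    have "int (card S) * tuple_count p ms ms = int (poly (subgroup_poly ls ms) p) * tuple_count p ms ms"
      using card_subgroups_of_type[OF p ms Cons.prems(1,2)] poly_subgroup_poly[OF Cons.prems(3) ms True]
      by (simp add: S_def)
    then show ?thesis
      using tuple_count_self_pos[OF prime_gt_1_nat[OF p] ms] by simp
  next
    case False
    \<comment> \<open>No subgroup of this type exists, in agreement with the zero polynomial in
      \<open>subgroup_poly\<close>.\<close>
    then have "S = {}"
      using partition_le_if_subgroup[OF p ms Cons.prems(3,1,2)] by (auto simp: S_def)
    then show ?thesis using False by (simp add: subgroup_poly_def)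
  qed
  have "card (type_chains p (ms # Ms) H) = (\<Sum>K\<in>S. card ((#) K ` type_chains p Ms K))"
    unfolding type_chains.simps S_def[symmetric]
    by (rule card_UN_disjoint) (use finS IH in auto)
  also have "\<dots> = (\<Sum>K\<in>S. poly (chain_poly ms Ms) p)"
    by (rule sum.cong) (use IH in \<open>simp_all add: card_image\<close>)
  finally show ?case
    using finS IH card_S by (simp add: S_def[symmetric])
qed

end

section \<open>Chains of sublattices as flags in the finite quotient\<close>

definition lattice_type_chains :: "nat \<Rightarrow> nat list list \<Rightarrow> nat \<Rightarrow> (nat \<Rightarrow> int) set list set" where
  "lattice_type_chains s \<Lambda> p =
     {As \<in> subgroup_chains s (length \<Lambda>).
        \<forall>i<length \<Lambda>. finite (rcosets\<^bsub>int_lattice s\<^esub> (As ! i)) \<and>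
          has_type p (\<Lambda> ! i) (int_lattice s Mod (As ! i))}"

lemma has_type_finite_rcosets:
  assumes "has_type p ls (G Mod A)" "p > 0"
  shows "finite (rcosets\<^bsub>G\<^esub> A)" "card (rcosets\<^bsub>G\<^esub> A) = p ^ sum_list ls"
  using has_type_card[OF assms] by (simp_all add: FactGroup_def)

lemma subgroup_chains_iff:
  "As \<in> subgroup_chains s m \<longleftrightarrow>
     length As = m \<and> (\<forall>i<m. subgroup (As ! i) (int_lattice s)) \<and> sorted_wrt (\<lambda>A B. B \<subseteq> A) As"
proof -
  have "transp (\<lambda>A B :: (nat \<Rightarrow> int) set. B \<subseteq> A)" by (auto intro: transpI)
  then show ?thesis
    by (auto simp: subgroup_chains_def sorted_wrt_iff_nth_Suc_transp)
qed

lemma lattice_type_chains_iff: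
  assumes "p > 0"
  shows "As \<in> lattice_type_chains s \<Lambda> p \<longleftrightarrow>
     list_all2 (\<lambda>ls A. subgroup A (int_lattice s) \<and> has_type p ls (int_lattice s Mod A)) \<Lambda> As \<and>
     sorted_wrt (\<lambda>A B. B \<subseteq> A) As"
  by (auto simp: lattice_type_chains_def subgroup_chains_iff list_all2_conv_all_nth
      intro: has_type_finite_rcosets(1)[OF _ assms])

context prime_power_lattice
begin

text \<open>\<open>perp\<close> reverses inclusions, so the images of A_1, ..., A_m increase;
  \<open>rev\<close> restores the decreasing order in which flags are listed, and the types follow
  as \<open>rev \<Lambda>\<close>.\<close>

lemma bij_betw_lattice_type_chains:
  assumes parts: "\<forall>ls\<in>set \<Lambda>. is_partition ls \<and> (\<forall>x\<in>set ls. x \<le> N)"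
  shows "bij_betw (\<lambda>As. rev (map perp As)) (lattice_type_chains s \<Lambda> p)
           (Q.type_chains p (rev \<Lambda>) (carrier Q))"
proof (rule bij_betw_byWitness[where f' = "\<lambda>Bs. map annih (rev Bs)"])
  let ?X = "lattice_type_chains s \<Lambda> p" and ?Y = "Q.type_chains p (rev \<Lambda>) (carrier Q)"
  have perp_anti: "perp A \<subseteq> perp B" and annih_anti: "annih A \<subseteq> annih B" if "B \<subseteq> A" for A B
    using that by (auto simp: perp_def annih_def)
  have X: "As \<in> ?X \<longleftrightarrow> list_all2 (\<lambda>ls A. subgroup A L \<and> has_type p ls (L Mod A)) \<Lambda> As \<and>
      sorted_wrt (\<lambda>A B. B \<subseteq> A) As" for As
    by (rule lattice_type_chains_iff[OF p_pos])
  have Y: "Bs \<in> ?Y \<longleftrightarrow> list_all2 (\<lambda>ls B. B \<in> Q.subgroups_of_type p (carrier Q) ls) (rev \<Lambda>) Bs \<and>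
      sorted_wrt (\<lambda>A B. B \<subseteq> A) Bs" for Bs
  proof -
    have "B \<subseteq> carrier Q" if "list_all2 (\<lambda>ls B. B \<in> Q.subgroups_of_type p (carrier Q) ls) (rev \<Lambda>) Bs" "B \<in> set Bs" for B
      using that by (auto simp: Q.subgroups_of_type_def list_all2_conv_all_nth in_set_conv_nth)
    then show ?thesis by (auto simp: Q.type_chains_iff)
  qed
  have to_Q: "perp A \<in> Q.subgroups_of_type p (carrier Q) ls" "annih (perp A) = A"
    if "ls \<in> set \<Lambda>" "subgroup A L" "has_type p ls (L Mod A)" for ls A
    using has_type_perp[OF that(2) _ _ that(3)] that(1) parts subgroup.subset[OF perp_subgroup, of A]
    by (auto simp: Q.subgroups_of_type_def perp_subgroup)
  have to_L: "subgroup (annih B) L \<and> has_type p ls (L Mod annih B)" "perp (annih B) = B"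
    if "ls \<in> set \<Lambda>" "B \<in> Q.subgroups_of_type p (carrier Q) ls" for ls B
    using has_type_annih[of B ls] that parts by (auto simp: Q.subgroups_of_type_def annih_subgroup perp_annih)
  show "\<forall>As\<in>?X. map annih (rev (rev (map perp As))) = As"
  proof
    fix As assume "As \<in> ?X"
    then have l: "list_all2 (\<lambda>ls A. subgroup A L \<and> has_type p ls (L Mod A)) \<Lambda> As"
      by (simp only: X)
    have "annih (perp A) = A" if A: "A \<in> set As" for A
    proof -
      obtain i where "i < length As" "A = As ! i" using A by (auto simp: in_set_conv_nth)
      then have "\<Lambda> ! i \<in> set \<Lambda>" "subgroup A L" "has_type p (\<Lambda> ! i) (L Mod A)"
        using l by (auto simp: list_all2_conv_all_nth)
      then show ?thesis by (rule to_Q(2))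
    qed
    then show "map annih (rev (rev (map perp As))) = As"
      by (simp add: map_idI)
  qed
  show "\<forall>Bs\<in>?Y. rev (map perp (map annih (rev Bs))) = Bs"
  proof
    fix Bs assume "Bs \<in> ?Y"
    then have l: "list_all2 (\<lambda>ls B. B \<in> Q.subgroups_of_type p (carrier Q) ls) (rev \<Lambda>) Bs"
      by (simp only: Y)
    have "perp (annih B) = B" if B: "B \<in> set Bs" for B
    proof -
      obtain i where i: "i < length Bs" "B = Bs ! i" using B by (auto simp: in_set_conv_nth)
      then have "rev \<Lambda> ! i \<in> set (rev \<Lambda>)" "B \<in> Q.subgroups_of_type p (carrier Q) (rev \<Lambda> ! i)"
        using l by (auto simp: list_all2_conv_all_nth simp del: set_rev)
      then show ?thesis using to_L(2) by simp
    qed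
    then have "map (perp \<circ> annih) (rev Bs) = rev Bs"
      by (intro map_idI) simp
    then show "rev (map perp (map annih (rev Bs))) = Bs" by simp
  qed
  show "(\<lambda>As. rev (map perp As)) ` ?X \<subseteq> ?Y"
  proof safe
    fix As assume As: "As \<in> ?X"
    have "list_all2 (\<lambda>ls A. perp A \<in> Q.subgroups_of_type p (carrier Q) ls) \<Lambda> As"
      using As to_Q(1) unfolding X by (auto simp: list_all2_conv_all_nth)
    moreover have "sorted_wrt (\<lambda>A B. B \<subseteq> A) As"
      using As unfolding X by simp
    then have "sorted_wrt (\<lambda>A B. perp A \<subseteq> perp B) As"
      by (rule sorted_wrt_mono_rel[rotated]) (rule perp_anti)
    ultimately show "rev (map perp As) \<in> ?Y"
      unfolding Y by (simp add: list_all2_map2 sorted_wrt_rev sorted_wrt_map)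
  qed
  show "(\<lambda>Bs. map annih (rev Bs)) ` ?Y \<subseteq> ?X"
  proof safe
    fix Bs assume Bs: "Bs \<in> ?Y"
    then have "list_all2 (\<lambda>ls B. B \<in> Q.subgroups_of_type p (carrier Q) ls) \<Lambda> (rev Bs)"
      unfolding Y by (metis list_all2_rev rev_rev_ident)
    then have "list_all2 (\<lambda>ls B. subgroup (annih B) L \<and> has_type p ls (L Mod annih B)) \<Lambda> (rev Bs)"
      unfolding list_all2_conv_all_nth using to_L(1)[OF nth_mem] by blast
    moreover have "sorted_wrt (\<lambda>A B. A \<subseteq> B) (rev Bs)"
      using Bs unfolding Y by (simp add: sorted_wrt_rev)
    then have "sorted_wrt (\<lambda>A B. annih B \<subseteq> annih A) (rev Bs)"
      by (rule sorted_wrt_mono_rel[rotated]) (rule annih_anti)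
    ultimately show "map annih (rev Bs) \<in> ?X"
      unfolding X by (simp add: list_all2_map2 sorted_wrt_map)
  qed
qed

lemma card_lattice_type_chains:
  assumes "\<forall>ls\<in>set \<Lambda>. is_partition ls \<and> (\<forall>x\<in>set ls. x \<le> N)"
  shows "finite (lattice_type_chains s \<Lambda> p)"
    "card (lattice_type_chains s \<Lambda> p) = poly (chain_poly (replicate s N) (rev \<Lambda>)) p"
proof -
  have "finite (Q.type_chains p (rev \<Lambda>) (carrier Q)) \<and>
      card (Q.type_chains p (rev \<Lambda>) (carrier Q)) = poly (chain_poly (replicate s N) (rev \<Lambda>)) p"
    using assms N_pos has_type_Q
    by (intro Q.card_type_chains prime_p Q.subgroup_self)
      (auto simp: is_partition_def sorted_wrt_iff_nth_less)
  then show "finite (lattice_type_chains s \<Lambda> p)"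
    "card (lattice_type_chains s \<Lambda> p) = poly (chain_poly (replicate s N) (rev \<Lambda>)) p"
    using bij_betw_lattice_type_chains[OF assms] bij_betw_finite bij_betw_same_card by metis+
qed

lemma has_type_if_card_rcosets:
  assumes A: "subgroup A L" and "card (rcosets\<^bsub>L\<^esub> A) = p ^ a"
  shows "\<exists>ls. is_partition ls \<and> has_type p ls (L Mod A) \<and> sum_list ls = a"
proof -
  interpret M: comm_group "L Mod A" by (rule L.comm_group_FactGroup[OF A])
  have "card (carrier (L Mod A)) = p ^ a"
    using assms(2) by (simp add: FactGroup_def)
  from M.p_group_has_type[OF prime_p M.subgroup_self this]
  obtain ls where ls: "is_partition ls" "has_type p ls (L Mod A)" by auto
  moreover have "p ^ sum_list ls = p ^ a"
    using has_type_finite_rcosets(2)[OF ls(2) p_pos] assms(2) by simp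
  then have "sum_list ls = a"
    using prime_gt_1_nat[OF prime_p] by simp
  ultimately show ?thesis by blast
qed

end

section \<open>The polynomials for both kinds of chains\<close>

lemma finite_partitions: "finite {ls. is_partition ls \<and> sum_list ls = a}"
proof (rule finite_subset)
  show "{ls. is_partition ls \<and> sum_list ls = a} \<subseteq> {ls. set ls \<subseteq> {..a} \<and> length ls \<le> a}"
  proof (intro subsetI CollectI conjI)
    fix ls assume "ls \<in> {ls. is_partition ls \<and> sum_list ls = a}"
    then have ls: "is_partition ls" "a = sum_list ls" by auto
    show "x \<in> {..a}" if "x \<in> set ls" for x
      using member_le_sum_list[OF that] ls(2) by simp
    have "sum_list ls = (\<Sum>i<length ls. ls ! i)"
      by (simp add: sum_list_sum_nth atLeast0LessThan)
    also have "\<dots> \<ge> (\<Sum>i<length ls. 1)"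
      by (rule sum_mono) (use ls(1) in \<open>auto simp: is_partition_def Suc_le_eq\<close>)
    finally show "length ls \<le> a" by (simp add: ls(2))
  qed
  show "finite {ls. set ls \<subseteq> {..a} \<and> length ls \<le> a}"
    by (rule finite_lists_length_le) simp
qed

text \<open>Every subgroup of index \<open>p ^ a\<close> has exactly one type, a partition of a, so
  the chains fall into finitely many disjoint classes. Tuples of types that are not nested, or with
  a type of more than s parts, enter with the zero polynomial.\<close>

lemma alpha_index_eq_poly:
  "\<exists>f :: nat poly. \<forall>p. prime p \<longrightarrow> alpha_index s S p = poly f p"
proof -
  define m where "m = card S"
  define a where "a = sorted_list_of_set S"
  \<comment> \<open>No part exceeds the total of its partition; the successor keeps \<open>N\<close>
    positive when all exponents are 0. As \<open>N\<close> does not involve p, neither does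
    \<open>f\<close>.\<close>
  define N where "N = Suc (sum_list a)"
  define \<L> where "\<L> = {\<Lambda>. length \<Lambda> = m \<and> (\<forall>i<m. is_partition (\<Lambda> ! i) \<and> sum_list (\<Lambda> ! i) = a ! i)}"
  define f where "f = (\<Sum>\<Lambda>\<in>\<L>. chain_poly (replicate s N) (rev \<Lambda>))"
  have len: "length a = m" by (simp add: a_def m_def)
  have fin: "finite \<L>"
  proof (rule finite_subset)
    show "\<L> \<subseteq> {\<Lambda>. set \<Lambda> \<subseteq> (\<Union>i<m. {ls. is_partition ls \<and> sum_list ls = a ! i}) \<and> length \<Lambda> = m}"
      by (force simp: \<L>_def in_set_conv_nth)
    show "finite {\<Lambda>. set \<Lambda> \<subseteq> (\<Union>i<m. {ls. is_partition ls \<and> sum_list ls = a ! i}) \<and> length \<Lambda> = m}"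
      by (rule finite_lists_length_eq) (simp add: finite_partitions)
  qed
  have "alpha_index s S p = poly f p" if p: "prime p" for p
  proof -
    interpret prime_power_lattice s p N
      by unfold_locales (use p in \<open>simp_all add: N_def\<close>)
    have parts: "\<forall>ls\<in>set \<Lambda>. is_partition ls \<and> (\<forall>x\<in>set ls. x \<le> N)" if \<Lambda>: "\<Lambda> \<in> \<L>" for \<Lambda>
    proof
      fix ls assume "ls \<in> set \<Lambda>"
      then obtain i where i: "i < m" "ls = \<Lambda> ! i" using \<Lambda> by (auto simp: \<L>_def in_set_conv_nth)
      then have "is_partition ls" "sum_list ls = a ! i" using \<Lambda> by (auto simp: \<L>_def)
      moreover have "a ! i \<le> sum_list a" using i(1) len by (auto intro!: member_le_sum_list)
      moreover have "x \<le> sum_list ls" if "x \<in> set ls" for x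
        using member_le_sum_list[OF that] by simp
      ultimately show "is_partition ls \<and> (\<forall>x\<in>set ls. x \<le> N)"
        by (fastforce simp: N_def)
    qed
    have "{As \<in> subgroup_chains s m. \<forall>i<m. card (rcosets\<^bsub>L\<^esub> (As ! i)) = p ^ (a ! i)} =
        (\<Union>\<Lambda>\<in>\<L>. lattice_type_chains s \<Lambda> p)" (is "?I = ?U")
    proof
      show "?I \<subseteq> ?U"
      proof
        fix As assume As: "As \<in> ?I"
        then have "\<forall>i<m. \<exists>ls. is_partition ls \<and> has_type p ls (L Mod (As ! i)) \<and> sum_list ls = a ! i"
          using has_type_if_card_rcosets by (auto simp: subgroup_chains_def)
        then obtain F where F: "\<And>i. i < m \<Longrightarrow> is_partition (F i) \<and> has_type p (F i) (L Mod (As ! i)) \<and> sum_list (F i) = a ! i"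
          by metis
        have "map F [0..<m] \<in> \<L>" using F by (simp add: \<L>_def)
        moreover have "As \<in> lattice_type_chains s (map F [0..<m]) p"
          using As F has_type_finite_rcosets(1)[OF _ p_pos] by (auto simp: lattice_type_chains_def)
        ultimately show "As \<in> ?U" by blast
      qed
      show "?U \<subseteq> ?I"
        using has_type_finite_rcosets(2)[OF _ p_pos] by (fastforce simp: \<L>_def lattice_type_chains_def)
    qed
    moreover have "\<forall>\<Lambda>\<in>\<L>. \<forall>\<Lambda>'\<in>\<L>. \<Lambda> \<noteq> \<Lambda>' \<longrightarrow>
        lattice_type_chains s \<Lambda> p \<inter> lattice_type_chains s \<Lambda>' p = {}"
    proof (intro ballI impI)
      fix \<Lambda> \<Lambda>' assume *: "\<Lambda> \<in> \<L>" "\<Lambda>' \<in> \<L>" "\<Lambda> \<noteq> \<Lambda>'"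
      show "lattice_type_chains s \<Lambda> p \<inter> lattice_type_chains s \<Lambda>' p = {}"
      proof (rule ccontr)
        assume "\<not> ?thesis"
        then obtain As where As: "As \<in> lattice_type_chains s \<Lambda> p" "As \<in> lattice_type_chains s \<Lambda>' p" by blast
        have "\<Lambda> ! i = \<Lambda>' ! i" if i: "i < m" for i
        proof (rule comm_group.has_type_unique[OF L.comm_group_FactGroup prime_p])
          show "subgroup (As ! i) L" "has_type p (\<Lambda> ! i) (L Mod (As ! i))" "has_type p (\<Lambda>' ! i) (L Mod (As ! i))"
            using As * i by (auto simp: lattice_type_chains_def subgroup_chains_def \<L>_def)
        qed (use * i in \<open>auto simp: \<L>_def\<close>)
        then show False using * by (auto simp: \<L>_def list_eq_iff_nth_eq)
      qed
    qed
    ultimately have "alpha_index s S p = (\<Sum>\<Lambda>\<in>\<L>. card (lattice_type_chains s \<Lambda> p))"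
      unfolding alpha_index_def m_def[symmetric] a_def[symmetric]
      using fin card_lattice_type_chains(1)[OF parts] by (simp add: card_UN_disjoint)
    also have "\<dots> = (\<Sum>\<Lambda>\<in>\<L>. poly (chain_poly (replicate s N) (rev \<Lambda>)) p)"
      by (rule sum.cong) (simp_all add: card_lattice_type_chains(2)[OF parts])
    finally show ?thesis by (simp add: f_def poly_sum)
  qed
  then show ?thesis by blast
qed

lemma alpha_type_eq_poly:
  assumes "\<forall>ls\<in>set \<Lambda>. is_partition ls"
  shows "\<exists>f :: nat poly. (\<forall>p. prime p \<longrightarrow> alpha_type s \<Lambda> p = poly f p) \<and>
    unimodal (\<lambda>i. real (coeff f i)) (degree f)"
proof -
  \<comment> \<open>A bound for all parts that is positive and independent of p.\<close>
  define N where "N = Suc (sum_list (concat \<Lambda>))"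
  define f where "f = chain_poly (replicate s N) (rev \<Lambda>)"
  have "x \<le> N" if "ls \<in> set \<Lambda>" "x \<in> set ls" for ls x
  proof -
    have "x \<in> set (concat \<Lambda>)" using that by auto
    from member_le_sum_list[OF this] show ?thesis by (simp add: N_def)
  qed
  then have parts: "\<forall>ls\<in>set \<Lambda>. is_partition ls \<and> (\<forall>x\<in>set ls. x \<le> N)"
    using assms by blast
  have "alpha_type s \<Lambda> p = poly f p" if p: "prime p" for p
  proof -
    interpret prime_power_lattice s p N
      by unfold_locales (use p in \<open>simp_all add: N_def\<close>)
    show ?thesis
      using card_lattice_type_chains(2)[OF parts]
      by (simp add: alpha_type_def lattice_type_chains_def f_def)
  qed
  moreover have "unimodal (\<lambda>i. real (coeff f i)) (degree f)"
    using sym_unimodal_chain_poly unimodal_if_sym_unimodal unfolding f_def by blast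
  ultimately show ?thesis by blast
qed

theorem theorem1p14:
  fixes s m :: nat
  assumes "0 < s" and "0 < m"
  shows "(\<forall>S :: nat set. finite S \<and> card S = m \<longrightarrow>
            (\<exists>f :: nat poly. \<forall>p :: nat. prime p \<longrightarrow> alpha_index s S p = poly f p)) \<and>
         (\<forall>\<Lambda> :: nat list list.
            length \<Lambda> = m \<and>
            (\<forall>ls\<in>set \<Lambda>. is_partition ls \<and> length ls \<le> s) \<and>
            (\<forall>i. Suc i < m \<longrightarrow> partition_le (\<Lambda> ! i) (\<Lambda> ! Suc i)) \<longrightarrow>
            (\<exists>f :: nat poly.
               (\<forall>p :: nat. prime p \<longrightarrow> alpha_type s \<Lambda> p = poly f p) \<and>
               unimodal (\<lambda>i. real (coeff f i)) (degree f)))"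
  using alpha_index_eq_poly alpha_type_eq_poly by blast

end
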